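(* Let $\hat g_1,\dots,\hat g_m$ be linearly independent traceless Hermitian $N\times N$ matrices, let $\boldsymbol\alpha\in\mathbb R^m\setminus\{0\}$, let $\hat H_0=\sum_{j=1}^m\theta_j\hat g_j$ with $\boldsymbol\theta\in\mathbb R^m$ unknown, and let $q=\boldsymbol\alpha\cdot\boldsymbol\theta$ and $t>0$. Let $\gamma=\gamma(\hat{\boldsymbol g}\mid\boldsymbol\alpha)$ be the minimum of $\tfrac12\|\hat A\|_1$ over Hermitian $N\times N$ matrices $\hat A$ with $\mathrm{Tr}(\hat A\hat g_j)=\alpha_j$ for all $j$ and $\mathrm{Tr}(\hat A)=0$. Let $\hat A=\sum_{k=0}^{N-1}a_k|k\rangle\langle k|$ be a minimizer, diagonalized in an orthonormal basis $\{|k\rangle\}_{k=0}^{N-1}$. Put $\mathcal X=\{k:a_k>0\}=\{x_1,\dots,x_p\}$, $\mathcal Y=\{k:a_k<0\}=\{y_1,\dots,y_l\}$ and $\hat H_{\rm eff}=\sum_k\langle k|\hat H_0|k\rangle\,|k\rangle\langle k|$. Then: (i) (Projection onto the diagonal.) With $\hat U_s=\sum_{k=0}^{N-1}e^{2\pi i sk/N}|k\rangle\langle k|$, one has $\frac1N\sum_{s=0}^{N-1}\hat U_s^\dagger\hat H_0\hat U_s=\hat H_{\rm eff}$. (ii) (Reshaping by randomized evolution.) Let $\hat V=\prod_{l'=1}^{L}\hat U_{s_{l'}}^\dagger e^{-i\hat H_0\Delta t}\hat U_{s_{l'}}$ with $\Delta t=t/L$ and each $s_{l'}$ sampled uniformly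 at random from $\{0,\dots,N-1\}$. With high probability, $\hat V$ approximates $e^{-i\hat H_{\rm eff}t}$ to additive error $\epsilon$, that is, $\|e^{-i\hat H_{\rm eff}t}-\hat V\|\le\epsilon$, when the number of steps satisfies $$L=\Omega\!\left(\frac{\log(N)\,\lambda^2t^2}{\epsilon^2}\right),\qquad \lambda=\|\hat H_0\|,$$ where $\|\cdot\|$ is the spectral norm. (iii) (Phase accumulation.) The swap protocol run under $\hat H_{\rm eff}$ for total time $t$ (defined in the context) produces, up to a global phase, the state $\frac1{\sqrt2}\big(|x_p\rangle+e^{i\Phi}|y_l\rangle\big)$ with $$\Phi=\frac{2t}{\|\hat A\|_1}\sum_j\theta_j\,\mathrm{Tr}(\hat A\hat g_j)=\frac{q\,t}{\gamma(\hat{\boldsymbol g}\mid\boldsymbol\alpha)}.$$ (iv) (Saturation.) Measuring the operator $i|x_p\rangle\langle y_l|+\text{h.c.}$ on this state gives an estimator of $q$ with variance $$\mathrm{Var}(q_{\rm est})=\frac{\gamma^2(\hat{\boldsymbol g}\mid\boldsymbol\alpha)}{t^2},$$ which saturates the lower bound $\mathrm{Var}(q_{\rm est})\ge\gamma^2(\hat{\boldsymbol g}\mid\boldsymbol\alpha)/t^2$ valid for unbiased estimators. This variance refers to evolution under $\hat H_{\rm eff}$. When that evolution is implemented by the randomized reshaping of (ii), the reshaping error can bias the estimator, but this bias can be made arbitrarily small by increasing $L$, so that its contribution is negligible compared with the optimal variance. (v) (Number of switches.) The number of control switches (swaps) in the protocol is less than $\mathrm{rank}(\hat A)$. Moreover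 the minimizer $\hat A$ can always be chosen with $\mathrm{rank}(\hat A)\le m+1$, so that $|\mathcal X|+|\mathcal Y|\le m+1$ and the number of switches is less than $m$.
   Context: $\|\hat A\|_1=\mathrm{Tr}\sqrt{\hat A^\dagger\hat A}$ is the trace norm. Evolution for time $\tau$ under a constant Hamiltonian $\hat H$ is $e^{-i\hat H\tau}$. Setting: the system evolves for total time $t$ under $\hat H_0+\hat H_c(s)$, where $\hat H_c(s)$ is an arbitrary, arbitrarily fast, $\boldsymbol\theta$-independent control Hamiltonian (possibly also acting on ancillas). Arbitrary state preparation and final measurement are allowed. The figure of merit is the minimal variance of an unbiased estimator of $q$, and in this setting every unbiased estimator satisfies $\mathrm{Var}(q_{\rm est})\ge\gamma^2(\hat{\boldsymbol g}\mid\boldsymbol\alpha)/t^2$. Conjugated evolutions $\hat U_s^\dagger e^{-i\hat H_0\Delta t}\hat U_s$ are produced by applying $\hat U_s$ and $\hat U_s^\dagger$ as fast control pulses before and after evolving under $\hat H_0$ for time $\Delta t$. Swap unitary: $\hat S_{k,k'}=|k\rangle\langle k'|+|k'\rangle\langle k|+\sum_{k''\ne k,k'}|k''\rangle\langle k''|$ for $k\ne k'$. Swap protocol under $\hat H_{\rm eff}$ for time $t$: start in $\frac1{\sqrt2}(|x_1\rangle+|y_1\rangle)$ and evolve under $\hat H_{\rm eff}$ for total time $t$. The first branch occupies $|x_1\rangle,\dots,|x_p\rangle$ successively, spending time $a_{x_i}t/\sum_{x\in\mathcal X}a_x$ in $|x_i\rangle$, with $\hat S_{x_i,x_{i+1}}$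 applied instantaneously between consecutive intervals. Simultaneously, the second branch occupies $|y_1\rangle,\dots,|y_l\rangle$ successively, spending time $a_{y_i}t/\sum_{y\in\mathcal Y}a_y$ in $|y_i\rangle$, with $\hat S_{y_i,y_{i+1}}$ applied instantaneously between consecutive intervals.
   Formalization: In (iv) cos Φ ≠ 0 is assumed (at cos Φ = 0 the outcome is deterministic, so the variance is 0), and the saturating estimator is locally unbiased at θ; the lower bound is proved for finite-outcome measurements and finite-dimensional ancillas. *)

theory Defs
  imports "HOL-Probability.Probability"
begin

text \<open>
  Operators on an \<open>N\<close>-dimensional Hilbert space are matrices of type \<open>complex^'n^'n\<close> with
  \<open>N = CARD('n)\<close>. On this type \<open>*\<close> and \<open>exp\<close> are not the matrix operations (\<open>*\<close> is entrywise),
  hence \<open>**\<close>, and \<open>mexp\<close> below. The type of complex vectors carries the Euclidean norm, so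
  \<open>onorm ((*v) A)\<close> is the spectral norm of \<open>A\<close>.
\<close>

type_synonym 'n cvec = "complex^'n"
type_synonym 'n cmat = "complex^'n^'n"

section \<open>Linear algebra\<close>

definition cscale :: "complex \<Rightarrow> 'n cmat \<Rightarrow> 'n::finite cmat" where
  "cscale c A = (\<chi> i j. c * A $ i $ j)"

definition dagger :: "'n cmat \<Rightarrow> 'n::finite cmat" where
  "dagger A = (\<chi> i j. cnj (A $ j $ i))"

definition hermitian :: "'n::finite cmat \<Rightarrow> bool" where
  "hermitian A \<longleftrightarrow> dagger A = A"

definition unitary :: "'n::finite cmat \<Rightarrow> bool" where
  "unitary U \<longleftrightarrow> dagger U ** U = mat 1 \<and> U ** dagger U = mat 1"

definition braket :: "'n cvec \<Rightarrow> 'n::finite cvec \<Rightarrow> complex" where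
  "braket u v = (\<Sum>i\<in>UNIV. cnj (u $ i) * v $ i)"

definition ketbra :: "'n cvec \<Rightarrow> 'n cvec \<Rightarrow> 'n::finite cmat" where
  "ketbra u v = (\<chi> i j. u $ i * cnj (v $ j))"

definition psd :: "'n::finite cmat \<Rightarrow> bool" where
  "psd A \<longleftrightarrow> hermitian A \<and> (\<forall>v. 0 \<le> Re (braket v (A *v v)))"

definition msqrt :: "'n cmat \<Rightarrow> 'n::finite cmat" where
  "msqrt A = (THE B. psd B \<and> B ** B = A)"

definition trace_norm :: "'n::finite cmat \<Rightarrow> real" where
  "trace_norm A = Re (trace (msqrt (dagger A ** A)))"

definition spectral_norm :: "'n::finite cmat \<Rightarrow> real" where
  "spectral_norm A = onorm (\<lambda>v. A *v v)"

definition mpow :: "'n cmat \<Rightarrow> nat \<Rightarrow> 'n::finite cmat" where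
  "mpow A k = (((**) A) ^^ k) (mat 1)"

definition mexp :: "'n cmat \<Rightarrow> 'n::finite cmat" where
  "mexp A = (\<Sum>k. (1 / fact k) *\<^sub>R mpow A k)"

definition evol :: "'n cmat \<Rightarrow> real \<Rightarrow> 'n::finite cmat" where
  "evol H \<tau> = mexp (cscale (- \<i> * complex_of_real \<tau>) H)"

text \<open>Only the values \<open>b k\<close> with \<open>k < N\<close> matter.\<close>

definition orthonormal_basis :: "(nat \<Rightarrow> 'n::finite cvec) \<Rightarrow> bool" where
  "orthonormal_basis b \<longleftrightarrow>
     (\<forall>i<CARD('n). \<forall>j<CARD('n). braket (b i) (b j) = (if i = j then 1 else 0))"

definition diagonalizes :: "(nat \<Rightarrow> 'n cvec) \<Rightarrow> (nat \<Rightarrow> real) \<Rightarrow> 'n::finite cmat \<Rightarrow> bool" where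
  "diagonalizes b a A \<longleftrightarrow> orthonormal_basis b \<and>
     A = (\<Sum>k<CARD('n). a k *\<^sub>R ketbra (b k) (b k))"

section \<open>The optimization problem\<close>

definition drift :: "('m \<Rightarrow> 'n cmat) \<Rightarrow> real^'m::finite \<Rightarrow> 'n::finite cmat" where
  "drift g \<theta> = (\<Sum>j\<in>UNIV. \<theta> $ j *\<^sub>R g j)"

definition feasible :: "('m \<Rightarrow> 'n cmat) \<Rightarrow> real^'m::finite \<Rightarrow> 'n::finite cmat set" where
  "feasible g \<alpha> = {A. hermitian A \<and>
     (\<forall>j. trace (A ** g j) = complex_of_real (\<alpha> $ j)) \<and> trace A = 0}"

definition minimizer :: "('m \<Rightarrow> 'n cmat) \<Rightarrow> real^'m::finite \<Rightarrow> 'n::finite cmat \<Rightarrow> bool" where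
  "minimizer g \<alpha> A \<longleftrightarrow> A \<in> feasible g \<alpha> \<and>
     (\<forall>B\<in>feasible g \<alpha>. trace_norm A / 2 \<le> trace_norm B / 2)"

definition gamma :: "('m \<Rightarrow> 'n::finite cmat) \<Rightarrow> real^'m::finite \<Rightarrow> real" where
  "gamma g \<alpha> = Inf ((\<lambda>A. trace_norm A / 2) ` feasible g \<alpha>)"

section \<open>Reshaping\<close>

definition phase_unitary :: "(nat \<Rightarrow> 'n cvec) \<Rightarrow> nat \<Rightarrow> 'n::finite cmat" where
  "phase_unitary b s =
     (\<Sum>k<CARD('n). cscale (cis (2 * pi * real s * real k / real CARD('n))) (ketbra (b k) (b k)))"

definition diag_part :: "(nat \<Rightarrow> 'n cvec) \<Rightarrow> 'n cmat \<Rightarrow> 'n::finite cmat" where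
  "diag_part b H = (\<Sum>k<CARD('n). cscale (braket (b k) (H *v b k)) (ketbra (b k) (b k)))"

fun conjugated_product :: "(nat \<Rightarrow> 'n cvec) \<Rightarrow> 'n cmat \<Rightarrow> real \<Rightarrow> nat list \<Rightarrow> 'n::finite cmat" where
  "conjugated_product b H \<Delta> [] = mat 1"
| "conjugated_product b H \<Delta> (s # ss) =
     (dagger (phase_unitary b s) ** evol H \<Delta> ** phase_unitary b s) ** conjugated_product b H \<Delta> ss"

text \<open>The random operator \<open>V\<close>: \<open>L\<close> independent uniform indices, total duration \<open>\<tau>\<close>.\<close>

definition reshaped_evol ::
  "(nat \<Rightarrow> 'n cvec) \<Rightarrow> 'n cmat \<Rightarrow> nat \<Rightarrow> real \<Rightarrow> 'n::finite cmat pmf" where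
  "reshaped_evol b H L \<tau> =
     map_pmf (conjugated_product b H (\<tau> / real L)) (replicate_pmf L (pmf_of_set {..<CARD('n)}))"

section \<open>The swap protocol\<close>

definition swap_unitary :: "(nat \<Rightarrow> 'n cvec) \<Rightarrow> nat \<Rightarrow> nat \<Rightarrow> 'n::finite cmat" where
  "swap_unitary b k k' = ketbra (b k) (b k') + ketbra (b k') (b k) +
     (\<Sum>k''\<in>{..<CARD('n)} - {k, k'}. ketbra (b k'') (b k''))"

text \<open>
  A pulse is a pair of an application time and a unitary. In the branch running through
  \<open>zs = [z\<^sub>1, z\<^sub>2, \<dots>]\<close> the swap of \<open>z\<^sub>i\<close> and \<open>z\<^sub>i\<^sub>+\<^sub>1\<close> happens when the dwell times
  \<open>a z\<^sub>j * t / (\<Sum>z. a z)\<close>, \<open>j \<le> i\<close>, have elapsed. The pulses of both branches act on the whole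
  system and are merged in time order.
\<close>

definition branch_pulses ::
  "(nat \<Rightarrow> 'n cvec) \<Rightarrow> (nat \<Rightarrow> real) \<Rightarrow> real \<Rightarrow> nat list \<Rightarrow> (real \<times> 'n::finite cmat) list" where
  "branch_pulses b a t zs =
     map (\<lambda>i. (\<Sum>j\<le>i. a (zs ! j) * t / (\<Sum>z\<in>set zs. a z), swap_unitary b (zs ! i) (zs ! Suc i)))
       [0..<length zs - 1]"

definition swap_schedule ::
  "(nat \<Rightarrow> 'n cvec) \<Rightarrow> (nat \<Rightarrow> real) \<Rightarrow> real \<Rightarrow> nat list \<Rightarrow> nat list \<Rightarrow> (real \<times> 'n::finite cmat) list"
  where
  "swap_schedule b a t xs ys = sort_key fst (branch_pulses b a t xs @ branch_pulses b a t ys)"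

text \<open>
  Propagator from time \<open>s\<close> to time \<open>T\<close> with free evolution \<open>E \<tau>\<close> for duration \<open>\<tau>\<close> between
  the pulses; in the second version the free evolutions are random and independent.
\<close>

fun pulsed :: "(real \<Rightarrow> 'n cmat) \<Rightarrow> real \<Rightarrow> (real \<times> 'n cmat) list \<Rightarrow> real \<Rightarrow> 'n::finite cmat" where
  "pulsed E s [] T = E (T - s)"
| "pulsed E s ((r, S) # ps) T = pulsed E r ps T ** S ** E (r - s)"

fun random_pulsed ::
  "(real \<Rightarrow> 'n cmat pmf) \<Rightarrow> real \<Rightarrow> (real \<times> 'n cmat) list \<Rightarrow> real \<Rightarrow> 'n::finite cmat pmf" where
  "random_pulsed E s [] T = E (T - s)"
| "random_pulsed E s ((r, S) # ps) T =
     bind_pmf (E (r - s)) (\<lambda>V. map_pmf (\<lambda>W. W ** S ** V) (random_pulsed E r ps T))"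

definition initial_state :: "(nat \<Rightarrow> 'n cvec) \<Rightarrow> nat list \<Rightarrow> nat list \<Rightarrow> 'n::finite cvec" where
  "initial_state b xs ys = (1 / sqrt 2) *\<^sub>R (b (hd xs) + b (hd ys))"

definition swap_state ::
  "(nat \<Rightarrow> 'n cvec) \<Rightarrow> (nat \<Rightarrow> real) \<Rightarrow> real \<Rightarrow> nat list \<Rightarrow> nat list \<Rightarrow> 'n cmat \<Rightarrow> 'n::finite cvec" where
  "swap_state b a t xs ys H =
     pulsed (evol (diag_part b H)) 0 (swap_schedule b a t xs ys) t *v initial_state b xs ys"

text \<open>Each free interval of the schedule is implemented by \<open>L\<close> randomized steps.\<close>

definition random_swap_state ::
  "(nat \<Rightarrow> 'n cvec) \<Rightarrow> (nat \<Rightarrow> real) \<Rightarrow> real \<Rightarrow> nat list \<Rightarrow> nat list \<Rightarrow> 'n cmat \<Rightarrow> nat \<Rightarrow>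
    'n::finite cvec pmf" where
  "random_swap_state b a t xs ys H L =
     map_pmf (\<lambda>W. W *v initial_state b xs ys)
       (random_pulsed (reshaped_evol b H L) 0 (swap_schedule b a t xs ys) t)"

section \<open>Measurement and estimation\<close>

definition density_operator :: "'n::finite cmat \<Rightarrow> bool" where
  "density_operator \<rho> \<longleftrightarrow> psd \<rho> \<and> trace \<rho> = 1"

text \<open>
  Measurements have finitely many outcomes, labelled by real numbers; an estimator is a function
  of the outcome.
\<close>

definition povm :: "(real \<Rightarrow> 'n::finite cmat) \<Rightarrow> bool" where
  "povm E \<longleftrightarrow> finite {x. E x \<noteq> 0} \<and> (\<forall>x. psd (E x)) \<and> (\<Sum>x\<in>{x. E x \<noteq> 0}. E x) = mat 1"

definition est_mean :: "(real \<Rightarrow> 'n cmat) \<Rightarrow> (real \<Rightarrow> real) \<Rightarrow> 'n::finite cmat \<Rightarrow> real" where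
  "est_mean E f \<rho> = (\<Sum>x\<in>{x. E x \<noteq> 0}. f x * Re (trace (\<rho> ** E x)))"

definition est_var :: "(real \<Rightarrow> 'n cmat) \<Rightarrow> (real \<Rightarrow> real) \<Rightarrow> 'n::finite cmat \<Rightarrow> real" where
  "est_var E f \<rho> = (\<Sum>x\<in>{x. E x \<noteq> 0}. (f x - est_mean E f \<rho>)\<^sup>2 * Re (trace (\<rho> ** E x)))"

text \<open>
  Measuring an observable \<open>M\<close>: outcome \<open>x\<close> corresponds to the orthogonal projection onto the
  eigenspace of \<open>M\<close> for \<open>x\<close>, which is \<open>0\<close> unless \<open>x\<close> is an eigenvalue.
\<close>

definition observable :: "'n cmat \<Rightarrow> real \<Rightarrow> 'n::finite cmat" where
  "observable M x = (THE P. hermitian P \<and> P ** P = P \<and>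
     range (\<lambda>v. P *v v) = {v. M *v v = complex_of_real x *s v})"

text \<open>Unbiasedness for \<open>q = \<alpha> \<bullet> \<theta>\<close>, in terms of the mean of the estimator as a function of \<open>\<theta>\<close>.\<close>

definition unbiased :: "real^'m::finite \<Rightarrow> (real^'m \<Rightarrow> real) \<Rightarrow> bool" where
  "unbiased \<alpha> \<mu> \<longleftrightarrow> (\<forall>\<theta>. \<mu> \<theta> = \<alpha> \<bullet> \<theta>)"

definition locally_unbiased :: "real^'m::finite \<Rightarrow> real^'m \<Rightarrow> (real^'m \<Rightarrow> real) \<Rightarrow> bool" where
  "locally_unbiased \<alpha> \<theta> \<mu> \<longleftrightarrow> \<mu> \<theta> = \<alpha> \<bullet> \<theta> \<and> (\<mu> has_derivative (\<lambda>v. \<alpha> \<bullet> v)) (at \<theta>)"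

section \<open>Controlled evolutions\<close>

definition with_ancilla :: "'n cmat \<Rightarrow> ('n::finite \<times> 'k::finite) cmat" where
  "with_ancilla A = (\<chi> r c. if snd r = snd c then A $ fst r $ fst c else 0)"

text \<open>
  \<open>controlled H t U\<close>: \<open>U \<theta>\<close> is the propagator over total time \<open>t\<close> under \<open>H \<theta> + H\<^sub>c(s)\<close> for a
  control \<open>H\<^sub>c\<close> not depending on \<open>\<theta>\<close>. The control may change abruptly, and the limit of
  arbitrarily fast control is included in the form of instantaneous unitary pulses.
\<close>

inductive controlled ::
  "(real^'m::finite \<Rightarrow> 'd::finite cmat) \<Rightarrow> real \<Rightarrow> (real^'m \<Rightarrow> 'd cmat) \<Rightarrow> bool" for H where
  pulse: "unitary W \<Longrightarrow> controlled H 0 (\<lambda>_. W)"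
| drive: "\<lbrakk>0 \<le> \<tau>; \<And>s. s \<in> {0..\<tau>} \<Longrightarrow> hermitian (Hc s); \<And>\<theta>. U \<theta> 0 = mat 1;
     \<And>\<theta> s. s \<in> {0..\<tau>} \<Longrightarrow>
       (U \<theta> has_vector_derivative cscale (- \<i>) ((H \<theta> + Hc s) ** U \<theta> s)) (at s within {0..\<tau>})\<rbrakk>
   \<Longrightarrow> controlled H \<tau> (\<lambda>\<theta>. U \<theta> \<tau>)"
| seq: "\<lbrakk>controlled H \<tau>\<^sub>1 U\<^sub>1; controlled H \<tau>\<^sub>2 U\<^sub>2\<rbrakk> \<Longrightarrow> controlled H (\<tau>\<^sub>1 + \<tau>\<^sub>2) (\<lambda>\<theta>. U\<^sub>2 \<theta> ** U\<^sub>1 \<theta>)"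

end

theory Submission
  imports Defs
begin

text \<open>
  Lower bound. By convex duality there is a direction \<open>v\<close> with \<open>\<alpha> \<bullet> v > 0\<close> such that the spread of the
  spectrum of \<open>\<Sum>\<^sub>j v\<^sub>j g\<^sub>j\<close> is at most \<open>(\<alpha> \<bullet> v) / \<gamma>\<close>. Shifting \<open>\<theta>\<close> by \<open>\<epsilon> v\<close> changes any controlled
  propagator, up to a phase, by at most \<open>\<epsilon> t\<close> times half that spread, and the Cauchy-Schwarz
  inequality converts this into a bound on the sensitivity of the mean by the standard deviation.

  Saturation. The two branches of the swap protocol weight the diagonal of \<open>H\<^sub>0\<close> by the normalized
  positive and negative parts of \<open>A\<close>, so that the relative phase is proportional to \<open>Tr (A H\<^sub>0) = q\<close>.

  Reshaping. In the rotating frame the random product is a matrix martingale up to a small drift.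
  The even trace moments of its Hermitian and skew-Hermitian parts are at most those of a sum of
  random signs, and a moment of order \<open>log N\<close> gives the tail bound.

  Rank. Among the minimizers diagonal in a fixed eigenbasis take one of least rank: with more than
  \<open>m + 1\<close> nonzero eigenvalues these could be moved, at constant trace norm, until one of them vanishes.
\<close>

text \<open>The mean of the interference measurement is a sine of \<open>q\<close>, hence bounded,
  and can match the linear function \<open>q\<close> only to first order at a point. Attainability
  is therefore a statement about local unbiasedness where the cosine does not vanish, and the lower
  bound has to cover that wider class. It works with finite increments of the mean, since the rules
  of \<open>controlled\<close> give a Lipschitz estimate at each constructor but say nothing about
  derivatives of the propagator in the parameter.

  For the random product the obstacle is that the increments neither commute nor are Hermitian. Even
  trace moments cope with noncommutativity: differentiating twice in the size of a single increment
  \<open>Y\<close> leaves words with two factors \<open>Y\<close> separated by powers of one matrix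
  \<open>Z\<close>, and these can be evaluated in an eigenbasis of \<open>Z\<close>. Dividing the
  moment of order \<open>2 * q\<close> by \<open>fact (2 * q)\<close> turns the recursion over
  increments into a binomial convolution, so that variance proxies simply add. Splitting into two
  Hermitian martingales supplies Hermiticity at the cost of a factor two in probability and
  error.\<close>

lemma dagger_nth: "dagger A $ i $ j = cnj (A $ j $ i)" by (simp add: dagger_def)
lemma cscale_nth: "cscale c A $ i $ j = c * A $ i $ j" by (simp add: cscale_def)
lemma ketbra_nth: "ketbra u v $ i $ j = u $ i * cnj (v $ j)" by (simp add: ketbra_def)
lemma matrix_mult_nth: "(A ** B) $ i $ j = (\<Sum>k\<in>UNIV. A $ i $ k * B $ k $ j)"
  by (simp add: matrix_matrix_mult_def)
lemma mv_nth: "(A *v v) $ i = (\<Sum>k\<in>UNIV. A $ i $ k * v $ k)"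
  by (simp add: matrix_vector_mult_def)

lemmas mat_nth = dagger_nth cscale_nth ketbra_nth matrix_mult_nth mv_nth

section \<open>Linear algebra: norms, spectral theory, trace norm and rank of complex
  matrices\<close>

section \<open>Products, adjoints and scalars\<close>

lemma dagger_dagger [simp]: "dagger (dagger A) = A" by (simp add: vec_eq_iff mat_nth)
lemma dagger_add: "dagger (A + B) = dagger A + dagger B" by (simp add: vec_eq_iff mat_nth)
lemma dagger_diff: "dagger (A - B) = dagger A - dagger B" by (simp add: vec_eq_iff mat_nth)
lemma dagger_0 [simp]: "dagger 0 = 0" by (simp add: vec_eq_iff mat_nth)
lemma dagger_mat1 [simp]: "dagger (mat 1) = mat 1" by (simp add: vec_eq_iff mat_nth mat_def)
lemma dagger_cscale: "dagger (cscale c A) = cscale (cnj c) (dagger A)" by (simp add: vec_eq_iff mat_nth)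
lemma dagger_scaleR: "dagger (r *\<^sub>R A) = r *\<^sub>R dagger A" by (simp add: vec_eq_iff mat_nth)
lemma dagger_ketbra: "dagger (ketbra u v) = ketbra v u" by (simp add: vec_eq_iff mat_nth mult.commute)
lemma dagger_sum: "dagger (\<Sum>k\<in>S. f k) = (\<Sum>k\<in>S. dagger (f k))"
  by (induction S rule: infinite_finite_induct) (auto simp: dagger_add)
lemma dagger_mult: "dagger (A ** B) = dagger B ** dagger A"
  by (simp add: vec_eq_iff mat_nth mult.commute)

lemma scaleR_cscale: "r *\<^sub>R A = cscale (complex_of_real r) A"
  by (simp add: vec_eq_iff mat_nth scaleR_conv_of_real[where 'a=complex])
lemma cscale_1 [simp]: "cscale 1 A = A" by (simp add: vec_eq_iff mat_nth)
lemma cscale_0 [simp]: "cscale 0 A = 0" by (simp add: vec_eq_iff mat_nth)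
lemma cscale_0_right [simp]: "cscale c 0 = 0" by (simp add: vec_eq_iff mat_nth)
lemma cscale_cscale: "cscale c (cscale d A) = cscale (c * d) A" by (simp add: vec_eq_iff mat_nth mult.assoc)
lemma cscale_add_right: "cscale c (A + B) = cscale c A + cscale c B"
  by (simp add: vec_eq_iff mat_nth algebra_simps)
lemma cscale_diff_right: "cscale c (A - B) = cscale c A - cscale c B"
  by (simp add: vec_eq_iff mat_nth algebra_simps)
lemma cscale_add_left: "cscale (c + d) A = cscale c A + cscale d A"
  by (simp add: vec_eq_iff mat_nth algebra_simps)
lemma cscale_diff_left: "cscale (c - d) A = cscale c A - cscale d A"
  by (simp add: vec_eq_iff mat_nth algebra_simps)
lemma cscale_uminus_left: "cscale (- c) A = - cscale c A"
  by (simp add: vec_eq_iff mat_nth)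
lemma cscale_sum_right: "cscale c (\<Sum>k\<in>S. f k) = (\<Sum>k\<in>S. cscale c (f k))"
  by (induction S rule: infinite_finite_induct) (auto simp: cscale_add_right)
lemma cscale_mult_left: "cscale c A ** B = cscale c (A ** B)"
  by (simp add: vec_eq_iff mat_nth sum_distrib_left mult.assoc)
lemma cscale_mult_right: "A ** cscale c B = cscale c (A ** B)"
  by (simp add: vec_eq_iff mat_nth sum_distrib_left mult_ac)
lemma cscale_mv: "cscale c A *v v = c *s (A *v v)"
  by (simp add: vec_eq_iff mat_nth sum_distrib_left mult.assoc)
lemma mv_cscale: "A *v (c *s v) = c *s (A *v v)" for A :: "'n::finite cmat"
  by (simp add: vec_eq_iff mat_nth sum_distrib_left mult_ac)

lemma mult_diff_left: "(A - B) ** C = A ** C - B ** C" for A :: "'n::finite cmat"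
  by (simp add: vec_eq_iff mat_nth algebra_simps sum_subtractf)
lemma mult_diff_right: "A ** (B - C) = A ** B - A ** C" for A :: "'n::finite cmat"
  by (simp add: vec_eq_iff mat_nth algebra_simps sum_subtractf)
lemma mult_add_left: "(A + B) ** C = A ** C + B ** C" for A :: "'n::finite cmat"
  by (simp add: vec_eq_iff mat_nth algebra_simps sum.distrib)
lemma mult_sum_left: "(\<Sum>k\<in>S. f k) ** C = (\<Sum>k\<in>S. f k ** C)" for C :: "'n::finite cmat" and f :: "_ \<Rightarrow> 'n cmat"
  by (induction S rule: infinite_finite_induct) (auto simp: mult_add_left)
lemma mult_sum_right: "C ** (\<Sum>k\<in>S. f k) = (\<Sum>k\<in>S. C ** f k)" for C :: "'n::finite cmat"
  by (induction S rule: infinite_finite_induct) (auto simp: matrix_add_ldistrib)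
lemma mmult_scaleR_left: "(r *\<^sub>R A) ** B = r *\<^sub>R (A ** B)" for A B :: "'n::finite cmat"
  by (simp add: scaleR_cscale[where A=A] scaleR_cscale[where A="A ** B"] cscale_mult_left)
lemma mmult_scaleR_right: "A ** (r *\<^sub>R B) = r *\<^sub>R (A ** B)" for A B :: "'n::finite cmat"
  by (simp add: scaleR_cscale[where A=B] scaleR_cscale[where A="A ** B"] cscale_mult_right)
lemma sum_mv: "(\<Sum>k\<in>S. f k) *v v = (\<Sum>k\<in>S. f k *v v)" for v :: "'n::finite cvec"
  by (induction S rule: infinite_finite_induct) (auto simp: matrix_vector_mult_add_rdistrib)
lemma mv_sum: "A *v (\<Sum>k\<in>S. f k) = (\<Sum>k\<in>S. A *v f k)" for A :: "'n::finite cmat"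
  by (induction S rule: infinite_finite_induct) (auto simp: matrix_vector_right_distrib)
lemma scaleR_mv: "(r *\<^sub>R A) *v v = r *\<^sub>R (A *v v)" for A :: "'n::finite cmat"
  by (simp add: vec_eq_iff mat_nth scaleR_sum_right)

lemma ketbra_mv: "ketbra u v *v w = braket v w *s u"
  by (simp add: vec_eq_iff mat_nth braket_def sum_distrib_left sum_distrib_right mult_ac)
lemma mult_ketbra: "A ** ketbra u v = ketbra (A *v u) v"
  by (simp add: vec_eq_iff mat_nth sum_distrib_left sum_distrib_right mult_ac)
lemma trace_ketbra: "trace (ketbra u v) = braket v u"
  by (simp add: trace_def mat_nth braket_def mult_ac)
lemma trace_cscale: "trace (cscale c A) = c * trace A"
  by (simp add: trace_def mat_nth sum_distrib_left)
lemma trace_scaleR: "trace (r *\<^sub>R A) = r *\<^sub>R trace A" for A :: "'n::finite cmat"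
  by (simp add: trace_def scaleR_sum_right)
lemma trace_sum: "trace (\<Sum>k\<in>S. f k) = (\<Sum>k\<in>S. trace (f k))" for f :: "_ \<Rightarrow> 'n::finite cmat"
  unfolding trace_def sum_component by (rule sum.swap)
lemma trace_zero [simp]: "trace (0 :: 'n::finite cmat) = 0" by (simp add: trace_def)
lemma trace_dagger: "trace (dagger A) = cnj (trace A)" by (simp add: trace_def mat_nth)
lemma trace_mult_cycle: "trace (A ** B ** C) = trace (B ** C ** A)" for A :: "'n::finite cmat"
  by (metis matrix_mul_assoc trace_mul_sym)
lemma trace_mult_ketbra: "trace (A ** ketbra u v) = braket v (A *v u)"
  by (simp add: mult_ketbra trace_ketbra)

section \<open>The inner product\<close>

lemma braket_add_right: "braket u (v + w) = braket u v + braket u w"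
  by (simp add: braket_def algebra_simps sum.distrib)
lemma braket_add_left: "braket (u + v) w = braket u w + braket v w"
  by (simp add: braket_def algebra_simps sum.distrib)
lemma braket_diff_right: "braket u (v - w) = braket u v - braket u w"
  by (simp add: braket_def algebra_simps sum_subtractf)
lemma braket_diff_left: "braket (u - v) w = braket u w - braket v w"
  by (simp add: braket_def algebra_simps sum_subtractf)
lemma braket_smult_right [simp]: "braket u (c *s v) = c * braket u v"
  by (simp add: braket_def sum_distrib_left mult_ac)
lemma braket_smult_left [simp]: "braket (c *s u) v = cnj c * braket u v"
  by (simp add: braket_def sum_distrib_left mult_ac)
lemma braket_scaleR_right [simp]: "braket u (r *\<^sub>R v) = r *\<^sub>R braket u v"
  by (simp add: braket_def scaleR_sum_right)
lemma braket_0 [simp]: "braket 0 v = 0" "braket u 0 = 0" by (simp_all add: braket_def)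
lemma braket_sum_right: "braket u (\<Sum>k\<in>S. f k) = (\<Sum>k\<in>S. braket u (f k))"
  by (induction S rule: infinite_finite_induct) (auto simp: braket_add_right)
lemma cnj_braket: "cnj (braket u v) = braket v u"
  by (simp add: braket_def mult.commute)
lemma braket_mv: "braket u (A *v v) = braket (dagger A *v u) v"
proof -
  have "braket u (A *v v) = (\<Sum>i\<in>UNIV. \<Sum>j\<in>UNIV. cnj (u $ i) * (A $ i $ j * v $ j))"
    by (simp add: braket_def mat_nth sum_distrib_left)
  also have "\<dots> = (\<Sum>j\<in>UNIV. \<Sum>i\<in>UNIV. cnj (u $ i) * (A $ i $ j * v $ j))" by (rule sum.swap)
  also have "\<dots> = braket (dagger A *v u) v"
    by (simp add: braket_def mat_nth sum_distrib_left sum_distrib_right mult_ac)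
  finally show ?thesis .
qed
lemma braket_mv_left: "braket (A *v u) v = braket u (dagger A *v v)"
  by (simp add: braket_mv)

lemma inner_eq_braket: "inner u v = Re (braket u v)" for u v :: "'n::finite cvec"
  by (simp add: inner_vec_def braket_def inner_complex_def)
lemma braket_self: "braket v v = complex_of_real ((norm v)\<^sup>2)"
proof -
  have "Im (braket v v) = 0" by (simp add: braket_def)
  moreover have "Re (braket v v) = (norm v)\<^sup>2"
    by (simp add: inner_eq_braket[symmetric] power2_norm_eq_inner)
  ultimately show ?thesis by (simp add: complex_eq_iff)
qed
lemma norm_smult [simp]: "norm (c *s v) = cmod c * norm v" for v :: "'n::finite cvec"
proof -
  have "complex_of_real ((norm (c *s v))\<^sup>2) = complex_of_real ((cmod c * norm v)\<^sup>2)"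
    unfolding braket_self[symmetric] power_mult_distrib of_real_mult complex_norm_square
    by simp
  then have "(norm (c *s v))\<^sup>2 = (cmod c * norm v)\<^sup>2" using of_real_eq_iff by blast
  then show ?thesis by (rule power2_eq_imp_eq) auto
qed

text \<open>Rotating a number onto the nonnegative reals turns bounds on real parts, which the
  Euclidean inner product of \<open>complex^'n\<close> supplies, into bounds on moduli.\<close>

lemma unit_phase: obtains c where "cmod c = 1" "c * z = complex_of_real (cmod z)"
proof (cases "z = 0")
  case True then show ?thesis using that[of 1] by simp
next
  case False
  have "cnj z / cmod z * z = complex_of_real (cmod z)"
    using False complex_norm_square[of z] by (simp add: field_simps power2_eq_square)
  then show ?thesis using that[of "cnj z / cmod z"] False by (simp add: norm_divide)
qed

lemma norm_braket_le: "cmod (braket u v) \<le> norm u * norm v"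
proof -
  obtain c where c: "cmod c = 1" "c * braket u v = complex_of_real (cmod (braket u v))" by (rule unit_phase)
  have "cmod (braket u v) = Re (braket u (c *s v))" using c by simp
  also have "\<dots> = inner u (c *s v)" by (simp add: inner_eq_braket)
  also have "\<dots> \<le> norm u * norm (c *s v)" by (rule norm_cauchy_schwarz)
  finally show ?thesis using c by simp
qed

lemma hermitian_braket_real: assumes "hermitian A" shows "Im (braket v (A *v v)) = 0"
proof -
  have "cnj (braket v (A *v v)) = braket v (A *v v)"
    using assms by (simp add: cnj_braket braket_mv_left hermitian_def)
  then show ?thesis by (simp add: complex_eq_iff)
qed

lemma mat_eqI_braket: assumes "\<And>v. A *v v = B *v (v :: 'n::finite cvec)" shows "A = (B :: 'n cmat)"
  using assms by (simp add: matrix_eq)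

section \<open>The spectral norm\<close>

lemma norm_mv_le: "norm (A *v v) \<le> spectral_norm A * norm v" for A :: "'n::finite cmat"
  unfolding spectral_norm_def by (rule onorm[OF matrix_vector_mul_bounded_linear])
lemma spectral_norm_leI: "(\<And>v. norm (A *v v) \<le> c * norm v) \<Longrightarrow> spectral_norm A \<le> c" for A :: "'n::finite cmat"
  unfolding spectral_norm_def by (rule onorm_le)
lemma spectral_norm_nonneg: "0 \<le> spectral_norm (A :: 'n::finite cmat)"
  unfolding spectral_norm_def by (rule onorm_pos_le[OF matrix_vector_mul_bounded_linear])
lemma spectral_norm_triangle: "spectral_norm (A + B) \<le> spectral_norm A + spectral_norm (B :: 'n::finite cmat)"
proof (rule spectral_norm_leI)
  fix v
  have "norm ((A + B) *v v) \<le> norm (A *v v) + norm (B *v v)"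
    by (simp add: matrix_vector_mult_add_rdistrib norm_triangle_ineq)
  also have "\<dots> \<le> spectral_norm A * norm v + spectral_norm B * norm v"
    by (intro add_mono norm_mv_le)
  finally show "norm ((A + B) *v v) \<le> (spectral_norm A + spectral_norm B) * norm v"
    by (simp add: distrib_right)
qed
lemma spectral_norm_cscale: "spectral_norm (cscale c A) \<le> cmod c * spectral_norm (A :: 'n::finite cmat)"
  by (rule spectral_norm_leI) (simp add: cscale_mv mult.assoc mult_left_mono norm_mv_le)
lemma spectral_norm_minus: "spectral_norm (- A) = spectral_norm (A :: 'n::finite cmat)"
proof -
  have "(- A) *v v = - (A *v v)" for v by (simp add: vec_eq_iff mat_nth sum_negf)
  then show ?thesis using onorm_neg[of "(*v) A"] by (simp add: spectral_norm_def)
qed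
lemma spectral_norm_diff: "spectral_norm (A - B) \<le> spectral_norm A + spectral_norm (B :: 'n::finite cmat)"
  using spectral_norm_triangle[of A "- B"] by (simp add: spectral_norm_minus)
lemma spectral_norm_zero [simp]: "spectral_norm (0 :: 'n::finite cmat) = 0"
  using spectral_norm_cscale[of 0 "0 :: 'n cmat"] spectral_norm_nonneg[of "0 :: 'n cmat"] by simp
lemma spectral_norm_mult: "spectral_norm (A ** B) \<le> spectral_norm A * spectral_norm (B :: 'n::finite cmat)"
proof (rule spectral_norm_leI)
  fix v
  have "norm ((A ** B) *v v) \<le> spectral_norm A * norm (B *v v)"
    by (simp add: matrix_vector_mul_assoc[symmetric] norm_mv_le)
  also have "\<dots> \<le> spectral_norm A * (spectral_norm B * norm v)"
    by (intro mult_left_mono norm_mv_le spectral_norm_nonneg)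
  finally show "norm ((A ** B) *v v) \<le> spectral_norm A * spectral_norm B * norm v" by (simp add: mult.assoc)
qed
lemma norm_braket_mv_le: "cmod (braket u (A *v v)) \<le> spectral_norm A * norm u * norm v"
proof -
  have "cmod (braket u (A *v v)) \<le> norm u * norm (A *v v)" by (rule norm_braket_le)
  also have "\<dots> \<le> norm u * (spectral_norm A * norm v)" by (intro mult_left_mono norm_mv_le norm_ge_zero)
  finally show ?thesis by (simp add: mult_ac)
qed
text \<open>The squared norm of \<open>dagger B *v v\<close> is a matrix element of \<open>B\<close>
  between \<open>v\<close> and this same vector; bounding it and cancelling one factor gives one
  inequality, and the involution gives the other.\<close>

lemma spectral_norm_dagger: "spectral_norm (dagger A) = spectral_norm (A :: 'n::finite cmat)"
proof -
  have le: "spectral_norm (dagger B) \<le> spectral_norm B" for B :: "'n cmat"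
  proof (rule spectral_norm_leI)
    fix v
    have "(norm (dagger B *v v))\<^sup>2 = Re (braket v (B *v (dagger B *v v)))"
      by (simp add: braket_mv braket_self del: matrix_vector_mul_assoc)
    also have "\<dots> \<le> spectral_norm B * norm v * norm (dagger B *v v)"
      using norm_braket_mv_le[of v B "dagger B *v v"] complex_Re_le_cmod order_trans by blast
    finally show "norm (dagger B *v v) \<le> spectral_norm B * norm v"
      by (cases "norm (dagger B *v v) = 0")
        (auto simp: power2_eq_square spectral_norm_nonneg)
  qed
  show ?thesis using le[of A] le[of "dagger A"] by simp
qed

section \<open>Unitary matrices\<close>

lemma unitary_mat1 [simp]: "unitary (mat 1)" by (simp add: unitary_def)
lemma unitary_mult: assumes "unitary A" "unitary B" shows "unitary (A ** B)"
proof -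
  have "dagger B ** dagger A ** (A ** B) = dagger B ** (dagger A ** A) ** B"
    "A ** B ** (dagger B ** dagger A) = A ** (B ** dagger B) ** dagger A"
    by (simp_all add: matrix_mul_assoc)
  then show ?thesis using assms by (simp add: unitary_def dagger_mult)
qed
lemma unitary_dagger: "unitary A \<Longrightarrow> unitary (dagger A)" by (simp add: unitary_def)
lemma unitary_norm: assumes "unitary A" shows "norm (A *v v) = norm v"
proof -
  have "braket (A *v v) (A *v v) = braket v v"
    using assms by (simp add: braket_mv matrix_vector_mul_assoc unitary_def)
  then have "(norm (A *v v))\<^sup>2 = (norm v)\<^sup>2" by (simp only: braket_self of_real_eq_iff)
  then show ?thesis by simp
qed
lemma unitary_spectral_norm: assumes "unitary A" shows "spectral_norm A \<le> 1"
  by (rule spectral_norm_leI) (simp add: unitary_norm assms)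
lemma spectral_norm_unitary_mult: assumes "unitary A" shows "spectral_norm (A ** B) = spectral_norm B"
  unfolding spectral_norm_def onorm_def
  by (simp add: matrix_vector_mul_assoc[symmetric] unitary_norm[OF assms])

section \<open>Orthonormal bases and operators diagonal in them\<close>

locale onb =
  fixes b :: "nat \<Rightarrow> 'n::finite cvec"
  assumes orthonormal: "orthonormal_basis b"
begin

lemma braket_basis: "i < CARD('n) \<Longrightarrow> j < CARD('n) \<Longrightarrow> braket (b i) (b j) = (if i = j then 1 else 0)"
  using orthonormal by (auto simp: orthonormal_basis_def)

lemma norm_basis: assumes "k < CARD('n)" shows "norm (b k) = 1"
proof -
  have "complex_of_real ((norm (b k))\<^sup>2) = complex_of_real 1"
    using braket_basis[OF assms assms] by (simp add: braket_self)
  then have "(norm (b k))\<^sup>2 = 1" using of_real_eq_iff by blast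
  then show ?thesis using power2_eq_imp_eq[of "norm (b k)" 1] by simp
qed

lemma basis_nonzero: "k < CARD('n) \<Longrightarrow> b k \<noteq> 0"
  using norm_basis by fastforce

text \<open>With the basis vectors as columns of a square matrix, after labelling \<open>'n\<close>
  by numbers, orthonormality says that the adjoint is a left inverse. For square matrices it is then
  a right inverse too, which is the resolution of the identity.\<close>

lemma completeness: "(\<Sum>k<CARD('n). ketbra (b k) (b k)) = mat 1"
proof -
  obtain e where e: "bij_betw e (UNIV :: 'n set) {..<CARD('n)}"
    using ex_bij_betw_finite_nat[OF finite[of "UNIV :: 'n set"]] by (auto simp: atLeast0LessThan)
  define B :: "'n cmat" where "B = (\<chi> i j. b (e j) $ i)"
  have e': "e i < CARD('n)" for i using e by (auto simp: bij_betw_def)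
  have einj: "e i = e j \<longleftrightarrow> i = j" for i j using e by (auto simp: bij_betw_def inj_on_def)
  have "(dagger B ** B) $ i $ j = mat 1 $ i $ j" for i j
    using braket_basis[OF e'[of i] e'[of j]]
    by (simp add: mat_nth B_def braket_def einj) (simp add: mat_def)
  then have "dagger B ** B = mat 1" by (simp add: vec_eq_iff)
  then have 1: "B ** dagger B = mat 1" by (simp add: matrix_left_right_inverse)
  have "(\<Sum>k<CARD('n). ketbra (b k) (b k)) $ i $ j = (B ** dagger B) $ i $ j" for i j
    using sum.reindex_bij_betw[OF e, of "\<lambda>k. b k $ i * cnj (b k $ j)"]
    by (simp add: mat_nth B_def)
  then show ?thesis by (simp add: vec_eq_iff 1)
qed

lemma expand: "v = (\<Sum>k<CARD('n). braket (b k) v *s b k)"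
proof -
  have "v = (\<Sum>k<CARD('n). ketbra (b k) (b k)) *v v" by (simp add: completeness)
  then show ?thesis unfolding sum_mv by (simp add: ketbra_mv)
qed

lemma parseval: "braket u v = (\<Sum>k<CARD('n). cnj (braket (b k) u) * braket (b k) v)"
  by (subst expand[of v]) (simp add: braket_sum_right cnj_braket mult_ac)

lemma norm_parseval: "(norm v)\<^sup>2 = (\<Sum>k<CARD('n). (cmod (braket (b k) v))\<^sup>2)"
proof -
  have "complex_of_real ((norm v)\<^sup>2) = complex_of_real (\<Sum>k<CARD('n). (cmod (braket (b k) v))\<^sup>2)"
    unfolding of_real_sum braket_self[symmetric] complex_norm_square parseval[of v v]
    by (simp add: mult_ac)
  then show ?thesis using of_real_eq_iff by blast
qed

lemma vec_eqI:
  assumes "\<And>k. k < CARD('n) \<Longrightarrow> braket (b k) u = braket (b k) v"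
  shows "u = v"
proof -
  have "(\<Sum>k<CARD('n). braket (b k) u *s b k) = (\<Sum>k<CARD('n). braket (b k) v *s b k)"
    by (rule sum.cong) (auto simp: assms)
  then show ?thesis by (simp only: expand[symmetric])
qed

lemma mat_eqI:
  fixes A B :: "'n cmat"
  assumes "\<And>k. k < CARD('n) \<Longrightarrow> A *v b k = B *v b k"
  shows "A = B"
proof (rule mat_eqI_braket)
  fix v
  have "A *v (\<Sum>k<CARD('n). braket (b k) v *s b k) = B *v (\<Sum>k<CARD('n). braket (b k) v *s b k)"
    unfolding mv_sum mv_cscale by (rule sum.cong) (auto simp: assms)
  then show "A *v v = B *v v" by (simp only: expand[symmetric])
qed

text \<open>Functional calculus in the basis \<open>b\<close>: sums, products, adjoints and
  exponentials become pointwise operations on \<open>c\<close>. By the spectral theorem every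
  Hermitian matrix has this form for some basis, so facts about Hermitian matrices are reduced to
  it.\<close>

definition diag_op :: "(nat \<Rightarrow> complex) \<Rightarrow> 'n cmat" where
  "diag_op c = (\<Sum>k<CARD('n). cscale (c k) (ketbra (b k) (b k)))"

lemma diag_op_cong: "(\<And>k. k < CARD('n) \<Longrightarrow> c k = d k) \<Longrightarrow> diag_op c = diag_op d"
  by (simp add: diag_op_def)

lemma diag_op_basis: assumes "k < CARD('n)" shows "diag_op c *v b k = c k *s b k"
proof -
  have "diag_op c *v b k = (\<Sum>j<CARD('n). if j = k then c k *s b k else 0)"
    unfolding diag_op_def sum_mv
    by (rule sum.cong) (auto simp: cscale_mv ketbra_mv braket_basis assms)
  then show ?thesis using assms by simp
qed

lemma diag_op_mult: "diag_op c ** diag_op d = diag_op (\<lambda>k. c k * d k)"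
  by (rule mat_eqI) (simp add: matrix_vector_mul_assoc[symmetric] diag_op_basis mv_cscale mult.commute)

lemma diag_op_add: "diag_op c + diag_op d = diag_op (\<lambda>k. c k + d k)"
  by (simp add: diag_op_def cscale_add_left sum.distrib)

lemma diag_op_diff: "diag_op c - diag_op d = diag_op (\<lambda>k. c k - d k)"
  by (simp add: diag_op_def cscale_diff_left sum_subtractf)

lemma diag_op_cscale: "cscale z (diag_op c) = diag_op (\<lambda>k. z * c k)"
  by (simp add: diag_op_def cscale_sum_right cscale_cscale)

lemma diag_op_1: "diag_op (\<lambda>_. 1) = mat 1"
  by (simp add: diag_op_def completeness)

lemma dagger_diag_op: "dagger (diag_op c) = diag_op (\<lambda>k. cnj (c k))"
  by (simp add: diag_op_def dagger_sum dagger_cscale dagger_ketbra)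

lemma trace_diag_op: "trace (diag_op c) = (\<Sum>k<CARD('n). c k)"
  by (simp add: diag_op_def trace_sum trace_cscale trace_ketbra braket_basis)

lemma hermitian_diag_op: "hermitian (diag_op (\<lambda>k. complex_of_real (a k)))"
  by (simp add: hermitian_def dagger_diag_op)

lemma unitary_diag_op: assumes "\<And>k. k < CARD('n) \<Longrightarrow> cmod (c k) = 1" shows "unitary (diag_op c)"
proof -
  have "cnj (c k) * c k = 1" if "k < CARD('n)" for k
    using complex_norm_square[of "c k"] assms[OF that] by (simp add: mult.commute)
  then have "diag_op (\<lambda>k. cnj (c k) * c k) = diag_op (\<lambda>_. 1)" by (rule diag_op_cong)
  then show ?thesis by (simp add: unitary_def dagger_diag_op diag_op_mult diag_op_1 mult.commute)
qed

lemma braket_diag_op: assumes "k < CARD('n)"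
  shows "braket (b k) (diag_op c *v v) = c k * braket (b k) v"
  using assms by (simp add: braket_mv dagger_diag_op diag_op_basis)

lemma spectral_norm_diag_op_le:
  assumes "\<And>k. k < CARD('n) \<Longrightarrow> cmod (c k) \<le> C"
  shows "spectral_norm (diag_op c) \<le> C"
proof (rule spectral_norm_leI)
  fix v
  have "0 < CARD('n)" by simp
  then have C: "0 \<le> C" using assms[of 0] norm_ge_zero order_trans by blast
  have "(norm (diag_op c *v v))\<^sup>2 = (\<Sum>k<CARD('n). (cmod (c k) * cmod (braket (b k) v))\<^sup>2)"
    by (simp add: norm_parseval[of "diag_op c *v v"] braket_diag_op norm_mult)
  also have "\<dots> \<le> (\<Sum>k<CARD('n). (C * cmod (braket (b k) v))\<^sup>2)"
    by (intro sum_mono power_mono mult_right_mono assms) auto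
  also have "\<dots> = (C * norm v)\<^sup>2"
    by (simp add: power_mult_distrib norm_parseval[of v] sum_distrib_left)
  finally show "norm (diag_op c *v v) \<le> C * norm v"
    by (rule power2_le_imp_le) (simp add: C)
qed

lemma trace_basis: "trace X = (\<Sum>k<CARD('n). braket (b k) (X *v b k))"
proof -
  have "trace X = trace (X ** (\<Sum>k<CARD('n). ketbra (b k) (b k)))" by (simp add: completeness)
  then show ?thesis by (simp add: mult_sum_right trace_sum trace_mult_ketbra)
qed

lemma trace_diag_op_mult: "trace (diag_op c ** X) = (\<Sum>k<CARD('n). c k * braket (b k) (X *v b k))"
  by (simp add: trace_basis[of "diag_op c ** X"] matrix_vector_mul_assoc[symmetric] braket_diag_op)

lemma mpow_diag_op: "mpow (diag_op c) n = diag_op (\<lambda>k. c k ^ n)"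
proof (induction n)
  case 0 then show ?case by (simp add: mpow_def diag_op_1)
next
  case (Suc n)
  have "mpow (diag_op c) (Suc n) = diag_op c ** mpow (diag_op c) n" by (simp add: mpow_def)
  then show ?case by (simp add: Suc diag_op_mult)
qed

lemma diag_op_nth: "diag_op c $ i $ j = (\<Sum>k<CARD('n). c k * (b k $ i * cnj (b k $ j)))"
  by (simp add: diag_op_def mat_nth)

text \<open>\<open>mexp\<close> is an infinite sum of matrices, so its value rests on convergence;
  entrywise the series is a finite combination over \<open>k\<close> of scalar exponential
  series.\<close>

lemma mexp_diag_op: "mexp (diag_op c) = diag_op (\<lambda>k. exp (c k))"
proof -
  have "(\<lambda>m. (1 / fact m) *\<^sub>R mpow (diag_op c) m) sums diag_op (\<lambda>k. exp (c k))"
    unfolding sums_def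
  proof (rule vec_tendstoI, rule vec_tendstoI)
    fix i j
    have "(\<lambda>m. (1 / fact m) *\<^sub>R c k ^ m * (b k $ i * cnj (b k $ j))) sums (exp (c k) * (b k $ i * cnj (b k $ j)))" for k
      using sums_mult2[OF exp_converges[of "c k"]] by (simp add: divide_inverse)
    then have "(\<lambda>m. \<Sum>k<CARD('n). (1 / fact m) *\<^sub>R c k ^ m * (b k $ i * cnj (b k $ j))) sums
       (\<Sum>k<CARD('n). exp (c k) * (b k $ i * cnj (b k $ j)))"
      by (intro sums_sum) auto
    then show "(\<lambda>n. (\<Sum>m<n. (1 / fact m) *\<^sub>R mpow (diag_op c) m) $ i $ j) \<longlonglongrightarrow> diag_op (\<lambda>k. exp (c k)) $ i $ j"
      by (simp add: sums_def mpow_diag_op diag_op_nth scaleR_sum_right)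
  qed
  then show ?thesis by (simp add: mexp_def sums_iff)
qed

lemma diag_part_eq: "diag_part b H = diag_op (\<lambda>k. braket (b k) (H *v b k))"
  by (simp add: diag_part_def diag_op_def)

lemma diagonalizes_iff: "diagonalizes b a A \<longleftrightarrow> A = diag_op (\<lambda>k. complex_of_real (a k))"
  by (simp add: diagonalizes_def orthonormal diag_op_def scaleR_cscale)

end

lemma diagonalizes_onb: "diagonalizes b a A \<Longrightarrow> onb b"
  by (simp add: diagonalizes_def onb_def)

section \<open>The spectral theorem\<close>

lemma continuous_on_braket [continuous_intros]:
  assumes "continuous_on S f" "continuous_on S g"
  shows "continuous_on S (\<lambda>x. braket (f x) (g x))"
  unfolding braket_def by (intro continuous_intros assms)

lemma continuous_on_mv [continuous_intros]:
  assumes "continuous_on S f"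
  shows "continuous_on S (\<lambda>x. (A :: 'n::finite cmat) *v f x)"
  by (rule bounded_linear.continuous_on[OF matrix_vector_mul_bounded_linear assms])

text \<open>The span of fewer than \<open>CARD('n)\<close> vectors is proper. A vector outside it,
  minus its projection, is orthogonal to all of them and cannot vanish.\<close>

lemma exists_orthogonal_nonzero:
  fixes b :: "nat \<Rightarrow> 'n::finite cvec"
  assumes b: "\<And>i j. i < k \<Longrightarrow> j < k \<Longrightarrow> braket (b i) (b j) = (if i = j then 1 else 0)"
    and k: "k < CARD('n)"
  obtains v where "v \<noteq> 0" "\<And>i. i < k \<Longrightarrow> braket (b i) v = 0"
proof -
  have "vec.dim (b ` {..<k}) \<le> card (b ` {..<k})" by (rule vec.dim_le_card') simp
  also have "\<dots> \<le> k" using card_image_le[of "{..<k}" b] by simp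
  finally have "vec.dim (b ` {..<k}) < vec.dim (UNIV :: 'n cvec set)"
    using k vec_dim_card[where 'a=complex and 'n='n] by simp
  then have "vec.span (b ` {..<k}) \<noteq> UNIV" using vec.dim_span[of "b ` {..<k}"] by (metis less_irrefl)
  then obtain w where w: "w \<notin> vec.span (b ` {..<k})" by blast
  define v where "v = w - (\<Sum>i<k. braket (b i) w *s b i)"
  have "(\<Sum>i<k. braket (b i) w *s b i) \<in> vec.span (b ` {..<k})"
    by (intro vec.span_sum vec.span_scale vec.span_base) auto
  then have "v \<noteq> 0" using w by (auto simp: v_def)
  moreover have "braket (b j) v = 0" if "j < k" for j
  proof -
    have "(\<Sum>i<k. braket (b i) w * braket (b j) (b i)) = (\<Sum>i<k. if i = j then braket (b j) w else 0)"
      by (rule sum.cong) (auto simp: b that)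
    then show ?thesis using that by (simp add: v_def braket_diff_right braket_sum_right)
  qed
  ultimately show ?thesis using that by blast
qed

text \<open>
  The Rayleigh quotient is maximized on the unit sphere of \<open>S\<close>; at a maximizer \<open>v\<close> with value \<open>r\<close>
  its derivative in the direction \<open>A v - r v\<close>, which lies in \<open>S\<close>, is \<open>2 \<parallel>A v - r v\<parallel>\<^sup>2\<close>.
\<close>

lemma rayleigh_eigenvector:
  fixes A :: "'n::finite cmat"
  assumes herm: "hermitian A"
    and S: "S = {v. \<forall>i<k. braket (b i) v = 0}"
    and inv: "\<And>v. v \<in> S \<Longrightarrow> A *v v \<in> S"
    and ne: "\<exists>v\<in>S. v \<noteq> 0"
  shows "\<exists>v r. v \<in> S \<and> norm v = 1 \<and> A *v v = complex_of_real r *s v"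
proof -
  have sm: "c *s v \<in> S" if "v \<in> S" for c v using that by (simp add: S)
  have ad: "u + v \<in> S" "u - v \<in> S" if "u \<in> S" "v \<in> S" for u v
    using that by (simp_all add: S braket_add_right braket_diff_right)
  define f where "f v = Re (braket v (A *v v))" for v
  obtain v0 where v0: "v0 \<in> S" "v0 \<noteq> 0" using ne by blast
  have "closed S"
  proof -
    have "S = (\<Inter>i\<in>{..<k}. {v. braket (b i) v = 0})" by (auto simp: S)
    then show ?thesis by (auto intro!: closed_INT closed_Collect_eq continuous_intros)
  qed
  then have "compact (S \<inter> sphere 0 1)" by (intro closed_Int_compact) auto
  moreover have "complex_of_real (1 / norm v0) *s v0 \<in> S \<inter> sphere 0 1"
    using v0 sm by (simp add: norm_divide)
  moreover have "continuous_on (S \<inter> sphere 0 1) f"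
    unfolding f_def by (intro continuous_intros)
  ultimately have "\<exists>v\<in>S \<inter> sphere 0 1. \<forall>u\<in>S \<inter> sphere 0 1. f u \<le> f v"
    by (intro continuous_attains_sup) auto
  then obtain v where v: "v \<in> S" "norm v = 1" and max: "\<And>u. u \<in> S \<Longrightarrow> norm u = 1 \<Longrightarrow> f u \<le> f v"
    by (auto simp: dist_norm)
  define r where "r = f v"
  have le: "f u \<le> r * (norm u)\<^sup>2" if u: "u \<in> S" for u
  proof (cases "u = 0")
    case False
    let ?u = "complex_of_real (1 / norm u) *s u"
    have "f ?u \<le> r" unfolding r_def using u sm False by (intro max) (auto simp: norm_divide)
    moreover have "f ?u = f u / (norm u)\<^sup>2"
      by (simp add: f_def mv_cscale power2_eq_square)
    ultimately show ?thesis using False by (simp add: divide_le_eq)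
  qed (simp add: f_def)
  define w where "w = A *v v - complex_of_real r *s v"
  have wS: "w \<in> S" unfolding w_def by (intro ad sm inv v)
  define C where "C = r * (norm w)\<^sup>2 - f w"
  have key: "2 * t * (norm w)\<^sup>2 \<le> t\<^sup>2 * C" for t :: real
  proof -
    let ?t = "complex_of_real t"
    have wv: "Re (braket w (A *v v)) = Re (braket v (A *v w))"
      using herm cnj_braket[of w "A *v v"] by (simp add: braket_mv_left hermitian_def complex_eq_iff)
    have wv2: "Re (braket w v) = Re (braket v w)"
      using cnj_braket[of w v] by (simp add: complex_eq_iff)
    have nn: "(norm u)\<^sup>2 = Re (braket u u)" for u :: "'n cvec" by (simp add: braket_self)
    have "(norm w)\<^sup>2 = Re (braket w (A *v v)) - r * Re (braket w v)"
      unfolding nn by (subst (2) w_def) (simp add: braket_diff_right)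
    moreover have "f (v + ?t *s w) = r + 2 * t * Re (braket w (A *v v)) + t\<^sup>2 * f w"
      by (simp add: f_def r_def braket_add_right braket_add_left matrix_vector_right_distrib mv_cscale
        wv power2_eq_square algebra_simps)
    moreover have "(norm (v + ?t *s w))\<^sup>2 = 1 + 2 * t * Re (braket w v) + t\<^sup>2 * (norm w)\<^sup>2"
    proof -
      have "(norm (v + ?t *s w))\<^sup>2 = (norm v)\<^sup>2 + 2 * t * Re (braket w v) + t\<^sup>2 * (norm w)\<^sup>2"
        unfolding nn by (simp add: braket_add_right braket_add_left wv2 power2_eq_square algebra_simps)
      then show ?thesis using v by simp
    qed
    moreover have "f (v + ?t *s w) \<le> r * (norm (v + ?t *s w))\<^sup>2" by (intro le ad sm v wS)
    ultimately have "r + 2 * t * (r * Re (braket w v) + (norm w)\<^sup>2) + t\<^sup>2 * f w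
        \<le> r * (1 + 2 * t * Re (braket w v) + t\<^sup>2 * (norm w)\<^sup>2)" by simp
    then show ?thesis by (simp add: C_def algebra_simps)
  qed
  have "w = 0"
  proof (rule ccontr)
    assume "w \<noteq> 0"
    define p where "p = (norm w)\<^sup>2"
    have p: "p > 0" using \<open>w \<noteq> 0\<close> by (simp add: p_def)
    \<comment> \<open>For this \<open>t\<close> the quadratic side of \<open>key\<close> is at most
      half of the linear side, which is impossible unless \<open>w\<close> vanishes.\<close>
    define t where "t = p / (\<bar>C\<bar> + 1)"
    have t: "t > 0" using p by (simp add: t_def)
    have "2 * p \<le> t * C" using key[of t] t by (simp add: p_def power2_eq_square)
    also have "\<dots> \<le> t * (\<bar>C\<bar> + 1)" using t by (intro mult_left_mono) auto
    also have "\<dots> = p" by (simp add: t_def)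
    finally show False using p by simp
  qed
  then have "A *v v = complex_of_real r *s v" by (simp add: w_def)
  then show ?thesis using v by blast
qed

text \<open>A Hermitian matrix leaves the orthogonal complement of its eigenvectors invariant, so
  the next eigenvector can be found there by the Rayleigh argument.\<close>

lemma partial_eigenbasis:
  fixes A :: "'n::finite cmat"
  assumes herm: "hermitian A" and "k \<le> CARD('n)"
  shows "\<exists>b a. (\<forall>i<k. \<forall>j<k. braket (b i) (b j) = (if i = j then 1 else 0)) \<and>
    (\<forall>i<k. A *v b i = complex_of_real (a i) *s b i)"
  using assms(2)
proof (induction k)
  case 0 then show ?case by simp
next
  case (Suc k)
  then obtain b a where b: "\<And>i j. i < k \<Longrightarrow> j < k \<Longrightarrow> braket (b i) (b j) = (if i = j then 1 else 0)"
    and a: "\<And>i. i < k \<Longrightarrow> A *v b i = complex_of_real (a i) *s b i" by auto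
  define S where "S = {v. \<forall>i<k. braket (b i) v = 0}"
  have inv: "A *v v \<in> S" if "v \<in> S" for v
  proof -
    have "braket (b i) (A *v v) = 0" if i: "i < k" for i
    proof -
      have "braket (b i) (A *v v) = braket (A *v b i) v" using herm by (simp add: braket_mv hermitian_def)
      also have "\<dots> = 0" using \<open>v \<in> S\<close> i by (simp add: a S_def)
      finally show ?thesis .
    qed
    then show ?thesis by (simp add: S_def)
  qed
  obtain v0 where "v0 \<noteq> 0" "\<And>i. i < k \<Longrightarrow> braket (b i) v0 = 0"
    using exists_orthogonal_nonzero[of k b] b Suc.prems by (metis Suc_le_lessD)
  then have "\<exists>v\<in>S. v \<noteq> 0" by (auto simp: S_def)
  from rayleigh_eigenvector[OF herm S_def inv this] obtain v r
    where v: "v \<in> S" "norm v = 1" "A *v v = complex_of_real r *s v" by blast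
  have vb: "braket (b i) v = 0" "braket v (b i) = 0" if "i < k" for i
    using v(1) that cnj_braket[of "b i" v] by (auto simp: S_def)
  have vv: "braket v v = 1" using v by (simp add: braket_self)
  show ?case
    by (rule exI[of _ "b(k := v)"], rule exI[of _ "a(k := r)"])
      (auto simp: less_Suc_eq b a vb vv v)
qed

theorem spectral_theorem:
  fixes A :: "'n::finite cmat"
  assumes "hermitian A" obtains b a where "diagonalizes b a A"
proof -
  obtain b a where b: "orthonormal_basis b"
    and a: "\<And>i. i < CARD('n) \<Longrightarrow> A *v b i = complex_of_real (a i) *s b i"
    using partial_eigenbasis[OF assms order_refl] unfolding orthonormal_basis_def by blast
  interpret onb b by unfold_locales (rule b)
  have "A = diag_op (\<lambda>k. complex_of_real (a k))" by (rule mat_eqI) (simp add: a diag_op_basis)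
  then show ?thesis using that diagonalizes_iff by blast
qed

section \<open>The trace norm\<close>

text \<open>Makes the definite description in \<open>msqrt\<close> meaningful. The root
  \<open>B\<close> has its own eigenbasis; where one of its eigenvectors has a nonzero coefficient
  along \<open>b k\<close>, the squares of the two eigenvalues agree, and hence the eigenvalues,
  both being nonnegative.\<close>

lemma (in onb) psd_sqrt_unique:
  assumes B: "psd B" "B ** B = diag_op (\<lambda>k. complex_of_real ((c k)\<^sup>2))"
    and c: "\<And>k. k < CARD('n) \<Longrightarrow> 0 \<le> c k"
  shows "B = diag_op (\<lambda>k. complex_of_real (c k))"
proof -
  obtain b' \<beta> where d: "diagonalizes b' \<beta> B" using spectral_theorem B(1) unfolding psd_def by metis
  interpret B: onb b' using diagonalizes_onb d .
  have Bd: "B = B.diag_op (\<lambda>k. complex_of_real (\<beta> k))" using d by (simp add: B.diagonalizes_iff)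
  have beta: "0 \<le> \<beta> j" if "j < CARD('n)" for j
  proof -
    have "0 \<le> Re (braket (b' j) (B *v b' j))" using B(1) by (simp add: psd_def)
    then show ?thesis using that by (simp add: Bd B.diag_op_basis B.braket_basis)
  qed
  show ?thesis
  proof (rule B.mat_eqI)
    fix j assume j: "j < CARD('n)"
    have coeff: "complex_of_real (c k) * braket (b k) (b' j) = complex_of_real (\<beta> j) * braket (b k) (b' j)"
      if k: "k < CARD('n)" for k
    proof -
      have "braket (b k) ((B ** B) *v b' j) = complex_of_real ((\<beta> j)\<^sup>2) * braket (b k) (b' j)"
        using j by (simp add: Bd B.diag_op_mult B.diag_op_basis power2_eq_square)
      moreover have "braket (b k) ((B ** B) *v b' j) = complex_of_real ((c k)\<^sup>2) * braket (b k) (b' j)"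
        unfolding B(2) using k by (simp add: braket_diag_op)
      ultimately have "braket (b k) (b' j) = 0 \<or> (\<beta> j)\<^sup>2 = (c k)\<^sup>2"
        by (metis mult_right_cancel of_real_eq_iff)
      then show ?thesis using beta[OF j] c[OF k] power2_eq_imp_eq by fastforce
    qed
    show "B *v b' j = diag_op (\<lambda>k. complex_of_real (c k)) *v b' j"
    proof (rule vec_eqI)
      fix k assume k: "k < CARD('n)"
      have "braket (b k) (B *v b' j) = complex_of_real (\<beta> j) * braket (b k) (b' j)"
        using j by (simp add: Bd B.diag_op_basis)
      also have "\<dots> = complex_of_real (c k) * braket (b k) (b' j)" using coeff[OF k] by (rule sym)
      also have "\<dots> = braket (b k) (diag_op (\<lambda>k. complex_of_real (c k)) *v b' j)"
        using k by (simp add: braket_diag_op)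
      finally show "braket (b k) (B *v b' j) = braket (b k) (diag_op (\<lambda>k. complex_of_real (c k)) *v b' j)" .
    qed
  qed
qed

lemma (in onb) psd_diag_op:
  assumes "\<And>k. k < CARD('n) \<Longrightarrow> 0 \<le> c k"
  shows "psd (diag_op (\<lambda>k. complex_of_real (c k)))"
proof -
  have "0 \<le> Re (braket v (diag_op (\<lambda>k. complex_of_real (c k)) *v v))" for v
  proof -
    have "Re (braket v (diag_op (\<lambda>k. complex_of_real (c k)) *v v)) =
        (\<Sum>k<CARD('n). c k * (cmod (braket (b k) v))\<^sup>2)"
      unfolding parseval[of v] Re_sum
    proof (rule sum.cong)
      fix k assume "k \<in> {..<CARD('n)}"
      then have "cnj (braket (b k) v) * braket (b k) (diag_op (\<lambda>k. complex_of_real (c k)) *v v)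
          = complex_of_real (c k) * (braket (b k) v * cnj (braket (b k) v))"
        by (simp add: braket_diag_op)
      also have "\<dots> = complex_of_real (c k * (cmod (braket (b k) v))\<^sup>2)"
        by (simp add: complex_norm_square[symmetric] flip: of_real_power)
      finally show "Re (cnj (braket (b k) v) * braket (b k) (diag_op (\<lambda>k. complex_of_real (c k)) *v v))
        = c k * (cmod (braket (b k) v))\<^sup>2" by simp
    qed simp
    also have "\<dots> \<ge> 0" using assms by (intro sum_nonneg mult_nonneg_nonneg) auto
    finally show ?thesis .
  qed
  then show ?thesis by (simp add: psd_def hermitian_diag_op)
qed

lemma (in onb) trace_norm_diag_op:
  "trace_norm (diag_op (\<lambda>k. complex_of_real (a k))) = (\<Sum>k<CARD('n). \<bar>a k\<bar>)"
proof -
  let ?A = "diag_op (\<lambda>k. complex_of_real (a k))"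
  let ?R = "diag_op (\<lambda>k. complex_of_real \<bar>a k\<bar>)"
  have AA: "dagger ?A ** ?A = diag_op (\<lambda>k. complex_of_real (\<bar>a k\<bar>\<^sup>2))"
    by (simp add: dagger_diag_op diag_op_mult power2_eq_square)
  have "msqrt (dagger ?A ** ?A) = ?R"
    unfolding msqrt_def
  proof (rule the_equality)
    show "psd ?R \<and> ?R ** ?R = dagger ?A ** ?A"
      using psd_diag_op[of "\<lambda>k. \<bar>a k\<bar>"]
      by (simp add: AA diag_op_mult power2_eq_square flip: of_real_mult)
    show "B = ?R" if "psd B \<and> B ** B = dagger ?A ** ?A" for B
      using that psd_sqrt_unique[of B "\<lambda>k. \<bar>a k\<bar>"] unfolding AA by auto
  qed
  then show ?thesis by (simp add: trace_norm_def trace_diag_op)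
qed

lemma trace_norm_diagonalizes:
  fixes A :: "'n::finite cmat"
  assumes "diagonalizes b a A" shows "trace_norm A = (\<Sum>k<CARD('n). \<bar>a k\<bar>)"
proof -
  interpret onb b using diagonalizes_onb assms .
  show ?thesis using assms by (simp add: diagonalizes_iff trace_norm_diag_op)
qed

lemma trace_norm_nonneg: "hermitian A \<Longrightarrow> 0 \<le> trace_norm A"
  by (metis spectral_theorem trace_norm_diagonalizes sum_nonneg abs_ge_zero)

text \<open>One half of the description of the trace norm as a supremum of traces against matrices
  of spectral norm at most one: in an eigenbasis of \<open>A\<close> only the diagonal of
  \<open>X\<close> enters, and its entries are bounded by the spectral norm.\<close>

lemma trace_norm_duality:
  fixes A X :: "'n::finite cmat"
  assumes "hermitian A"
  shows "cmod (trace (A ** X)) \<le> trace_norm A * spectral_norm X"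
proof -
  obtain b a where d: "diagonalizes b a A" using spectral_theorem assms by metis
  interpret onb b using diagonalizes_onb d .
  have A: "A = diag_op (\<lambda>k. complex_of_real (a k))" using d by (simp add: diagonalizes_iff)
  have "cmod (trace (A ** X)) \<le> (\<Sum>k<CARD('n). \<bar>a k\<bar> * cmod (braket (b k) (X *v b k)))"
    unfolding A trace_diag_op_mult
    by (rule order_trans[OF norm_sum]) (simp add: norm_mult)
  also have "\<dots> \<le> (\<Sum>k<CARD('n). \<bar>a k\<bar> * spectral_norm X)"
    by (intro sum_mono mult_left_mono)
      (use norm_braket_mv_le[of _ X] norm_basis in \<open>metis lessThan_iff mult.right_neutral\<close>, simp)
  also have "\<dots> = trace_norm A * spectral_norm X"
    by (simp add: A trace_norm_diag_op sum_distrib_right)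
  finally show ?thesis .
qed

text \<open>The supremum is attained at the sign of \<open>A\<close>. The triangle inequality then
  follows from the linearity of the trace.\<close>

lemma trace_norm_attained:
  fixes A :: "'n::finite cmat"
  assumes "hermitian A"
  obtains X where "spectral_norm X \<le> 1" "trace (A ** X) = complex_of_real (trace_norm A)"
proof -
  obtain b a where d: "diagonalizes b a A" using spectral_theorem assms by metis
  interpret onb b using diagonalizes_onb d .
  have A: "A = diag_op (\<lambda>k. complex_of_real (a k))" using d by (simp add: diagonalizes_iff)
  let ?X = "diag_op (\<lambda>k. complex_of_real (sgn (a k)))"
  have "spectral_norm ?X \<le> 1" by (rule spectral_norm_diag_op_le) (simp add: sgn_if)
  moreover have "trace (A ** ?X) = complex_of_real (trace_norm A)"
    unfolding A trace_norm_diag_op diag_op_mult trace_diag_op of_real_sum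
    by (intro sum.cong) (auto simp: sgn_if abs_if)
  ultimately show ?thesis using that by blast
qed

lemma hermitian_add: "hermitian A \<Longrightarrow> hermitian B \<Longrightarrow> hermitian (A + B)"
  by (simp add: hermitian_def dagger_add)
lemma hermitian_diff: "hermitian A \<Longrightarrow> hermitian B \<Longrightarrow> hermitian (A - B)"
  by (simp add: hermitian_def dagger_diff)
lemma hermitian_scaleR: "hermitian A \<Longrightarrow> hermitian (r *\<^sub>R A)"
  by (simp add: hermitian_def dagger_scaleR)
lemma hermitian_sum: "(\<And>k. k \<in> S \<Longrightarrow> hermitian (f k)) \<Longrightarrow> hermitian (\<Sum>k\<in>S. f k)"
  by (simp add: hermitian_def dagger_sum)
lemma hermitian_zero [simp]: "hermitian 0" by (simp add: hermitian_def)
lemma hermitian_ketbra: "hermitian (ketbra u u)" by (simp add: hermitian_def dagger_ketbra)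

lemma trace_norm_triangle:
  fixes A B :: "'n::finite cmat"
  assumes "hermitian A" "hermitian B"
  shows "trace_norm (A + B) \<le> trace_norm A + trace_norm B"
proof -
  obtain X :: "'n cmat" where X: "spectral_norm X \<le> 1"
    "trace ((A + B) ** X) = complex_of_real (trace_norm (A + B))"
    using trace_norm_attained hermitian_add assms by metis
  have "trace_norm (A + B) = Re (trace (A ** X) + trace (B ** X))"
    using X(2) by (simp add: mult_add_left trace_add)
  also have "\<dots> \<le> cmod (trace (A ** X)) + cmod (trace (B ** X))"
    using norm_triangle_ineq complex_Re_le_cmod order_trans by blast
  also have "\<dots> \<le> trace_norm A * spectral_norm X + trace_norm B * spectral_norm X"
    by (intro add_mono trace_norm_duality assms)
  also have "\<dots> \<le> trace_norm A * 1 + trace_norm B * 1"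
    by (intro add_mono mult_left_mono X trace_norm_nonneg assms)
  finally show ?thesis by simp
qed

lemma trace_norm_scaleR:
  fixes A :: "'n::finite cmat"
  assumes "hermitian A" shows "trace_norm (r *\<^sub>R A) = \<bar>r\<bar> * trace_norm A"
proof -
  obtain b a where d: "diagonalizes b a A" using spectral_theorem assms by metis
  interpret onb b using diagonalizes_onb d .
  have "r *\<^sub>R A = diag_op (\<lambda>k. complex_of_real (r * a k))"
    using d unfolding diagonalizes_iff by (simp add: scaleR_cscale diag_op_cscale)
  then show ?thesis
    using d trace_norm_diag_op[of "\<lambda>k. r * a k"]
    by (simp add: trace_norm_diagonalizes abs_mult sum_distrib_left)
qed

lemma spectral_norm_le_norm: "spectral_norm X \<le> norm X" for X :: "'n::finite cmat"
proof (rule spectral_norm_leI)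
  fix v
  have eq: "(X *v v) $ i = braket (\<chi> j. cnj (X $ i $ j)) v" for i by (simp add: mat_nth braket_def)
  have n: "norm (\<chi> j. cnj (X $ i $ j)) = norm (X $ i)" for i by (simp add: norm_vec_def L2_set_def)
  have "cmod ((X *v v) $ i) \<le> norm (X $ i) * norm v" for i
    using norm_braket_le[of "\<chi> j. cnj (X $ i $ j)" v] by (simp add: eq n)
  then have "norm (X *v v) \<le> L2_set (\<lambda>i. norm (X $ i) * norm v) UNIV"
    unfolding norm_vec_def[of "X *v v"] by (intro L2_set_mono) auto
  also have "\<dots> = norm X * norm v" by (simp add: norm_vec_def[of X] L2_set_left_distrib)
  finally show "norm (X *v v) \<le> norm X * norm v" .
qed

lemma inner_cmat: "inner X Y = Re (trace (dagger X ** Y))" for X Y :: "'n::finite cmat"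
proof -
  have "inner X Y = (\<Sum>i\<in>UNIV. \<Sum>j\<in>UNIV. Re (cnj (X $ i $ j) * Y $ i $ j))"
    by (simp add: inner_vec_def inner_complex_def)
  also have "\<dots> = (\<Sum>j\<in>UNIV. \<Sum>i\<in>UNIV. Re (cnj (X $ i $ j) * Y $ i $ j))" by (rule sum.swap)
  also have "\<dots> = Re (trace (dagger X ** Y))" by (simp add: trace_def mat_nth)
  finally show ?thesis .
qed

text \<open>The norm of the type is the Frobenius norm, and its square is
  \<open>trace (A ** A)\<close>; duality bounds this and one factor cancels. The estimate makes
  sublevel sets of the trace norm bounded, as needed for a minimizer to exist.\<close>

lemma norm_le_trace_norm:
  fixes A :: "'n::finite cmat"
  assumes "hermitian A" shows "norm A \<le> trace_norm A"
proof -
  have "(norm A)\<^sup>2 = Re (trace (A ** A))"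
    using assms by (simp add: power2_norm_eq_inner inner_cmat hermitian_def)
  also have "\<dots> \<le> trace_norm A * spectral_norm A"
    using trace_norm_duality[OF assms, of A] complex_Re_le_cmod order_trans by blast
  also have "\<dots> \<le> trace_norm A * norm A"
    by (intro mult_left_mono spectral_norm_le_norm trace_norm_nonneg assms)
  finally show ?thesis using trace_norm_nonneg[OF assms]
    by (cases "norm A = 0") (auto simp: power2_eq_square)
qed

text \<open>Together with the triangle inequality this makes the trace norm Lipschitz on Hermitian
  matrices; the value of the constant is immaterial.\<close>

lemma trace_norm_le_norm:
  obtains C where "\<And>A :: 'n::finite cmat. hermitian A \<Longrightarrow> trace_norm A \<le> C * norm A"
proof
  fix A :: "'n cmat" assume A: "hermitian A"
  obtain b a where d: "diagonalizes b a A" using spectral_theorem A by metis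
  interpret onb b using diagonalizes_onb d .
  have "\<bar>a k\<bar> \<le> norm A" if "k < CARD('n)" for k
  proof -
    have "\<bar>a k\<bar> = norm (A *v b k)"
      using d that by (simp add: diagonalizes_iff diag_op_basis norm_basis)
    also have "\<dots> \<le> spectral_norm A" using norm_mv_le[of A "b k"] that by (simp add: norm_basis)
    also have "\<dots> \<le> norm A" by (rule spectral_norm_le_norm)
    finally show ?thesis .
  qed
  then have "trace_norm A \<le> (\<Sum>k<CARD('n). norm A)"
    unfolding trace_norm_diagonalizes[OF d] by (intro sum_mono) auto
  then show "trace_norm A \<le> real CARD('n) * norm A" by simp
qed

lemma trace_norm_ketbra_self: "norm u = 1 \<Longrightarrow> trace_norm (ketbra u u) \<le> 1" for u :: "'n::finite cvec"
proof -
  assume u: "norm u = 1"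
  obtain X :: "'n cmat" where X: "spectral_norm X \<le> 1"
    "trace (ketbra u u ** X) = complex_of_real (trace_norm (ketbra u u))"
    using trace_norm_attained hermitian_ketbra by metis
  have "trace_norm (ketbra u u) = Re (braket u (X *v u))"
    using X(2) by (simp add: trace_mul_sym[of _ X] trace_mult_ketbra)
  also have "\<dots> \<le> spectral_norm X"
    using norm_braket_mv_le[of u X u] u complex_Re_le_cmod[of "braket u (X *v u)"] by simp
  finally show ?thesis using X(1) by simp
qed

lemma continuous_on_trace_norm: "continuous_on {A :: 'n::finite cmat. hermitian A} trace_norm"
proof -
  obtain C where C: "\<And>A :: 'n cmat. hermitian A \<Longrightarrow> trace_norm A \<le> C * norm A"
    using trace_norm_le_norm by blast
  have le: "trace_norm A - trace_norm B \<le> \<bar>C\<bar> * norm (A - B)"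
    if "hermitian A" "hermitian B" for A B :: "'n cmat"
  proof -
    have "trace_norm A \<le> trace_norm (A - B) + trace_norm B"
      using trace_norm_triangle[OF hermitian_diff[OF that] that(2)] by simp
    also have "trace_norm (A - B) \<le> C * norm (A - B)" by (intro C hermitian_diff that)
    also have "\<dots> \<le> \<bar>C\<bar> * norm (A - B)" by (intro mult_right_mono) auto
    finally show ?thesis by simp
  qed
  have "lipschitz_on \<bar>C\<bar> {A :: 'n cmat. hermitian A} trace_norm"
  proof (rule lipschitz_onI)
    fix A B :: "'n cmat" assume "A \<in> {A. hermitian A}" "B \<in> {A. hermitian A}"
    then show "dist (trace_norm A) (trace_norm B) \<le> \<bar>C\<bar> * dist A B"
      using le[of A B] le[of B A] by (simp add: dist_norm abs_le_iff norm_minus_commute)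
  qed simp
  then show ?thesis by (rule lipschitz_on_continuous_on)
qed

section \<open>Rank of a diagonal operator\<close>

text \<open>\<open>rank\<close> is taken as row rank. The rows are combinations of the complex
  conjugates of the basis vectors with nonzero \<open>c k\<close>; orthonormality recovers these
  conjugates from the rows and shows that they are independent.\<close>

lemma (in onb) rank_diag_op: "rank (diag_op c) = card {k. k < CARD('n) \<and> c k \<noteq> 0}"
proof -
  let ?S = "{k. k < CARD('n) \<and> c k \<noteq> 0}"
  define u where "u k = (\<chi> j. cnj (b k $ j))" for k
  have uu: "braket (u k) (u l) = (if k = l then 1 else 0)" if "k < CARD('n)" "l < CARD('n)" for k l
    using braket_basis[OF that(2) that(1)] by (simp add: braket_def u_def mult.commute)
  have inj: "inj_on u ?S"
  proof (rule inj_onI)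
    fix k l assume "k \<in> ?S" "l \<in> ?S" "u k = u l"
    then show "k = l" using uu[of k l] uu[of k k] by (auto split: if_splits)
  qed
  have row: "row i (diag_op c) = (\<Sum>k\<in>?S. (c k * b k $ i) *s u k)" for i
  proof -
    have "row i (diag_op c) = (\<Sum>k<CARD('n). (c k * b k $ i) *s u k)"
      by (simp add: vec_eq_iff row_def diag_op_nth u_def mult_ac)
    also have "\<dots> = (\<Sum>k\<in>?S. (c k * b k $ i) *s u k)"
      by (rule sum.mono_neutral_right) auto
    finally show ?thesis .
  qed
  have u_rows: "u k = (\<Sum>i\<in>UNIV. (cnj (b k $ i) / c k) *s row i (diag_op c))" if k: "k \<in> ?S" for k
  proof -
    have "(\<Sum>i\<in>UNIV. cnj (b k $ i) / c k * diag_op c $ i $ j) = cnj (b k $ j)" for j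
    proof -
      have "(\<Sum>i\<in>UNIV. cnj (b k $ i) / c k * diag_op c $ i $ j) =
          (\<Sum>i\<in>UNIV. \<Sum>l<CARD('n). c l / c k * cnj (b l $ j) * (cnj (b k $ i) * b l $ i))"
        by (simp add: diag_op_nth sum_distrib_left mult_ac)
      also have "\<dots> = (\<Sum>l<CARD('n). \<Sum>i\<in>UNIV. c l / c k * cnj (b l $ j) * (cnj (b k $ i) * b l $ i))"
        by (rule sum.swap)
      also have "\<dots> = (\<Sum>l<CARD('n). if l = k then cnj (b k $ j) else 0)"
      proof (rule sum.cong)
        fix l assume "l \<in> {..<CARD('n)}"
        then have "braket (b k) (b l) = (if l = k then 1 else 0)" using braket_basis[of k l] k by auto
        then show "(\<Sum>i\<in>UNIV. c l / c k * cnj (b l $ j) * (cnj (b k $ i) * b l $ i)) =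
            (if l = k then cnj (b k $ j) else 0)"
          unfolding sum_distrib_left[symmetric] braket_def[symmetric] using k by simp
      qed simp
      also have "\<dots> = cnj (b k $ j)" using k by simp
      finally show ?thesis .
    qed
    then show ?thesis by (simp add: vec_eq_iff u_def row_def)
  qed
  have "vec.span (rows (diag_op c)) = vec.span (u ` ?S)"
  proof (rule vec.span_eq[THEN iffD2], intro conjI subsetI)
    fix x assume "x \<in> rows (diag_op c)"
    then obtain i where "x = row i (diag_op c)" by (auto simp: rows_def)
    then show "x \<in> vec.span (u ` ?S)"
      unfolding row by (simp only:) (intro vec.span_sum vec.span_scale vec.span_base imageI)
  next
    fix x assume "x \<in> u ` ?S"
    then obtain k where "k \<in> ?S" "x = u k" by blast
    then show "x \<in> vec.span (rows (diag_op c))"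
      by (simp only: u_rows) (intro vec.span_sum vec.span_scale vec.span_base, auto simp: rows_def)
  qed
  moreover have "vec.independent (u ` ?S)"
  proof
    assume "vec.dependent (u ` ?S)"
    then obtain f k where f: "(\<Sum>v\<in>u ` ?S. f v *s v) = 0" and k: "k \<in> ?S" "f (u k) \<noteq> 0"
      using vec.dependent_finite[of "u ` ?S"] by auto
    have "0 = braket (u k) (\<Sum>l\<in>?S. f (u l) *s u l)"
      using f sum.reindex[OF inj, of "\<lambda>v. f v *s v"] by simp
    also have "\<dots> = (\<Sum>l\<in>?S. if l = k then f (u k) else 0)"
      unfolding braket_sum_right using k by (intro sum.cong) (auto simp: uu)
    also have "\<dots> = f (u k)" using k by simp
    finally show False using k by simp
  qed
  ultimately have "vec.dim (rows (diag_op c)) = card (u ` ?S)"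
    by (intro vec.dim_eq_card) auto
  then show ?thesis by (simp add: row_rank_def_gen card_image inj)
qed

lemma rank_diagonalizes:
  assumes "diagonalizes b a (A :: 'n::finite cmat)"
  shows "rank A = card {k. k < CARD('n) \<and> a k \<noteq> 0}"
proof -
  interpret onb b using diagonalizes_onb assms .
  show ?thesis using assms by (simp add: diagonalizes_iff rank_diag_op)
qed

section \<open>The optimization problem: existence, sparsity and dual certificate of a
  minimizer\<close>

section \<open>The optimization problem\<close>

lemma trace_hermitian_mult_real:
  assumes "hermitian A" "hermitian B"
  shows "trace (A ** B) = complex_of_real (Re (trace (A ** B)))"
proof -
  have "cnj (trace (A ** B)) = trace (A ** B)"
    using assms by (simp add: trace_dagger[symmetric] dagger_mult hermitian_def trace_mul_sym[of B A])
  then show ?thesis by (simp add: complex_eq_iff)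
qed

lemma drift_add: "drift g (x + y) = drift g x + drift g y"
  by (simp add: drift_def algebra_simps sum.distrib)
lemma drift_scaleR: "drift g (r *\<^sub>R x) = r *\<^sub>R drift g x"
  by (simp add: drift_def scaleR_sum_right)

text \<open>The absolute value is affine until the sign flips. Reaching zero is allowed, as the
  removal of an eigenvalue requires.\<close>

lemma abs_add_weak_sign:
  fixes a x :: real
  assumes "a \<noteq> 0" "a * x \<ge> 0 \<or> \<bar>x\<bar> \<le> \<bar>a\<bar>"
  shows "\<bar>a + x\<bar> = \<bar>a\<bar> + sgn a * x"
  using assms by (auto simp: sgn_if abs_if zero_le_mult_iff split: if_splits)

text \<open>Linear dependence for an indexed family. Passing to the image set forgets repetitions,
  so a repeated vector is treated separately: the difference of its two copies is the
  relation.\<close>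

lemma nontrivial_relation:
  fixes w :: "nat \<Rightarrow> 'a::euclidean_space"
  assumes "finite S" "card S > DIM('a)"
  obtains \<beta> k where "(\<Sum>k\<in>S. \<beta> k *\<^sub>R w k) = 0" "k \<in> S" "\<beta> k \<noteq> 0"
proof (cases "inj_on w S")
  case True
  have "dependent (w ` S)" using assms by (intro dependent_biggerset) (auto simp: card_image True)
  then obtain f k where "(\<Sum>v\<in>w ` S. f v *\<^sub>R v) = 0" "k \<in> S" "f (w k) \<noteq> 0"
    using real_vector.dependent_finite[of "w ` S"] assms(1) by auto
  then show ?thesis using that[of "f \<circ> w" k] sum.reindex[OF True, of "\<lambda>v. f v *\<^sub>R v"] by simp
next
  case False
  then obtain k l where kl: "k \<in> S" "l \<in> S" "k \<noteq> l" "w k = w l" by (auto simp: inj_on_def)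
  let ?\<beta> = "\<lambda>i. if i = k then 1 else if i = l then -1 else (0::real)"
  have "(\<Sum>i\<in>S. ?\<beta> i *\<^sub>R w i) = (\<Sum>i\<in>S. (if i = k then w k else 0) - (if i = l then w l else 0))"
    using kl by (intro sum.cong) auto
  also have "\<dots> = 0" using kl assms(1) by (simp add: sum_subtractf)
  finally show ?thesis using that[of ?\<beta> k] kl by simp
qed

locale estimation =
  fixes g :: "'m::finite \<Rightarrow> 'n::finite cmat" and \<alpha> :: "real^'m"
  assumes herm: "\<And>j. hermitian (g j)"
    and traceless: "\<And>j. trace (g j) = 0"
    and inj_g: "inj g"
    and indep_g: "independent (range g)"
    and \<alpha>_nonzero: "\<alpha> \<noteq> 0"
begin

lemma hermitian_drift: "hermitian (drift g \<theta>)"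
  unfolding drift_def by (intro hermitian_sum hermitian_scaleR herm)

lemma trace_drift: "trace (drift g \<theta>) = 0"
  by (simp add: drift_def trace_sum trace_scaleR traceless)

lemma trace_mult_drift: "trace (A ** drift g \<theta>) = (\<Sum>j\<in>UNIV. \<theta> $ j *\<^sub>R trace (A ** g j))"
  by (simp add: drift_def mult_sum_right trace_sum mmult_scaleR_right trace_scaleR)

lemma drift_eq_0_iff: "drift g c = 0 \<longleftrightarrow> c = 0"
proof
  assume "drift g c = 0"
  then have "(\<Sum>v\<in>range g. (c $ inv g v) *\<^sub>R v) = 0"
    using sum.reindex[OF inj_g, of "\<lambda>v. (c $ inv g v) *\<^sub>R v"] inj_g by (simp add: drift_def)
  then have "c $ inv g v = 0" if "v \<in> range g" for v
    using indep_g real_vector.dependent_finite[of "range g"] that by auto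
  then have "c $ j = 0" for j using inj_g by (metis inv_f_f rangeI)
  then show "c = 0" by (simp add: vec_eq_iff)
qed (simp add: drift_def)

lemma feasible_trace_drift:
  assumes "A \<in> feasible g \<alpha>" shows "trace (A ** drift g \<theta>) = complex_of_real (\<alpha> \<bullet> \<theta>)"
  using assms by (simp add: trace_mult_drift feasible_def inner_vec_def scaleR_conv_of_real mult.commute)

text \<open>A solution is sought among the combinations of the \<open>g j\<close>, which are
  Hermitian and traceless. There the constraint map is the Gram matrix of the trace inner product,
  injective by linear independence and therefore surjective.\<close>

lemma feasible_nonempty: "feasible g \<alpha> \<noteq> {}"
proof -
  define T :: "real^'m \<Rightarrow> real^'m" where "T c = (\<chi> i. Re (trace (drift g c ** g i)))" for c
  have lin: "linear T"
    by (rule linearI)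
      (auto simp: T_def vec_eq_iff drift_add drift_scaleR mult_add_left mmult_scaleR_left trace_add trace_scaleR)
  have "inj T"
  proof (rule linear_injective_0[OF lin, THEN iffD2], intro allI impI)
    fix c assume "T c = 0"
    then have 0: "Re (trace (drift g c ** g i)) = 0" for i by (simp add: T_def vec_eq_iff)
    have "inner (drift g c) (drift g c) = Re (trace (drift g c ** drift g c))"
      using hermitian_drift by (simp add: inner_cmat hermitian_def)
    also have "\<dots> = 0" unfolding trace_mult_drift by (simp add: 0)
    finally show "c = 0" by (simp add: drift_eq_0_iff)
  qed
  then obtain c where "T c = \<alpha>" using linear_injective_imp_surjective[OF lin] by (metis surjD)
  then have c: "Re (trace (drift g c ** g i)) = \<alpha> $ i" for i by (auto simp: T_def)
  have "trace (drift g c ** g i) = complex_of_real (\<alpha> $ i)" for i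
    using trace_hermitian_mult_real[OF hermitian_drift herm] c by metis
  then have "drift g c \<in> feasible g \<alpha>"
    by (simp add: feasible_def hermitian_drift trace_drift)
  then show ?thesis by blast
qed

lemma closed_feasible: "closed (feasible g \<alpha>)"
proof -
  have "feasible g \<alpha> = {A. (\<chi> i j. cnj (A $ j $ i)) = A} \<inter>
      (\<Inter>j. {A. (\<Sum>i\<in>UNIV. \<Sum>k\<in>UNIV. A $ i $ k * g j $ k $ i) = complex_of_real (\<alpha> $ j)}) \<inter>
      {A. (\<Sum>i\<in>UNIV. A $ i $ i) = 0}"
    by (auto simp: feasible_def hermitian_def dagger_def trace_def mat_nth)
  also have "closed \<dots>"
    by (intro closed_Int closed_INT ballI closed_Collect_eq continuous_intros continuous_on_vec_lambda)
  finally show ?thesis .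
qed

text \<open>Cutting the closed feasible set by the ball of radius \<open>trace_norm A0\<close> makes
  it compact and loses no better candidate, because the norm is at most the trace norm.\<close>

lemma exists_minimizer: obtains A where "minimizer g \<alpha> A"
proof -
  obtain A0 where A0: "A0 \<in> feasible g \<alpha>" using feasible_nonempty by blast
  have fh: "feasible g \<alpha> \<subseteq> {A. hermitian A}" by (auto simp: feasible_def)
  let ?K = "feasible g \<alpha> \<inter> cball 0 (trace_norm A0)"
  have "compact ?K" by (intro closed_Int_compact closed_feasible) auto
  moreover have "A0 \<in> ?K" using A0 fh norm_le_trace_norm by auto
  moreover have "continuous_on ?K trace_norm"
    using continuous_on_trace_norm by (rule continuous_on_subset) (use fh in auto)
  ultimately have "\<exists>A\<in>?K. \<forall>B\<in>?K. trace_norm A \<le> trace_norm B"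
    by (intro continuous_attains_inf) auto
  then obtain A where A: "A \<in> ?K" "\<And>B. B \<in> ?K \<Longrightarrow> trace_norm A \<le> trace_norm B" by blast
  have "trace_norm A \<le> trace_norm B" if "B \<in> feasible g \<alpha>" for B
  proof (cases "B \<in> ?K")
    case False
    then have "trace_norm A0 < norm B" using that by auto
    also have "norm B \<le> trace_norm B" using norm_le_trace_norm fh that by auto
    finally show ?thesis using A(2)[OF \<open>A0 \<in> ?K\<close>] by simp
  qed (rule A(2))
  then show ?thesis using that A(1) by (auto simp: minimizer_def)
qed

lemma gamma_eq: assumes "minimizer g \<alpha> A" shows "gamma g \<alpha> = trace_norm A / 2"
  unfolding gamma_def by (rule cInf_eq_minimum) (use assms in \<open>auto simp: minimizer_def\<close>)

lemma gamma_pos: "0 < gamma g \<alpha>"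
proof -
  obtain A where A: "minimizer g \<alpha> A" by (rule exists_minimizer)
  then have F: "A \<in> feasible g \<alpha>" by (simp add: minimizer_def)
  have "A \<noteq> 0"
  proof
    assume "A = 0"
    then have "\<alpha> $ j = 0" for j using F by (auto simp: feasible_def)
    then show False using \<alpha>_nonzero by (simp add: vec_eq_iff)
  qed
  then have "0 < norm A" by simp
  also have "norm A \<le> trace_norm A" using F by (intro norm_le_trace_norm) (simp add: feasible_def)
  finally show ?thesis using gamma_eq[OF A] by simp
qed

lemma gamma_le: "B \<in> feasible g \<alpha> \<Longrightarrow> gamma g \<alpha> \<le> trace_norm B / 2"
  using exists_minimizer gamma_eq by (metis minimizer_def)

text \<open>
  More than \<open>m + 1\<close> nonzero eigenvalues can be moved inside the feasible set without changing the
  eigenbasis; by minimality this does not change the trace norm as long as no eigenvalue changes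
  sign, and one moves until some eigenvalue vanishes.
\<close>

lemma reduce_support:
  assumes ob: "orthonormal_basis b"
    and min: "minimizer g \<alpha> (onb.diag_op b (\<lambda>k. complex_of_real (a k)))"
    and big: "card {k. k < CARD('n) \<and> a k \<noteq> 0} > CARD('m) + 1"
  shows "\<exists>a'. minimizer g \<alpha> (onb.diag_op b (\<lambda>k. complex_of_real (a' k))) \<and>
    card {k. k < CARD('n) \<and> a' k \<noteq> 0} < card {k. k < CARD('n) \<and> a k \<noteq> 0}"
proof -
  interpret onb b by unfold_locales (rule ob)
  let ?S = "{k. k < CARD('n) \<and> a k \<noteq> 0}"
  \<comment> \<open>A change of the eigenvalues preserves feasibility when it is a linear relation
    among these vectors. The first component carries the \<open>m\<close> trace conditions and the
    second the tracelessness, which is the origin of \<open>m + 1\<close>.\<close>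
  define w where "w k = ((\<chi> j. Re (braket (b k) (g j *v b k))) :: real^'m, 1 :: real)" for k
  have "card ?S > DIM((real^'m) \<times> real)" using big by simp
  then obtain \<beta>0 k1 where \<beta>0: "(\<Sum>k\<in>?S. \<beta>0 k *\<^sub>R w k) = 0" and k1: "k1 \<in> ?S" "\<beta>0 k1 \<noteq> 0"
    using nontrivial_relation[of ?S w] by auto
  \<comment> \<open>The sign makes the perturbation push \<open>a k1\<close> towards zero, so that a
    positive step annihilates some eigenvalue.\<close>
  define \<sigma> where "\<sigma> = - sgn (a k1 * \<beta>0 k1)"
  define \<beta> where "\<beta> k = (if k \<in> ?S then \<sigma> * \<beta>0 k else 0)" for k
  have \<sigma>: "\<bar>\<sigma>\<bar> = 1" using k1 by (simp add: \<sigma>_def sgn_if)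
  have "(\<Sum>k\<in>?S. \<beta> k *\<^sub>R w k) = \<sigma> *\<^sub>R (\<Sum>k\<in>?S. \<beta>0 k *\<^sub>R w k)"
    by (simp add: scaleR_sum_right \<beta>_def)
  then have rel: "(\<Sum>k\<in>?S. \<beta> k *\<^sub>R w k) = 0" using \<beta>0 by simp
  have sumS: "(\<Sum>k<CARD('n). f k) = (\<Sum>k\<in>?S. f k)" if "\<And>k. k \<notin> ?S \<Longrightarrow> k < CARD('n) \<Longrightarrow> f k = 0" for f :: "nat \<Rightarrow> real"
    by (rule sum.mono_neutral_right) (use that in auto)
  have rel1: "(\<Sum>k<CARD('n). \<beta> k) = 0"
  proof -
    have "snd (\<Sum>k\<in>?S. \<beta> k *\<^sub>R w k) = (\<Sum>k\<in>?S. \<beta> k)" by (simp add: snd_sum w_def)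
    then show ?thesis using rel sumS[of \<beta>] by (simp add: \<beta>_def)
  qed
  have relg: "(\<Sum>k<CARD('n). \<beta> k * Re (braket (b k) (g j *v b k))) = 0" for j
  proof -
    have "fst (\<Sum>k\<in>?S. \<beta> k *\<^sub>R w k) $ j = (\<Sum>k\<in>?S. \<beta> k * Re (braket (b k) (g j *v b k)))"
      by (simp add: fst_sum w_def)
    then show ?thesis using rel sumS[of "\<lambda>k. \<beta> k * Re (braket (b k) (g j *v b k))"] by (simp add: \<beta>_def)
  qed
  define A where "A s = diag_op (\<lambda>k. complex_of_real (a k + s * \<beta> k))" for s
  have A0: "A 0 \<in> feasible g \<alpha>" "trace_norm (A 0) = (\<Sum>k<CARD('n). \<bar>a k\<bar>)"
    using min by (simp_all add: minimizer_def A_def trace_norm_diag_op)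
  have feas: "A s \<in> feasible g \<alpha>" for s
  proof -
    have "trace (A s) = trace (A 0) + complex_of_real (s * (\<Sum>k<CARD('n). \<beta> k))"
      by (simp add: A_def trace_diag_op sum.distrib sum_distrib_left)
    then have 1: "trace (A s) = 0" using A0(1) by (simp add: rel1 feasible_def)
    have "trace (A s ** g j) = complex_of_real (\<alpha> $ j)" for j
    proof -
      have r: "braket (b k) (g j *v b k) = complex_of_real (Re (braket (b k) (g j *v b k)))" for k
        using hermitian_braket_real[OF herm] by (simp add: complex_eq_iff)
      have "trace (A s ** g j) = trace (A 0 ** g j) +
          (\<Sum>k<CARD('n). complex_of_real s * (complex_of_real (\<beta> k) * braket (b k) (g j *v b k)))"
        by (simp add: A_def trace_diag_op_mult sum.distrib[symmetric] algebra_simps)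
      also have "(\<Sum>k<CARD('n). complex_of_real s * (complex_of_real (\<beta> k) * braket (b k) (g j *v b k)))
          = complex_of_real (s * (\<Sum>k<CARD('n). \<beta> k * Re (braket (b k) (g j *v b k))))"
        by (subst r) (simp add: sum_distrib_left)
      finally show ?thesis using A0(1) by (simp add: relg feasible_def)
    qed
    then show ?thesis
      using 1 hermitian_diag_op[of "\<lambda>k. a k + s * \<beta> k"] by (simp add: feasible_def A_def)
  qed
  \<comment> \<open>Slope of the trace norm along the perturbation, valid as long as no eigenvalue
    changes sign.\<close>
  define D where "D = (\<Sum>k<CARD('n). sgn (a k) * \<beta> k)"
  have tn: "trace_norm (A s) = trace_norm (A 0) + s * D"
    if "\<And>k. k \<in> ?S \<Longrightarrow> a k * (s * \<beta> k) \<ge> 0 \<or> \<bar>s * \<beta> k\<bar> \<le> \<bar>a k\<bar>" for s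
  proof -
    have "trace_norm (A s) = (\<Sum>k<CARD('n). \<bar>a k\<bar> + s * (sgn (a k) * \<beta> k))"
      unfolding A_def trace_norm_diag_op
    proof (rule sum.cong)
      fix k assume "k \<in> {..<CARD('n)}"
      then show "\<bar>a k + s * \<beta> k\<bar> = \<bar>a k\<bar> + s * (sgn (a k) * \<beta> k)"
        using abs_add_weak_sign[of "a k" "s * \<beta> k"] that[of k]
        by (cases "a k = 0") (auto simp: \<beta>_def mult_ac)
    qed simp
    then show ?thesis by (simp add: A0 D_def sum.distrib sum_distrib_left)
  qed
  have opt: "trace_norm (A 0) \<le> trace_norm (A s)" for s
    using min feas[of s] by (simp add: minimizer_def A_def)
  have "D \<le> 0"
  proof -
    \<comment> \<open>A small step in the opposite direction flips no sign and changes the trace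
      norm by \<open>- s * D\<close>, which minimality forbids to be negative. The
      \<open>+ 1\<close> takes care of vanishing \<open>\<beta> k\<close>.\<close>
    define s where "s = Min ((\<lambda>k. \<bar>a k\<bar> / (\<bar>\<beta> k\<bar> + 1)) ` ?S)"
    have fin: "finite ((\<lambda>k. \<bar>a k\<bar> / (\<bar>\<beta> k\<bar> + 1)) ` ?S)" "(\<lambda>k. \<bar>a k\<bar> / (\<bar>\<beta> k\<bar> + 1)) ` ?S \<noteq> {}"
      using k1 by auto
    have s: "s > 0" unfolding s_def using fin by (subst Min_gr_iff) (auto intro!: divide_pos_pos)
    have "\<bar>- s * \<beta> k\<bar> \<le> \<bar>a k\<bar>" if "k \<in> ?S" for k
    proof -
      have "s \<le> \<bar>a k\<bar> / (\<bar>\<beta> k\<bar> + 1)" unfolding s_def using that fin by (intro Min_le) auto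
      then have "s * (\<bar>\<beta> k\<bar> + 1) \<le> \<bar>a k\<bar>" by (simp add: pos_le_divide_eq)
      then show ?thesis using s by (simp add: abs_mult algebra_simps)
    qed
    then have "trace_norm (A (- s)) = trace_norm (A 0) - s * D" using tn[of "- s"] by simp
    then have "s * D \<le> 0" using opt[of "- s"] by simp
    then show ?thesis using s by (simp add: mult_le_0_iff)
  qed
  \<comment> \<open>Only eigenvalues that move towards zero limit the step; the smallest of their
    hitting times is the step at which one of them vanishes.\<close>
  define Neg where "Neg = {k \<in> ?S. a k * \<beta> k < 0}"
  have "a k1 * \<beta> k1 = - \<bar>a k1 * \<beta>0 k1\<bar>"
    using k1 by (simp add: \<beta>_def \<sigma>_def sgn_if abs_if algebra_simps)
  then have "k1 \<in> Neg" using k1 by (simp add: Neg_def)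
  have finN: "finite ((\<lambda>k. \<bar>a k\<bar> / \<bar>\<beta> k\<bar>) ` Neg)" "(\<lambda>k. \<bar>a k\<bar> / \<bar>\<beta> k\<bar>) ` Neg \<noteq> {}"
    using \<open>k1 \<in> Neg\<close> by (auto simp: Neg_def)
  define s where "s = Min ((\<lambda>k. \<bar>a k\<bar> / \<bar>\<beta> k\<bar>) ` Neg)"
  obtain k0 where k0: "k0 \<in> Neg" "s = \<bar>a k0\<bar> / \<bar>\<beta> k0\<bar>"
    using Min_in[OF finN] unfolding s_def by blast
  have s: "s \<ge> 0" using k0 by simp
  have ts: "a k * (s * \<beta> k) \<ge> 0 \<or> \<bar>s * \<beta> k\<bar> \<le> \<bar>a k\<bar>" if k: "k \<in> ?S" for k
  proof (cases "k \<in> Neg")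
    case True
    then have "s \<le> \<bar>a k\<bar> / \<bar>\<beta> k\<bar>" unfolding s_def using finN by (intro Min_le) auto
    moreover have "\<bar>\<beta> k\<bar> > 0" using True by (auto simp: Neg_def)
    ultimately have "s * \<bar>\<beta> k\<bar> \<le> \<bar>a k\<bar>" by (simp add: pos_le_divide_eq)
    then show ?thesis using s by (simp add: abs_mult)
  next
    case False
    then have "a k * \<beta> k \<ge> 0" using k by (simp add: Neg_def)
    then have "s * (a k * \<beta> k) \<ge> 0" using s by (rule mult_nonneg_nonneg[rotated])
    then show ?thesis by (simp add: mult_ac)
  qed
  have "trace_norm (A s) \<le> trace_norm (A 0)"
    using tn[of s] ts s \<open>D \<le> 0\<close> by (simp add: mult_nonneg_nonpos)
  then have "minimizer g \<alpha> (A s)"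
    using min feas[of s] by (force simp: minimizer_def A_def)
  moreover have "card {k. k < CARD('n) \<and> a k + s * \<beta> k \<noteq> 0} < card ?S"
  proof (rule psubset_card_mono)
    have "a k0 + s * \<beta> k0 = 0"
    proof -
      have "a k0 * \<beta> k0 < 0" using k0(1) by (simp add: Neg_def)
      then have "s * \<beta> k0 = - a k0"
        unfolding k0(2) by (auto simp: abs_if mult_less_0_iff split: if_splits)
      then show ?thesis by simp
    qed
    moreover have "k0 \<in> ?S" using k0 by (simp add: Neg_def)
    moreover have "{k. k < CARD('n) \<and> a k + s * \<beta> k \<noteq> 0} \<subseteq> ?S" by (auto simp: \<beta>_def)
    ultimately show "{k. k < CARD('n) \<and> a k + s * \<beta> k \<noteq> 0} \<subset> ?S" by blast
  qed simp
  ultimately show ?thesis unfolding A_def by (intro exI[of _ "\<lambda>k. a k + s * \<beta> k"]) simp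
qed

lemma low_rank_minimizer:
  "\<exists>A b a. minimizer g \<alpha> A \<and> diagonalizes b a A \<and> rank A \<le> CARD('m) + 1"
proof -
  obtain A where A: "minimizer g \<alpha> A" by (rule exists_minimizer)
  then have "hermitian A" by (simp add: minimizer_def feasible_def)
  then obtain b a where d: "diagonalizes b a A" by (rule spectral_theorem)
  interpret onb b using diagonalizes_onb d .
  let ?P = "\<lambda>a. minimizer g \<alpha> (diag_op (\<lambda>k. complex_of_real (a k)))"
  let ?c = "\<lambda>a :: nat \<Rightarrow> real. card {k. k < CARD('n) \<and> a k \<noteq> 0}"
  have "?P a" using A d by (simp add: diagonalizes_iff)
  then obtain a' where a': "?P a'" "\<And>a''. ?P a'' \<Longrightarrow> ?c a' \<le> ?c a''"
    using ex_has_least_nat[of ?P a ?c] by blast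
  have "?c a' \<le> CARD('m) + 1"
    using reduce_support[OF orthonormal a'(1)] a'(2) by (meson not_le)
  moreover have "diagonalizes b a' (diag_op (\<lambda>k. complex_of_real (a' k)))" by (simp add: diagonalizes_iff)
  ultimately show ?thesis using a'(1) rank_diagonalizes by metis
qed

text \<open>
  The dual problem: \<open>v\<close> separates \<open>\<alpha>\<close> from the vectors \<open>(Tr (B g\<^sub>j))\<^sub>j\<close> of traceless \<open>B\<close> with
  \<open>\<parallel>B\<parallel>\<^sub>1 / 2 < \<gamma>\<close>; differences of two rank-one projections are such \<open>B\<close> up to scaling.
\<close>

lemma dual_certificate:
  obtains v where "v \<noteq> 0"
    "\<And>u w. norm u = 1 \<Longrightarrow> norm w = 1 \<Longrightarrow>
      gamma g \<alpha> * (Re (braket u (drift g v *v u)) - Re (braket w (drift g v *v w))) \<le> v \<bullet> \<alpha>"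
proof -
  let ?\<gamma> = "gamma g \<alpha>"
  define S where "S = {y :: real^'m. \<exists>B. hermitian B \<and> trace B = 0 \<and> trace_norm B / 2 < ?\<gamma> \<and>
    (\<forall>j. trace (B ** g j) = complex_of_real (y $ j))}"
  have "0 \<in> S" unfolding S_def using gamma_pos trace_norm_scaleR[of "0 :: 'n cmat" 0]
    by (intro CollectI exI[of _ 0]) auto
  have "convex S"
  proof (rule convexI)
    fix x y and p q :: real
    assume "x \<in> S" "y \<in> S" and pq: "0 \<le> p" "0 \<le> q" "p + q = 1"
    then obtain B C where B: "hermitian B" "trace B = 0" "trace_norm B / 2 < ?\<gamma>"
        "\<And>j. trace (B ** g j) = complex_of_real (x $ j)"
      and C: "hermitian C" "trace C = 0" "trace_norm C / 2 < ?\<gamma>"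
        "\<And>j. trace (C ** g j) = complex_of_real (y $ j)" unfolding S_def by blast
    have "trace_norm (p *\<^sub>R B + q *\<^sub>R C) \<le> p * trace_norm B + q * trace_norm C"
      using trace_norm_triangle[of "p *\<^sub>R B" "q *\<^sub>R C"] pq B C
      by (simp add: hermitian_scaleR trace_norm_scaleR)
    moreover have "p * (trace_norm B / 2) + q * (trace_norm C / 2) < ?\<gamma>"
      using convex_bound_lt[OF B(3) C(3) pq] .
    ultimately have "trace_norm (p *\<^sub>R B + q *\<^sub>R C) / 2 < ?\<gamma>" by simp
    moreover have "trace ((p *\<^sub>R B + q *\<^sub>R C) ** g j) = complex_of_real ((p *\<^sub>R x + q *\<^sub>R y) $ j)" for j
      by (simp add: mult_add_left mmult_scaleR_left trace_add trace_scaleR B C scaleR_conv_of_real[where 'a=complex])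
    ultimately show "p *\<^sub>R x + q *\<^sub>R y \<in> S"
      unfolding S_def using B C
      by (intro CollectI exI[of _ "p *\<^sub>R B + q *\<^sub>R C"])
        (simp add: hermitian_add hermitian_scaleR trace_add trace_scaleR)
  qed
  moreover have "\<alpha> \<notin> S"
  proof
    assume "\<alpha> \<in> S"
    then obtain B where "B \<in> feasible g \<alpha>" "trace_norm B / 2 < ?\<gamma>"
      unfolding S_def feasible_def by blast
    then show False using gamma_le by force
  qed
  ultimately obtain v c where v: "v \<noteq> 0" "\<And>x. x \<in> S \<Longrightarrow> v \<bullet> x \<le> c" "v \<bullet> \<alpha> \<ge> c"
    using separating_hyperplane_sets[of S "{\<alpha>}"] \<open>0 \<in> S\<close> by auto
  have "?\<gamma> * (Re (braket u (drift g v *v u)) - Re (braket w (drift g v *v w))) \<le> v \<bullet> \<alpha>"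
    if u: "norm u = 1" and w: "norm w = 1" for u w
  proof (rule field_le_mult_one_interval)
    \<comment> \<open>\<open>S\<close> is cut out by a strict inequality, so the extreme matrix
      itself may lie outside; it is scaled by \<open>z < 1\<close> and the inequality survives the
      passage to the limit.\<close>
    fix z :: real assume z: "0 < z" "z < 1"
    let ?r = "z * ?\<gamma>"
    let ?B = "?r *\<^sub>R (ketbra u u - ketbra w w)"
    define y :: "real^'m" where "y = (\<chi> j. ?r * (Re (braket u (g j *v u)) - Re (braket w (g j *v w))))"
    have h: "hermitian ?B" by (intro hermitian_scaleR hermitian_diff hermitian_ketbra)
    have "trace_norm (ketbra u u - ketbra w w) \<le> trace_norm (ketbra u u) + trace_norm (ketbra w w)"
      using trace_norm_triangle[of "ketbra u u" "(-1) *\<^sub>R ketbra w w"]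
        trace_norm_scaleR[OF hermitian_ketbra[of w], of "-1"]
      by (simp add: hermitian_ketbra hermitian_scaleR[of _ "-1", simplified])
    also have "\<dots> \<le> 2" using trace_norm_ketbra_self[OF u] trace_norm_ketbra_self[OF w] by simp
    finally have "trace_norm ?B \<le> ?r * 2"
      using z gamma_pos by (simp add: trace_norm_scaleR hermitian_diff hermitian_ketbra)
    moreover have "?r < 1 * ?\<gamma>" using z gamma_pos by (intro mult_strict_right_mono)
    ultimately have 1: "trace_norm ?B / 2 < ?\<gamma>" by simp
    have 2: "trace ?B = 0"
      using u w by (simp add: trace_scaleR trace_sub trace_ketbra braket_self)
    have "trace (?B ** g j) = complex_of_real (y $ j)" for j
    proof -
      have r: "braket x (g j *v x) = complex_of_real (Re (braket x (g j *v x)))" for x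
        using hermitian_braket_real[OF herm] by (simp add: complex_eq_iff)
      have "trace (?B ** g j) = ?r *\<^sub>R (braket u (g j *v u) - braket w (g j *v w))"
        by (simp add: mmult_scaleR_left mult_diff_left trace_scaleR trace_sub
            trace_mul_sym[of _ "g j"] trace_mult_ketbra)
      also have "\<dots> = complex_of_real (y $ j)"
        by (subst (1 2) r) (simp add: y_def scaleR_conv_of_real)
      finally show ?thesis .
    qed
    then have "y \<in> S" unfolding S_def using h 1 2 by blast
    then have "v \<bullet> y \<le> v \<bullet> \<alpha>" using v(2)[of y] v(3) by linarith
    moreover have "v \<bullet> y = z * (?\<gamma> * (Re (braket u (drift g v *v u)) - Re (braket w (drift g v *v w))))"
    proof -
      have dr: "Re (braket x (drift g v *v x)) = (\<Sum>j\<in>UNIV. v $ j * Re (braket x (g j *v x)))" for x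
        by (simp add: drift_def sum_mv scaleR_mv braket_sum_right)
      have "v \<bullet> y = (\<Sum>j\<in>UNIV. ?r * (v $ j * Re (braket u (g j *v u)) - v $ j * Re (braket w (g j *v w))))"
        by (simp add: inner_vec_def y_def right_diff_distrib mult_ac)
      also have "\<dots> = ?r * (Re (braket u (drift g v *v u)) - Re (braket w (drift g v *v w)))"
        unfolding dr sum_subtractf[symmetric] by (rule sum_distrib_left[symmetric])
      finally show ?thesis by (simp add: mult.assoc)
    qed
    ultimately show "z * (?\<gamma> * (Re (braket u (drift g v *v u)) - Re (braket w (drift g v *v w)))) \<le> v \<bullet> \<alpha>"
      by simp
  qed
  then show ?thesis using that v(1) by blast
qed

text \<open>Multiples of the identity only change the phase of an evolution, so what matters is the
  distance of \<open>drift g v\<close> from them: half the spread of its spectrum, reached at the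
  midpoint \<open>c\<close>. The certificate at extreme eigenvectors bounds the spread. A zero
  spread would make the traceless \<open>drift g v\<close> vanish, against independence, whence
  \<open>\<alpha> \<bullet> v\<close> is positive.\<close>

lemma dual_direction:
  obtains v c where "\<alpha> \<bullet> v > 0"
    "spectral_norm (drift g v - cscale (complex_of_real c) (mat 1)) \<le> (\<alpha> \<bullet> v) / (2 * gamma g \<alpha>)"
proof -
  obtain v where v: "v \<noteq> 0" and cert: "\<And>u w. norm u = 1 \<Longrightarrow> norm w = 1 \<Longrightarrow>
      gamma g \<alpha> * (Re (braket u (drift g v *v u)) - Re (braket w (drift g v *v w))) \<le> v \<bullet> \<alpha>"
    using dual_certificate by blast
  obtain b a where d: "diagonalizes b a (drift g v)" using spectral_theorem[OF hermitian_drift] by metis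
  interpret onb b using diagonalizes_onb d .
  have hd: "drift g v = diag_op (\<lambda>k. complex_of_real (a k))" using d by (simp add: diagonalizes_iff)
  have cert': "gamma g \<alpha> * (a k - a l) \<le> \<alpha> \<bullet> v" if "k < CARD('n)" "l < CARD('n)" for k l
    using cert[OF norm_basis[OF that(1)] norm_basis[OF that(2)]] that
    by (simp add: hd diag_op_basis braket_basis inner_commute)
  let ?R = "a ` {..<CARD('n)}"
  have fin: "finite ?R" "?R \<noteq> {}" by (auto simp: lessThan_empty_iff)
  obtain k where k: "k < CARD('n)" "a k = Max ?R" using Max_in[OF fin] by auto
  obtain l where l: "l < CARD('n)" "a l = Min ?R" using Min_in[OF fin] by auto
  have le: "a i \<le> a k" "a l \<le> a i" if "i < CARD('n)" for i
    unfolding k l using that fin by auto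
  have "a l < a k"
  proof (rule ccontr)
    assume "\<not> a l < a k"
    then have eq: "a i = a k" if "i < CARD('n)" for i using le[OF that] by simp
    have "complex_of_real (\<Sum>i<CARD('n). a i) = 0"
      using trace_drift[of v] by (simp add: hd trace_diag_op)
    then have "(\<Sum>i<CARD('n). a i) = 0" using of_real_eq_0_iff by blast
    moreover have "(\<Sum>i<CARD('n). a i) = (\<Sum>i<CARD('n). a k)" by (rule sum.cong) (use eq in auto)
    ultimately have "a k = 0" by simp
    then have "diag_op (\<lambda>k. complex_of_real (a k)) = diag_op (\<lambda>_. 0)"
      using eq by (intro diag_op_cong) simp
    then have "drift g v = 0" by (simp add: hd diag_op_def)
    then show False using v by (simp add: drift_eq_0_iff)
  qed
  then have pos: "\<alpha> \<bullet> v > 0"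
    using cert'[OF k(1) l(1)] mult_pos_pos[OF gamma_pos, of "a k - a l"] by simp
  define c where "c = (a k + a l) / 2"
  have "drift g v - cscale (complex_of_real c) (mat 1) = diag_op (\<lambda>i. complex_of_real (a i - c))"
    by (simp add: hd diag_op_1[symmetric] diag_op_cscale diag_op_diff)
  moreover have "spectral_norm (diag_op (\<lambda>i. complex_of_real (a i - c))) \<le> (\<alpha> \<bullet> v) / (2 * gamma g \<alpha>)"
  proof (rule spectral_norm_diag_op_le)
    fix i assume i: "i < CARD('n)"
    have "\<bar>a i - c\<bar> \<le> (a k - a l) / 2" using le[OF i] by (simp add: c_def abs_le_iff field_simps)
    also have "\<dots> \<le> (\<alpha> \<bullet> v) / (2 * gamma g \<alpha>)"
      using cert'[OF k(1) l(1)] gamma_pos by (simp add: field_simps)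
    finally show "cmod (complex_of_real (a i - c)) \<le> (\<alpha> \<bullet> v) / (2 * gamma g \<alpha>)"
      by (simp only: norm_of_real)
  qed
  ultimately show ?thesis using that[of v c] pos by simp
qed

end

section \<open>Propagators, the diagonal projection and concentration of the randomized
  product\<close>

section \<open>Time evolution\<close>

lemma (in onb) evol_diag_op:
  "evol (diag_op (\<lambda>k. complex_of_real (h k))) \<tau> = diag_op (\<lambda>k. cis (- (h k * \<tau>)))"
  by (simp add: evol_def diag_op_cscale mexp_diag_op cis_conv_exp mult_ac)

text \<open>The shape in which the spectral theorem serves evolutions: the propagator becomes a
  diagonal of phases, and estimates for it become scalar estimates for \<open>cis\<close>.\<close>

lemma hermitian_diag_form:
  fixes H :: "'n::finite cmat"
  assumes "hermitian H"
  obtains b h where "onb b" "H = onb.diag_op b (\<lambda>k. complex_of_real (h k))"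
    "\<And>k. k < CARD('n) \<Longrightarrow> \<bar>h k\<bar> \<le> spectral_norm H"
proof -
  obtain b h where d: "diagonalizes b h H" using spectral_theorem assms by metis
  interpret onb b using diagonalizes_onb d .
  have H: "H = diag_op (\<lambda>k. complex_of_real (h k))" using d by (simp add: diagonalizes_iff)
  have "\<bar>h k\<bar> \<le> spectral_norm H" if "k < CARD('n)" for k
    using norm_mv_le[of H "b k"] that by (simp add: norm_basis) (simp add: H diag_op_basis norm_basis)
  then show ?thesis using that onb_axioms H by blast
qed

lemma unitary_evol: assumes "hermitian H" shows "unitary (evol H \<tau>)"
proof -
  obtain b h where "onb b" and H: "H = onb.diag_op b (\<lambda>k. complex_of_real (h k))"
    using hermitian_diag_form assms by metis
  then interpret onb b by simp
  show ?thesis unfolding H evol_diag_op by (rule unitary_diag_op) simp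
qed

lemma evol_add: assumes "hermitian H" shows "evol H (s + \<tau>) = evol H s ** evol H \<tau>"
proof -
  obtain b h where "onb b" and H: "H = onb.diag_op b (\<lambda>k. complex_of_real (h k))"
    using hermitian_diag_form assms by metis
  then interpret onb b by simp
  show ?thesis unfolding H evol_diag_op diag_op_mult by (simp add: cis_mult algebra_simps)
qed

lemma evol_0: assumes "hermitian H" shows "evol H 0 = mat 1"
proof -
  obtain b h where "onb b" and H: "H = onb.diag_op b (\<lambda>k. complex_of_real (h k))"
    using hermitian_diag_form assms by metis
  then interpret onb b by simp
  show ?thesis unfolding H evol_diag_op by (simp add: diag_op_1)
qed

lemma cmod_cis_minus_1: "cmod (cis x - 1) \<le> \<bar>x\<bar>"
proof -
  have "(cmod (cis x - 1))\<^sup>2 = (cos x - 1)\<^sup>2 + (sin x)\<^sup>2" by (simp add: cmod_power2)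
  also have "\<dots> = 2 - 2 * cos x" using sin_cos_squared_add[of x] by (simp add: power2_eq_square algebra_simps)
  also have "\<dots> = (2 * sin (x / 2))\<^sup>2" using cos_double_sin[of "x / 2"] by (simp add: power2_eq_square)
  also have "\<dots> = \<bar>2 * sin (x / 2)\<bar>\<^sup>2" by simp
  also have "\<dots> \<le> \<bar>x\<bar>\<^sup>2"
    using abs_sin_x_le_abs_x[of "x / 2"] by (intro power_mono) (auto simp: abs_mult)
  finally show ?thesis by (rule power2_le_imp_le) simp
qed

lemma cmod_cis_second_order: "cmod (cis x - 1 - \<i> * x) \<le> x\<^sup>2 / 2"
proof -
  have "cmod (cis x - (\<Sum>k\<le>1. (\<i> * complex_of_real x) ^ k / fact k)) \<le> \<bar>x\<bar> ^ Suc 1 / fact (Suc 1)"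
    using iexp_approx1[of x 1] by (simp add: cis_conv_exp)
  then show ?thesis by (simp add: algebra_simps power2_eq_square)
qed

lemma evol_minus_1:
  fixes H :: "'n::finite cmat"
  assumes "hermitian H" shows "spectral_norm (evol H \<tau> - mat 1) \<le> spectral_norm H * \<bar>\<tau>\<bar>"
proof -
  obtain b h where "onb b" and H: "H = onb.diag_op b (\<lambda>k. complex_of_real (h k))"
    and h: "\<And>k. k < CARD('n) \<Longrightarrow> \<bar>h k\<bar> \<le> spectral_norm H"
    using hermitian_diag_form[OF assms] by metis
  then interpret onb b by simp
  have "spectral_norm (diag_op (\<lambda>k. cis (- (h k * \<tau>)) - 1)) \<le> spectral_norm H * \<bar>\<tau>\<bar>"
  proof (rule spectral_norm_diag_op_le)
    fix k assume "k < CARD('n)"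
    have "cmod (cis (- (h k * \<tau>)) - 1) \<le> \<bar>h k\<bar> * \<bar>\<tau>\<bar>"
      using cmod_cis_minus_1[of "- (h k * \<tau>)"] by (simp add: abs_mult)
    also have "\<dots> \<le> spectral_norm H * \<bar>\<tau>\<bar>" by (intro mult_right_mono h) (use \<open>k < _\<close> in auto)
    finally show "cmod (cis (- (h k * \<tau>)) - 1) \<le> spectral_norm H * \<bar>\<tau>\<bar>" .
  qed
  moreover have "evol H \<tau> - mat 1 = diag_op (\<lambda>k. cis (- (h k * \<tau>)) - 1)"
    unfolding diag_op_1[symmetric] by (subst H) (simp add: evol_diag_op diag_op_diff)
  ultimately show ?thesis by simp
qed

lemma evol_second_order:
  fixes H :: "'n::finite cmat"
  assumes "hermitian H"
  shows "spectral_norm (evol H \<tau> - (mat 1 - cscale (\<i> * complex_of_real \<tau>) H)) \<le> (spectral_norm H * \<tau>)\<^sup>2 / 2"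
proof -
  obtain b h where "onb b" and H: "H = onb.diag_op b (\<lambda>k. complex_of_real (h k))"
    and h: "\<And>k. k < CARD('n) \<Longrightarrow> \<bar>h k\<bar> \<le> spectral_norm H"
    using hermitian_diag_form[OF assms] by metis
  then interpret onb b by simp
  let ?c = "\<lambda>k. cis (- (h k * \<tau>)) - (1 - \<i> * complex_of_real \<tau> * complex_of_real (h k))"
  have "spectral_norm (diag_op ?c) \<le> (spectral_norm H * \<tau>)\<^sup>2 / 2"
  proof (rule spectral_norm_diag_op_le)
    fix k assume k: "k < CARD('n)"
    have "cmod (?c k) \<le> (h k * \<tau>)\<^sup>2 / 2"
      using cmod_cis_second_order[of "- (h k * \<tau>)"] by (simp add: algebra_simps)
    also have "\<dots> \<le> (spectral_norm H * \<tau>)\<^sup>2 / 2"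
      using h[OF k] by (simp add: power_mult_distrib mult_right_mono abs_le_square_iff[symmetric])
    finally show "cmod (?c k) \<le> (spectral_norm H * \<tau>)\<^sup>2 / 2" .
  qed
  moreover have "evol H \<tau> - (mat 1 - cscale (\<i> * complex_of_real \<tau>) H) = diag_op ?c"
    unfolding diag_op_1[symmetric]
    by (subst (1 2) H) (simp add: evol_diag_op diag_op_diff diag_op_cscale)
  ultimately show ?thesis by simp
qed

section \<open>Projection onto the diagonal\<close>

text \<open>Geometric sum of an \<open>N\<close>-th root of unity, which is different from one
  because distinct labels below \<open>N\<close> differ by less than \<open>N\<close>.\<close>

lemma sum_cis_roots:
  assumes "k < N" "l < N"
  shows "(\<Sum>s<N. cis (2 * pi * real s * (real l - real k) / real N)) = (if k = l then of_nat N else 0)"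
proof (cases "k = l")
  case False
  let ?x = "2 * pi * (real l - real k) / real N"
  let ?z = "cis ?x"
  have N: "N > 0" using assms by simp
  have pow: "cis (2 * pi * real s * (real l - real k) / real N) = ?z ^ s" for s
    unfolding Complex.DeMoivre by (rule arg_cong[where f = cis]) simp
  have "?z ^ N = cis (2 * pi * (real l - real k))" 
    unfolding Complex.DeMoivre by (rule arg_cong[where f = cis]) (use N in simp)
  also have "\<dots> = cis (2 * pi * real_of_int (int l - int k))" by simp
  also have "\<dots> = 1" by (rule cis_multiple_2pi) simp
  finally have "?z ^ N = 1" .
  moreover have "?z \<noteq> 1"
  proof
    assume "?z = 1"
    then have "cos ?x = 1" by (simp add: complex_eq_iff)
    then obtain n :: int where "?x = n * 2 * pi" by (auto simp: cos_one_2pi_int)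
    then have "2 * pi * ((real l - real k) / real N) = 2 * pi * n" by (simp add: mult_ac)
    then have "(real l - real k) / real N = n" by (subst (asm) mult_cancel_left) simp
    then have "real l - real k = n * real N" using N by (simp add: divide_eq_eq)
    then have "real_of_int (int l - int k) = real_of_int (n * int N)" by simp
    then have eq: "int l - int k = n * int N" by (simp only: of_int_eq_iff)
    then have "n \<noteq> 0" using False by auto
    then have "int N \<le> \<bar>n\<bar> * int N" using mult_right_mono[of 1 "\<bar>n\<bar>" "int N"] by simp
    also have "\<dots> = \<bar>int l - int k\<bar>" by (simp add: eq abs_mult)
    finally show False using assms by auto
  qed
  ultimately show ?thesis using False by (simp add: pow geometric_sum)
qed simp

context onb
begin

lemma mat_eqI2:
  fixes A B :: "'n cmat"
  assumes "\<And>k l. k < CARD('n) \<Longrightarrow> l < CARD('n) \<Longrightarrow> braket (b k) (A *v b l) = braket (b k) (B *v b l)"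
  shows "A = B"
  using assms by (intro mat_eqI vec_eqI)

lemma phase_unitary_eq:
  "phase_unitary b s = diag_op (\<lambda>k. cis (2 * pi * real s * real k / real CARD('n)))"
  by (simp add: phase_unitary_def diag_op_def)

lemma unitary_phase_unitary: "unitary (phase_unitary b s)"
  unfolding phase_unitary_eq by (rule unitary_diag_op) simp

text \<open>Conjugation multiplies the matrix element between \<open>b k\<close> and
  \<open>b l\<close> by a root of unity depending on \<open>l - k\<close>, and the average over
  \<open>s\<close> kills all but the diagonal. A general \<open>X\<close> is allowed because the
  reshaping averages short-time propagators, not the Hamiltonian.\<close>

lemma twirl:
  "(1 / real CARD('n)) *\<^sub>R (\<Sum>s<CARD('n). dagger (phase_unitary b s) ** X ** phase_unitary b s) = diag_part b X"
proof (rule mat_eqI2)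
  fix k l assume kl: "k < CARD('n)" "l < CARD('n)"
  have "braket (b k) ((dagger (phase_unitary b s) ** X ** phase_unitary b s) *v b l) =
      cis (2 * pi * real s * (real l - real k) / real CARD('n)) * braket (b k) (X *v b l)" for s
    unfolding matrix_vector_mul_assoc[symmetric] phase_unitary_eq dagger_diag_op
    by (simp add: kl diag_op_basis mv_cscale braket_diag_op cis_cnj cis_mult diff_divide_distrib
        right_diff_distrib add.commute mult.assoc[symmetric])
  then have "braket (b k) (((1 / real CARD('n)) *\<^sub>R (\<Sum>s<CARD('n). dagger (phase_unitary b s) ** X ** phase_unitary b s)) *v b l)
      = (1 / real CARD('n)) *\<^sub>R ((\<Sum>s<CARD('n). cis (2 * pi * real s * (real l - real k) / real CARD('n))) * braket (b k) (X *v b l))"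
    by (simp add: scaleR_mv sum_mv braket_sum_right sum_distrib_right)
  also have "\<dots> = (if k = l then braket (b k) (X *v b k) else 0)"
    unfolding sum_cis_roots[OF kl] by (simp add: scaleR_conv_of_real)
  also have "\<dots> = braket (b k) (diag_part b X *v b l)"
    using kl by (simp add: diag_part_eq diag_op_basis braket_basis)
  finally show "braket (b k) (((1 / real CARD('n)) *\<^sub>R (\<Sum>s<CARD('n). dagger (phase_unitary b s) ** X ** phase_unitary b s)) *v b l)
      = braket (b k) (diag_part b X *v b l)" .
qed

lemma spectral_norm_diag_part: "spectral_norm (diag_part b X) \<le> spectral_norm X"
  unfolding diag_part_eq
proof (rule spectral_norm_diag_op_le)
  fix k assume "k < CARD('n)"
  then show "cmod (braket (b k) (X *v b k)) \<le> spectral_norm X"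
    using norm_braket_mv_le[of "b k" X "b k"] by (simp add: norm_basis)
qed

lemma diag_part_diff: "diag_part b (X - Y) = diag_part b X - diag_part b Y"
  by (simp add: diag_part_eq diag_op_diff matrix_vector_mult_diff_rdistrib braket_diff_right)

lemma diag_part_cscale: "diag_part b (cscale c X) = cscale c (diag_part b X)"
  by (simp add: diag_part_eq diag_op_cscale cscale_mv)

lemma diag_part_mat1: "diag_part b (mat 1) = mat 1"
  unfolding diag_part_eq by (subst diag_op_1[symmetric]) (rule diag_op_cong, simp add: braket_basis)

lemma diag_part_hermitian:
  assumes "hermitian H"
  shows "diag_part b H = diag_op (\<lambda>k. complex_of_real (Re (braket (b k) (H *v b k))))"
  unfolding diag_part_eq using hermitian_braket_real[OF assms]
  by (intro diag_op_cong) (simp add: complex_eq_iff)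

lemma hermitian_diag_part: "hermitian H \<Longrightarrow> hermitian (diag_part b H)"
  using hermitian_diag_op[of "\<lambda>k. Re (braket (b k) (H *v b k))"] by (simp add: diag_part_hermitian)

text \<open>Averaging the propagator is not the same as evolving under the averaged Hamiltonian, but
  the expansions agree to first order in \<open>\<tau>\<close>; each of the two remainders
  contributes half of the bound.\<close>

lemma diag_part_evol:
  assumes "hermitian H"
  shows "spectral_norm (diag_part b (evol H \<tau>) - evol (diag_part b H) \<tau>) \<le> (spectral_norm H * \<tau>)\<^sup>2"
proof -
  let ?E = "evol H \<tau> - (mat 1 - cscale (\<i> * complex_of_real \<tau>) H)"
  let ?F = "evol (diag_part b H) \<tau> - (mat 1 - cscale (\<i> * complex_of_real \<tau>) (diag_part b H))"
  have "diag_part b (evol H \<tau>) - evol (diag_part b H) \<tau> = diag_part b ?E - ?F"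
    by (simp add: diag_part_diff diag_part_cscale diag_part_mat1)
  then have "spectral_norm (diag_part b (evol H \<tau>) - evol (diag_part b H) \<tau>) \<le> spectral_norm (diag_part b ?E) + spectral_norm ?F"
    using spectral_norm_diff by metis
  also have "\<dots> \<le> spectral_norm ?E + (spectral_norm (diag_part b H) * \<tau>)\<^sup>2 / 2"
    by (intro add_mono spectral_norm_diag_part evol_second_order hermitian_diag_part assms)
  also have "\<dots> \<le> (spectral_norm H * \<tau>)\<^sup>2 / 2 + (spectral_norm H * \<tau>)\<^sup>2 / 2"
    using spectral_norm_diag_part[of H] spectral_norm_nonneg[of "diag_part b H"]
    by (intro add_mono evol_second_order assms)
      (simp add: power_mult_distrib mult_right_mono power_mono)
  finally show ?thesis by simp
qed

end

section \<open>Moments of traces of Hermitian matrices\<close>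

lemma bounded_bilinear_mmult: "bounded_bilinear ((**) :: 'n::finite cmat \<Rightarrow> 'n cmat \<Rightarrow> 'n cmat)"
  unfolding bilinear_conv_bounded_bilinear[symmetric] bilinear_def
  by (auto intro!: linearI simp: matrix_add_ldistrib mult_add_left mmult_scaleR_left mmult_scaleR_right)

lemma bounded_linear_Re_trace: "bounded_linear (\<lambda>X :: 'n::finite cmat. Re (trace X))"
  unfolding linear_conv_bounded_linear[symmetric]
  by (auto intro!: linearI simp: trace_add trace_scaleR)

lemma mpow_0 [simp]: "mpow A 0 = mat 1" by (simp add: mpow_def)
lemma mpow_Suc: "mpow A (Suc n) = A ** mpow A n" by (simp add: mpow_def)
lemma mpow_add: "mpow A (m + n) = mpow A m ** mpow A n"
  by (induction m) (simp_all add: mpow_Suc matrix_mul_assoc)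

lemma has_vector_derivative_mpow:
  fixes X Y :: "'n::finite cmat"
  shows "((\<lambda>\<tau>. mpow (X + \<tau> *\<^sub>R Y) n) has_vector_derivative
     (\<Sum>i<n. mpow (X + \<tau> *\<^sub>R Y) i ** Y ** mpow (X + \<tau> *\<^sub>R Y) (n - 1 - i))) (at \<tau>)"
proof (induction n)
  case 0 then show ?case by simp
next
  case (Suc n)
  let ?Z = "X + \<tau> *\<^sub>R Y"
  have 1: "((\<lambda>\<tau>. X + \<tau> *\<^sub>R Y) has_vector_derivative Y) (at \<tau>)"
    by (auto intro!: derivative_eq_intros)
  have eq: "?Z ** (\<Sum>i<n. mpow ?Z i ** Y ** mpow ?Z (n - 1 - i)) + Y ** mpow ?Z n
     = (\<Sum>i<Suc n. mpow ?Z i ** Y ** mpow ?Z (Suc n - 1 - i))"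
    unfolding sum.lessThan_Suc_shift
    by (simp add: mult_sum_right mpow_Suc matrix_mul_assoc add.commute)
  show ?case
    using bounded_bilinear.has_vector_derivative[OF bounded_bilinear_mmult 1 Suc.IH]
    unfolding mpow_Suc eq .
qed

text \<open>The product rule yields \<open>n\<close> different words; cyclicity of the trace
  identifies all of them, as for scalars.\<close>

lemma DERIV_Re_trace_mpow:
  fixes X Y :: "'n::finite cmat"
  shows "((\<lambda>\<tau>. Re (trace (mpow (X + \<tau> *\<^sub>R Y) n))) has_real_derivative
    real n * Re (trace (mpow (X + \<tau> *\<^sub>R Y) (n - 1) ** Y))) (at \<tau>)"
proof -
  let ?Z = "X + \<tau> *\<^sub>R Y"
  have "Re (trace (mpow ?Z i ** Y ** mpow ?Z (n - 1 - i))) = Re (trace (mpow ?Z (n - 1) ** Y))" if "i < n" for i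
  proof -
    have "trace (mpow ?Z i ** Y ** mpow ?Z (n - 1 - i)) = trace (mpow ?Z (n - 1 - i) ** mpow ?Z i ** Y)"
      by (rule trace_mult_cycle[symmetric])
    also have "mpow ?Z (n - 1 - i) ** mpow ?Z i = mpow ?Z (n - 1)"
      using that by (simp add: mpow_add[symmetric])
    finally show ?thesis by simp
  qed
  then have "Re (trace (\<Sum>i<n. mpow ?Z i ** Y ** mpow ?Z (n - 1 - i))) = real n * Re (trace (mpow ?Z (n - 1) ** Y))"
    by (simp add: trace_sum)
  then show ?thesis
    using bounded_linear.has_vector_derivative[OF bounded_linear_Re_trace has_vector_derivative_mpow[of X Y n \<tau>]]
    by (simp add: has_real_derivative_iff_has_vector_derivative)
qed

text \<open>With a second factor \<open>Y\<close> present, cyclicity no longer merges the words;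
  their sum is what \<open>mixed_trace_le\<close> estimates.\<close>

lemma DERIV_Re_trace_mpow_mult:
  fixes X Y :: "'n::finite cmat"
  shows "((\<lambda>\<tau>. Re (trace (mpow (X + \<tau> *\<^sub>R Y) n ** Y))) has_real_derivative
    (\<Sum>i<n. Re (trace (mpow (X + \<tau> *\<^sub>R Y) i ** Y ** mpow (X + \<tau> *\<^sub>R Y) (n - 1 - i) ** Y)))) (at \<tau>)"
  using bounded_linear.has_vector_derivative[OF bounded_linear_Re_trace
      bounded_linear.has_vector_derivative[OF
        bounded_bilinear.bounded_linear_left[OF bounded_bilinear_mmult, of Y] has_vector_derivative_mpow[of X Y n \<tau>]]]
  by (simp add: has_real_derivative_iff_has_vector_derivative mult_sum_left trace_sum)

text \<open>The terms \<open>i\<close> and \<open>m - i\<close> are paired. Differences of equal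
  powers of two nonnegative numbers have the same sign for all exponents, so a mixed pair is at most
  the pure pair.\<close>

lemma sum_mixed_powers_le:
  fixes x y :: real
  assumes "0 \<le> x" "0 \<le> y"
  shows "(\<Sum>i<Suc m. x ^ i * y ^ (m - i)) \<le> real (Suc m) * (x ^ m + y ^ m) / 2"
proof -
  have pair: "x ^ i * y ^ (m - i) + x ^ (m - i) * y ^ i \<le> x ^ m + y ^ m" if "i \<le> m" for i
  proof -
    have "0 \<le> (x ^ i - y ^ i) * (x ^ (m - i) - y ^ (m - i))"
      using assms power_mono[of x y] power_mono[of y x]
      by (cases "x \<le> y") (auto intro!: mult_nonneg_nonneg mult_nonpos_nonpos)
    moreover have "x ^ m = x ^ i * x ^ (m - i)" "y ^ m = y ^ i * y ^ (m - i)"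
      using that by (simp_all add: power_add[symmetric])
    ultimately show ?thesis by (simp add: algebra_simps)
  qed
  have rev: "(\<Sum>i<Suc m. x ^ (m - i) * y ^ i) = (\<Sum>i<Suc m. x ^ i * y ^ (m - i))"
    by (rule sum.reindex_bij_witness[of _ "\<lambda>i. m - i" "\<lambda>i. m - i"]) auto
  have "2 * (\<Sum>i<Suc m. x ^ i * y ^ (m - i)) = (\<Sum>i<Suc m. x ^ i * y ^ (m - i) + x ^ (m - i) * y ^ i)"
    unfolding sum.distrib rev by simp
  also have "\<dots> \<le> (\<Sum>i<Suc m. x ^ m + y ^ m)" by (intro sum_mono pair) auto
  finally show ?thesis by simp
qed

text \<open>
  In an eigenbasis of \<open>Z\<close> the trace is \<open>\<Sum>\<^sub>k\<^sub>l |Y\<^sub>k\<^sub>l|\<^sup>2 \<Sum>\<^sub>i z\<^sub>k\<^sup>i z\<^sub>l\<^sup>m\<^sup>-\<^sup>i\<close>.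
\<close>

lemma mixed_trace_le:
  fixes Z Y :: "'n::finite cmat"
  assumes Z: "hermitian Z" and Y: "hermitian Y" "spectral_norm Y \<le> u" and m: "even m"
  shows "(\<Sum>i<Suc m. Re (trace (mpow Z i ** Y ** mpow Z (m - i) ** Y))) \<le> real (Suc m) * u\<^sup>2 * Re (trace (mpow Z m))"
proof -
  obtain b z where d: "diagonalizes b z Z" using spectral_theorem Z by metis
  interpret onb b using diagonalizes_onb d .
  have Zd: "Z = diag_op (\<lambda>k. complex_of_real (z k))" using d by (simp add: diagonalizes_iff)
  define y where "y k l = (cmod (braket (b l) (Y *v b k)))\<^sup>2" for k l
  have y0: "0 \<le> y k l" for k l by (simp add: y_def)
  have ysym: "y k l = y l k" for k l
  proof -
    have "braket (b l) (Y *v b k) = cnj (braket (b k) (Y *v b l))"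
      using Y(1) by (simp add: cnj_braket braket_mv_left hermitian_def)
    then show ?thesis by (simp add: y_def)
  qed
  have u: "0 \<le> u" using Y(2) spectral_norm_nonneg order_trans by blast
  have yrow: "(\<Sum>l<CARD('n). y k l) \<le> u\<^sup>2" if "k < CARD('n)" for k
  proof -
    have "(\<Sum>l<CARD('n). y k l) = (norm (Y *v b k))\<^sup>2" by (simp add: y_def norm_parseval)
    also have "norm (Y *v b k) \<le> u" using norm_mv_le[of Y "b k"] Y(2) that by (simp add: norm_basis)
    then have "(norm (Y *v b k))\<^sup>2 \<le> u\<^sup>2" by (intro power_mono) auto
    finally show ?thesis .
  qed
  have tr: "Re (trace (mpow Z i ** Y ** mpow Z j ** Y)) = (\<Sum>k<CARD('n). \<Sum>l<CARD('n). z k ^ i * z l ^ j * y k l)" for i j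
  proof -
    have "braket (b k) (Y *v (mpow Z j *v (Y *v b k))) = (\<Sum>l<CARD('n). complex_of_real (z l ^ j * y k l))" for k
    proof -
      have "braket (b k) (Y *v (mpow Z j *v (Y *v b k))) = braket (Y *v b k) (mpow Z j *v (Y *v b k))"
        using Y(1) by (simp add: braket_mv_left hermitian_def)
      also have "\<dots> = (\<Sum>l<CARD('n). complex_of_real (z l ^ j) * (cnj (braket (b l) (Y *v b k)) * braket (b l) (Y *v b k)))"
        unfolding parseval[of "Y *v b k"] Zd mpow_diag_op
        by (rule sum.cong) (auto simp: braket_diag_op mult_ac)
      also have "\<dots> = (\<Sum>l<CARD('n). complex_of_real (z l ^ j * y k l))"
        by (simp only: y_def of_real_mult complex_norm_square) (simp add: mult_ac)
      finally show ?thesis .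
    qed
    then have "Re (trace (mpow Z i ** (Y ** mpow Z j ** Y))) = (\<Sum>k<CARD('n). z k ^ i * (\<Sum>l<CARD('n). z l ^ j * y k l))"
      by (subst Zd)
        (simp add: mpow_diag_op trace_diag_op_mult matrix_vector_mul_assoc[symmetric] matrix_mul_assoc[symmetric]
          flip: of_real_power of_real_mult of_real_sum)
    then show ?thesis by (simp add: matrix_mul_assoc sum_distrib_left mult.assoc)
  qed
  have "(\<Sum>i<Suc m. Re (trace (mpow Z i ** Y ** mpow Z (m - i) ** Y)))
      = (\<Sum>k<CARD('n). \<Sum>l<CARD('n). (\<Sum>i<Suc m. z k ^ i * z l ^ (m - i)) * y k l)"
    unfolding tr sum_distrib_right by (subst sum.swap, intro sum.cong refl sum.swap)
  also have "\<dots> \<le> (\<Sum>k<CARD('n). \<Sum>l<CARD('n). (real (Suc m) * (z k ^ m + z l ^ m) / 2) * y k l)"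
  proof (intro sum_mono mult_right_mono y0)
    fix k l
    have "(\<Sum>i<Suc m. z k ^ i * z l ^ (m - i)) \<le> (\<Sum>i<Suc m. \<bar>z k\<bar> ^ i * \<bar>z l\<bar> ^ (m - i))"
      by (intro sum_mono) (metis abs_ge_self abs_mult power_abs)
    also have "\<dots> \<le> real (Suc m) * (\<bar>z k\<bar> ^ m + \<bar>z l\<bar> ^ m) / 2"
      by (rule sum_mixed_powers_le) auto
    finally show "(\<Sum>i<Suc m. z k ^ i * z l ^ (m - i)) \<le> real (Suc m) * (z k ^ m + z l ^ m) / 2"
      using m by (simp add: power_even_abs)
  qed
  also have "\<dots> = real (Suc m) / 2 * ((\<Sum>k<CARD('n). \<Sum>l<CARD('n). z k ^ m * y k l) + (\<Sum>k<CARD('n). \<Sum>l<CARD('n). z l ^ m * y k l))"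
    unfolding sum.distrib[symmetric] sum_distrib_left
    by (intro sum.cong refl) (simp del: of_nat_Suc add: field_simps)
  \<comment> \<open>The squared moduli \<open>y\<close> are symmetric in their indices, so both
    halves coincide and only the row sums of \<open>y\<close>, at most \<open>u\<^sup>2\<close>,
    remain.\<close>
  also have "(\<Sum>k<CARD('n). \<Sum>l<CARD('n). z l ^ m * y k l) = (\<Sum>k<CARD('n). \<Sum>l<CARD('n). z k ^ m * y k l)"
    by (subst sum.swap, subst ysym) (rule refl)
  also have "real (Suc m) / 2 * ((\<Sum>k<CARD('n). \<Sum>l<CARD('n). z k ^ m * y k l) + (\<Sum>k<CARD('n). \<Sum>l<CARD('n). z k ^ m * y k l))
      = real (Suc m) * (\<Sum>k<CARD('n). z k ^ m * (\<Sum>l<CARD('n). y k l))"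
    by (simp add: sum_distrib_left)
  also have "\<dots> \<le> real (Suc m) * (\<Sum>k<CARD('n). z k ^ m * u\<^sup>2)"
    using m by (intro mult_left_mono sum_mono yrow) (auto simp: zero_le_even_power)
  also have "(\<Sum>k<CARD('n). z k ^ m * u\<^sup>2) = u\<^sup>2 * Re (trace (mpow Z m))"
    by (simp add: Zd mpow_diag_op trace_diag_op sum_distrib_left mult.commute flip: of_real_power)
  finally show ?thesis by simp
qed

lemma nonneg_of_second_derivative:
  fixes f :: "real \<Rightarrow> real"
  assumes f: "\<And>x. (f has_real_derivative f' x) (at x)" and f': "\<And>x. (f' has_real_derivative f'' x) (at x)"
    and 0: "f 0 = 0" "f' 0 = 0" and nn: "\<And>x. 0 \<le> x \<Longrightarrow> 0 \<le> f'' x" and x: "0 \<le> x"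
  shows "0 \<le> f x"
proof -
  have "0 \<le> f' x" if "0 \<le> x" for x
    using DERIV_nonneg_imp_nondecreasing[of 0 x f'] f' nn that 0 by (metis)
  then show ?thesis using DERIV_nonneg_imp_nondecreasing[of 0 x f] f x 0 by metis
qed

text \<open>
  Comparison with a random sign: a centred Hermitian increment of norm at most \<open>u\<close> raises the even
  trace moments by no more than the scalar increment \<open>\<plusminus>u\<close>. Both sides, as functions of the scaling \<open>\<tau>\<close>
  of the increment, agree to first order at \<open>0\<close>, and their second derivatives compare by induction.
\<close>

lemma centred_increment_moments:
  fixes X :: "'n::finite cmat"
  assumes X: "hermitian X" and Y: "\<And>s. s \<in> S \<Longrightarrow> hermitian (Y s)" "\<And>s. s \<in> S \<Longrightarrow> spectral_norm (Y s) \<le> u"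
    and centred: "(\<Sum>s\<in>S. Y s) = 0" and "0 \<le> \<tau>"
  shows "(\<Sum>s\<in>S. Re (trace (mpow (X + \<tau> *\<^sub>R Y s) (2 * q)))) / fact (2 * q) \<le>
    real (card S) * (\<Sum>i\<le>q. (\<tau> * u) ^ (2 * i) / fact (2 * i) * (Re (trace (mpow X (2 * (q - i)))) / fact (2 * (q - i))))"
  using \<open>0 \<le> \<tau>\<close>
proof (induction q arbitrary: \<tau>)
  case 0 then show ?case by simp
next
  case (Suc q)
  \<comment> \<open>\<open>f\<close> and \<open>h\<close> are the two sides as functions of the
    scale, and the suffix counts derivatives. Owing to the factorials, two differentiations lower
    the order from \<open>Suc q\<close> to \<open>q\<close> with no coefficient left except
    \<open>u\<^sup>2\<close>.\<close>
  define T where "T j = Re (trace (mpow X (2 * j))) / fact (2 * j)" for j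
  define f where "f \<tau> = (\<Sum>s\<in>S. Re (trace (mpow (X + \<tau> *\<^sub>R Y s) (2 * Suc q)))) / fact (2 * Suc q)" for \<tau>
  define f1 where "f1 \<tau> = (\<Sum>s\<in>S. Re (trace (mpow (X + \<tau> *\<^sub>R Y s) (Suc (2 * q)) ** Y s))) / fact (Suc (2 * q))" for \<tau>
  define f2 where "f2 \<tau> = (\<Sum>s\<in>S. \<Sum>i<Suc (2 * q). Re (trace (mpow (X + \<tau> *\<^sub>R Y s) i ** Y s ** mpow (X + \<tau> *\<^sub>R Y s) (2 * q - i) ** Y s))) / fact (Suc (2 * q))" for \<tau>
  define h where "h \<tau> = real (card S) * (T (Suc q) + (\<Sum>i\<le>q. (\<tau> * u) ^ (2 * i + 2) / fact (2 * i + 2) * T (q - i)))" for \<tau>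
  define h1 where "h1 \<tau> = real (card S) * (\<Sum>i\<le>q. u * ((\<tau> * u) ^ (2 * i + 1) / fact (2 * i + 1)) * T (q - i))" for \<tau>
  define h2 where "h2 \<tau> = real (card S) * (\<Sum>i\<le>q. u\<^sup>2 * ((\<tau> * u) ^ (2 * i) / fact (2 * i)) * T (q - i))" for \<tau>
  have f: "(f has_real_derivative f1 x) (at x)" for x
  proof -
    have "(f has_real_derivative (\<Sum>s\<in>S. real (2 * Suc q) * Re (trace (mpow (X + x *\<^sub>R Y s) (2 * Suc q - 1) ** Y s))) / fact (2 * Suc q)) (at x)"
      unfolding f_def by (intro DERIV_cdivide DERIV_sum DERIV_Re_trace_mpow)
    moreover have "(\<Sum>s\<in>S. real (2 * Suc q) * Re (trace (mpow (X + x *\<^sub>R Y s) (2 * Suc q - 1) ** Y s))) / fact (2 * Suc q) = f1 x"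
    proof -
      have "fact (2 * Suc q) = real (2 * Suc q) * fact (Suc (2 * q))"
        by (metis fact_Suc mult_Suc_right add_2_eq_Suc)
      then show ?thesis unfolding f1_def sum_distrib_left[symmetric] by simp
    qed
    ultimately show ?thesis by simp
  qed
  have f1: "(f1 has_real_derivative f2 x) (at x)" for x
    unfolding f1_def f2_def
    using DERIV_Re_trace_mpow_mult[of X _ "Suc (2 * q)" x]
    by (intro DERIV_cdivide DERIV_sum) simp
  have pw: "((\<lambda>x. (x * u) ^ Suc n / fact (Suc n)) has_real_derivative u * ((x * u) ^ n / fact n)) (at x)" for x n
  proof -
    have "((\<lambda>x. (x * u) ^ Suc n / fact (Suc n)) has_real_derivative
        (1 + real n) * (u * (x * u) ^ n) / fact (Suc n)) (at x)"
      by (intro DERIV_cdivide DERIV_power_Suc) (auto intro!: derivative_eq_intros)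
    moreover have "(1 + real n) * (u * (x * u) ^ n) / fact (Suc n) = u * ((x * u) ^ n / fact n)"
      unfolding fact_Suc of_nat_Suc by (subst mult_divide_mult_cancel_left) auto
    ultimately show ?thesis by simp
  qed
  have h: "(h has_real_derivative h1 x) (at x)" for x
  proof -
    have "(h has_real_derivative real (card S) * (0 + (\<Sum>i\<le>q. u * ((x * u) ^ (2 * i + 1) / fact (2 * i + 1)) * T (q - i)))) (at x)"
      unfolding h_def using pw[of "2 * _ + 1"]
      by (intro DERIV_cmult DERIV_add DERIV_const DERIV_sum DERIV_cmult_right) simp
    then show ?thesis by (simp add: h1_def)
  qed
  have h1: "(h1 has_real_derivative h2 x) (at x)" for x
  proof -
    have "(h1 has_real_derivative real (card S) * (\<Sum>i\<le>q. u * (u * ((x * u) ^ (2 * i) / fact (2 * i))) * T (q - i))) (at x)"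
      unfolding h1_def using pw[of "2 * _"]
      by (intro DERIV_cmult DERIV_sum DERIV_cmult_right) simp
    then show ?thesis by (simp add: h2_def power2_eq_square mult.assoc)
  qed
  have "0 \<le> h \<tau> - f \<tau>"
  proof (rule nonneg_of_second_derivative[where f = "\<lambda>x. h x - f x" and f' = "\<lambda>x. h1 x - f1 x"
        and f'' = "\<lambda>x. h2 x - f2 x"])
    show "((\<lambda>x. h x - f x) has_real_derivative h1 x - f1 x) (at x)" for x by (intro DERIV_diff h f)
    show "((\<lambda>x. h1 x - f1 x) has_real_derivative h2 x - f2 x) (at x)" for x by (intro DERIV_diff h1 f1)
    show "h 0 - f 0 = 0" by (simp add: h_def f_def T_def)
    have "(\<Sum>s\<in>S. Re (trace (mpow X (Suc (2 * q)) ** Y s))) = Re (trace (mpow X (Suc (2 * q)) ** (\<Sum>s\<in>S. Y s)))"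
      by (simp add: mult_sum_right trace_sum)
    then show "h1 0 - f1 0 = 0" by (simp add: h1_def f1_def centred)
    show "0 \<le> h2 x - f2 x" if x: "0 \<le> x" for x
    proof -
      have "f2 x \<le> (\<Sum>s\<in>S. real (Suc (2 * q)) * u\<^sup>2 * Re (trace (mpow (X + x *\<^sub>R Y s) (2 * q)))) / fact (Suc (2 * q))"
        unfolding f2_def
        by (intro divide_right_mono sum_mono mixed_trace_le hermitian_add hermitian_scaleR X Y) auto
      also have "\<dots> = u\<^sup>2 * ((\<Sum>s\<in>S. Re (trace (mpow (X + x *\<^sub>R Y s) (2 * q)))) / fact (2 * q))"
        unfolding sum_distrib_left[symmetric] by (simp del: of_nat_Suc)
      also have "\<dots> \<le> u\<^sup>2 * (real (card S) * (\<Sum>i\<le>q. (x * u) ^ (2 * i) / fact (2 * i) * T (q - i)))"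
        unfolding T_def by (intro mult_left_mono Suc.IH x) auto
      also have "\<dots> = h2 x" by (simp add: h2_def sum_distrib_left mult_ac)
      finally show ?thesis by simp
    qed
  qed (rule Suc.prems)
  moreover have "h \<tau> = real (card S) * (\<Sum>i\<le>Suc q. (\<tau> * u) ^ (2 * i) / fact (2 * i) * T (Suc q - i))"
    unfolding sum.atMost_Suc_shift h_def by simp
  ultimately show ?case by (simp add: f_def T_def)
qed

section \<open>Concentration of matrix martingales\<close>

lemma finite_set_replicate_pmf: "finite (set_pmf p) \<Longrightarrow> finite (set_pmf (replicate_pmf n p))"
  using finite_lists_length_eq[of "set_pmf p" n] by (simp add: set_replicate_pmf lists_eq_set)

text \<open>Lists grow at the head: the tail is the past and the head the newest draw. Averaging
  over the head first is the conditioning step for a martingale indexed by lists.\<close>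

lemma expectation_replicate_pmf_Suc:
  fixes f :: "'s list \<Rightarrow> real"
  assumes S: "finite S" "S \<noteq> {}"
  shows "measure_pmf.expectation (replicate_pmf (Suc n) (pmf_of_set S)) f =
    measure_pmf.expectation (replicate_pmf n (pmf_of_set S)) (\<lambda>ss. (\<Sum>s\<in>S. f (s # ss)) / real (card S))"
proof -
  let ?R = "replicate_pmf n (pmf_of_set S)"
  have fin: "finite (set_pmf ?R)" by (rule finite_set_replicate_pmf) (use S in simp)
  have eq: "replicate_pmf (Suc n) (pmf_of_set S) = pmf_of_set S \<bind> (\<lambda>x. map_pmf ((#) x) ?R)"
    by (simp add: map_pmf_def)
  have "measure_pmf.expectation (replicate_pmf (Suc n) (pmf_of_set S)) f =
      (\<Sum>s\<in>S. measure_pmf.expectation (map_pmf ((#) s) ?R) f /\<^sub>R real (card S))"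
    unfolding eq by (rule pmf_expectation_bind_pmf_of_set) (use S fin in auto)
  also have "\<dots> = (\<Sum>s\<in>S. measure_pmf.expectation ?R (\<lambda>ss. f (s # ss))) / real (card S)"
    by (simp add: divide_inverse sum_distrib_left[symmetric] mult.commute)
  also have "(\<Sum>s\<in>S. measure_pmf.expectation ?R (\<lambda>ss. f (s # ss))) =
      measure_pmf.expectation ?R (\<lambda>ss. \<Sum>s\<in>S. f (s # ss))"
    by (rule Bochner_Integration.integral_sum[symmetric]) (rule integrable_measure_pmf_finite[OF fin])
  finally show ?thesis by simp
qed

text \<open>Coefficientwise form of \<open>cosh x \<le> exp (x\<^sup>2 / 2)\<close>, by which the
  moments of a random sign are replaced by Gaussian bounds.\<close>

lemma power2_mult_fact_le: "(2::real) ^ i * fact i \<le> fact (2 * i)"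
proof (induction i)
  case (Suc i)
  have "(2::real) ^ Suc i * fact (Suc i) = (2 * real (Suc i)) * (2 ^ i * fact i)" by simp
  also have "\<dots> \<le> (2 * real (Suc i)) * fact (2 * i)" by (intro mult_left_mono Suc.IH) auto
  also have "\<dots> \<le> (real (2 * i + 2) * real (2 * i + 1)) * fact (2 * i)"
    by (intro mult_right_mono) (auto simp: algebra_simps)
  also have "\<dots> = fact (2 * Suc i)" by (simp add: mult.assoc)
  finally show ?case .
qed simp

lemma fact_add_le: "(fact (m + j) :: real) \<le> real (m + j) ^ j * fact m"
proof (induction j)
  case (Suc j)
  have "(fact (m + Suc j) :: real) = real (m + Suc j) * fact (m + j)" by simp
  also have "\<dots> \<le> real (m + Suc j) * (real (m + j) ^ j * fact m)" by (intro mult_left_mono Suc.IH) auto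
  also have "\<dots> \<le> real (m + Suc j) * (real (m + Suc j) ^ j * fact m)"
    by (intro mult_left_mono mult_right_mono power_mono) auto
  finally show ?case by (simp add: mult.assoc)
qed simp

lemma binomial_normalized:
  fixes x y :: real
  shows "(\<Sum>i\<le>q. x ^ i / fact i * (y ^ (q - i) / fact (q - i))) = (x + y) ^ q / fact q"
proof -
  have "(x + y) ^ q / fact q = (\<Sum>i\<le>q. real (q choose i) * x ^ i * y ^ (q - i) / fact q)"
    by (simp add: binomial_ring sum_divide_distrib)
  also have "\<dots> = (\<Sum>i\<le>q. x ^ i / fact i * (y ^ (q - i) / fact (q - i)))"
    by (rule sum.cong) (auto simp: binomial_fact)
  finally show ?thesis by simp
qed

text \<open>Each draw convolves the normalized moments with
  \<open>(u\<^sup>2 / 2) ^ i / fact i\<close>, and by the binomial formula the variance proxy grows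
  by \<open>u\<^sup>2 / 2\<close> per draw. The factor \<open>CARD('n)\<close> is the trace of the
  identity, the only nonzero moment of the empty sum.\<close>

lemma martingale_moments:
  fixes G :: "'s list \<Rightarrow> 'n::finite cmat"
  assumes S: "finite S" "S \<noteq> {}"
    and G: "G [] = 0" "\<And>s ss. G (s # ss) = G ss + Y ss s"
    and Y: "\<And>ss s. hermitian (Y ss s)" "\<And>ss s. spectral_norm (Y ss s) \<le> u"
    and centred: "\<And>ss. (\<Sum>s\<in>S. Y ss s) = 0"
  shows "measure_pmf.expectation (replicate_pmf n (pmf_of_set S)) (\<lambda>ss. Re (trace (mpow (G ss) (2 * q))) / fact (2 * q))
    \<le> real CARD('n) * ((real n * u\<^sup>2 / 2) ^ q / fact q)"
proof (induction n arbitrary: q)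
  case 0
  show ?case
  proof (cases q)
    case 0 then show ?thesis by (simp add: trace_I)
  next
    case (Suc p) then show ?thesis by (simp add: G mpow_Suc)
  qed
next
  case (Suc n)
  let ?R = "replicate_pmf n (pmf_of_set S)"
  let ?f = "\<lambda>q ss. Re (trace (mpow (G ss) (2 * q))) / fact (2 * q)"
  have fin: "finite (set_pmf ?R)" by (rule finite_set_replicate_pmf) (use S in simp)
  have hG: "hermitian (G ss)" for ss
    by (induction ss) (simp_all add: G hermitian_add Y)
  have card: "real (card S) > 0" using S by (simp add: card_gt_0_iff)
  have step: "(\<Sum>s\<in>S. ?f q (s # ss)) / real (card S) \<le> (\<Sum>i\<le>q. u ^ (2 * i) / fact (2 * i) * ?f (q - i) ss)" for ss
  proof -
    have "(\<Sum>s\<in>S. Re (trace (mpow (G ss + 1 *\<^sub>R Y ss s) (2 * q)))) / fact (2 * q) \<le>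
      real (card S) * (\<Sum>i\<le>q. (1 * u) ^ (2 * i) / fact (2 * i) * ?f (q - i) ss)"
      by (rule centred_increment_moments) (auto simp: hG Y centred)
    then show ?thesis
      unfolding pos_divide_le_eq[OF card] by (simp add: G sum_divide_distrib mult.commute)
  qed
  have "measure_pmf.expectation (replicate_pmf (Suc n) (pmf_of_set S)) (?f q) =
      measure_pmf.expectation ?R (\<lambda>ss. (\<Sum>s\<in>S. ?f q (s # ss)) / real (card S))"
    by (rule expectation_replicate_pmf_Suc[OF S])
  also have "\<dots> \<le> measure_pmf.expectation ?R (\<lambda>ss. \<Sum>i\<le>q. u ^ (2 * i) / fact (2 * i) * ?f (q - i) ss)"
    by (intro integral_mono integrable_measure_pmf_finite fin step)
  also have "\<dots> = (\<Sum>i\<le>q. measure_pmf.expectation ?R (\<lambda>ss. u ^ (2 * i) / fact (2 * i) * ?f (q - i) ss))"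
    by (rule Bochner_Integration.integral_sum) (rule integrable_measure_pmf_finite[OF fin])
  also have "\<dots> = (\<Sum>i\<le>q. u ^ (2 * i) / fact (2 * i) * measure_pmf.expectation ?R (?f (q - i)))"
    by (simp only: integral_mult_right_zero)
  also have "\<dots> \<le> (\<Sum>i\<le>q. (u\<^sup>2 / 2) ^ i / fact i * (real CARD('n) * ((real n * u\<^sup>2 / 2) ^ (q - i) / fact (q - i))))"
  proof (rule sum_mono)
    fix i assume "i \<in> {..q}"
    have p: "u ^ (2 * i) = (u\<^sup>2) ^ i" by (simp add: power_mult)
    have "u ^ (2 * i) / fact (2 * i) \<le> (u\<^sup>2) ^ i / (2 ^ i * fact i)"
      unfolding p by (intro divide_left_mono power2_mult_fact_le) auto
    then have c: "u ^ (2 * i) / fact (2 * i) \<le> (u\<^sup>2 / 2) ^ i / fact i" by (simp add: power_divide)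
    have "u ^ (2 * i) / fact (2 * i) * measure_pmf.expectation ?R (?f (q - i)) \<le>
        u ^ (2 * i) / fact (2 * i) * (real CARD('n) * ((real n * u\<^sup>2 / 2) ^ (q - i) / fact (q - i)))"
      by (intro mult_left_mono Suc.IH) (simp add: p)
    also have "\<dots> \<le> (u\<^sup>2 / 2) ^ i / fact i * (real CARD('n) * ((real n * u\<^sup>2 / 2) ^ (q - i) / fact (q - i)))"
      by (intro mult_right_mono c) simp
    finally show "u ^ (2 * i) / fact (2 * i) * measure_pmf.expectation ?R (?f (q - i)) \<le>
      (u\<^sup>2 / 2) ^ i / fact i * (real CARD('n) * ((real n * u\<^sup>2 / 2) ^ (q - i) / fact (q - i)))" .
  qed
  also have "\<dots> = real CARD('n) * (\<Sum>i\<le>q. (u\<^sup>2 / 2) ^ i / fact i * ((real n * u\<^sup>2 / 2) ^ (q - i) / fact (q - i)))"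
    by (simp add: sum_distrib_left mult_ac)
  also have "\<dots> = real CARD('n) * ((real (Suc n) * u\<^sup>2 / 2) ^ q / fact q)"
  proof -
    have "u\<^sup>2 / 2 + real n * u\<^sup>2 / 2 = real (Suc n) * u\<^sup>2 / 2" by (simp add: field_simps)
    then show ?thesis by (simp only: binomial_normalized)
  qed
  finally show ?case .
qed

lemma spectral_norm_power_le_trace:
  fixes G :: "'n::finite cmat"
  assumes "hermitian G" shows "spectral_norm G ^ (2 * q) \<le> Re (trace (mpow G (2 * q)))"
proof -
  obtain b a where d: "diagonalizes b a G" using spectral_theorem assms by metis
  interpret onb b using diagonalizes_onb d .
  have Gd: "G = diag_op (\<lambda>k. complex_of_real (a k))" using d by (simp add: diagonalizes_iff)
  let ?R = "(\<lambda>k. \<bar>a k\<bar>) ` {..<CARD('n)}"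
  have fin: "finite ?R" "?R \<noteq> {}" by (auto simp: lessThan_empty_iff)
  obtain k where k: "k < CARD('n)" "\<bar>a k\<bar> = Max ?R" using Max_in[OF fin] by auto
  have "spectral_norm G \<le> \<bar>a k\<bar>"
    unfolding Gd k(2) by (rule spectral_norm_diag_op_le) (use fin in auto)
  then have "spectral_norm G ^ (2 * q) \<le> \<bar>a k\<bar> ^ (2 * q)"
    by (intro power_mono spectral_norm_nonneg)
  also have "\<dots> = a k ^ (2 * q)" by (simp add: power_even_abs)
  also have "\<dots> \<le> (\<Sum>k<CARD('n). a k ^ (2 * q))"
    using k(1) by (intro member_le_sum) auto
  also have "\<dots> = Re (trace (mpow G (2 * q)))"
    by (simp add: Gd mpow_diag_op trace_diag_op flip: of_real_power)
  finally show ?thesis .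
qed

text \<open>Markov's inequality for the moment of order \<open>2 * q\<close>, with the quotient of
  factorials bounded by \<open>(2 * real q) ^ q\<close>. The order stays free so that it can later
  be taken proportional to the logarithm of the dimension.\<close>

lemma martingale_tail:
  fixes G :: "'s list \<Rightarrow> 'n::finite cmat"
  assumes S: "finite S" "S \<noteq> {}"
    and G: "G [] = 0" "\<And>s ss. G (s # ss) = G ss + Y ss s"
    and Y: "\<And>ss s. hermitian (Y ss s)" "\<And>ss s. spectral_norm (Y ss s) \<le> u"
    and centred: "\<And>ss. (\<Sum>s\<in>S. Y ss s) = 0"
    and r: "r > 0"
  shows "measure_pmf.prob (replicate_pmf n (pmf_of_set S)) {ss. r < spectral_norm (G ss)}
    \<le> real CARD('n) * (real q * real n * u\<^sup>2 / r\<^sup>2) ^ q"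
proof -
  let ?R = "replicate_pmf n (pmf_of_set S)"
  let ?f = "\<lambda>ss. Re (trace (mpow (G ss) (2 * q))) / fact (2 * q)"
  let ?c = "(fact (2 * q) :: real) / r ^ (2 * q)"
  have fin: "finite (set_pmf ?R)" by (rule finite_set_replicate_pmf) (use S in simp)
  have hG: "hermitian (G ss)" for ss
    by (induction ss) (simp_all add: G hermitian_add Y)
  have ind: "indicat_real {ss. r < spectral_norm (G ss)} ss \<le> ?c * ?f ss" for ss
  proof -
    have tr: "spectral_norm (G ss) ^ (2 * q) \<le> Re (trace (mpow (G ss) (2 * q)))"
      by (rule spectral_norm_power_le_trace[OF hG])
    have eq: "?c * ?f ss = Re (trace (mpow (G ss) (2 * q))) / r ^ (2 * q)" by simp
    show ?thesis
    proof (cases "r < spectral_norm (G ss)")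
      case True
      then have "r ^ (2 * q) \<le> spectral_norm (G ss) ^ (2 * q)" using r by (intro power_mono) auto
      then have "r ^ (2 * q) \<le> Re (trace (mpow (G ss) (2 * q)))" using tr by simp
      then show ?thesis unfolding eq using True r by simp
    next
      case False
      have "0 \<le> Re (trace (mpow (G ss) (2 * q)))"
        using tr zero_le_power[OF spectral_norm_nonneg[of "G ss"], of "2 * q"] by linarith
      then show ?thesis unfolding eq using False r by simp
    qed
  qed
  have "(fact (2 * q) :: real) \<le> real (2 * q) ^ q * fact q"
    using fact_add_le[of q q] by (simp only: mult_2[symmetric])
  then have quot: "(fact (2 * q) :: real) / fact q \<le> (2 * real q) ^ q" by (simp add: divide_le_eq)
  have "measure_pmf.prob ?R {ss. r < spectral_norm (G ss)} =
      measure_pmf.expectation ?R (indicat_real {ss. r < spectral_norm (G ss)})" by simp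
  also have "\<dots> \<le> measure_pmf.expectation ?R (\<lambda>ss. ?c * ?f ss)"
    by (intro integral_mono integrable_measure_pmf_finite fin ind)
  also have "\<dots> = ?c * measure_pmf.expectation ?R ?f" by (simp only: integral_mult_right_zero)
  also have "\<dots> \<le> ?c * (real CARD('n) * ((real n * u\<^sup>2 / 2) ^ q / fact q))"
    using r by (intro mult_left_mono martingale_moments[where Y = Y] S G Y centred) auto
  also have "\<dots> = real CARD('n) * (fact (2 * q) / fact q * ((real n * u\<^sup>2 / 2) ^ q / (r\<^sup>2) ^ q))"
    unfolding power_mult[of r 2 q] by (simp add: mult_ac)
  also have "\<dots> \<le> real CARD('n) * ((2 * real q) ^ q * ((real n * u\<^sup>2 / 2) ^ q / (r\<^sup>2) ^ q))"
    by (intro mult_left_mono mult_right_mono quot) auto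
  also have "\<dots> = real CARD('n) * (real q * real n * u\<^sup>2 / r\<^sup>2) ^ q"
  proof -
    have "2 * real q * (real n * u\<^sup>2 / 2) / r\<^sup>2 = real q * real n * u\<^sup>2 / r\<^sup>2" by simp
    then show ?thesis unfolding power_divide[symmetric] power_mult_distrib[symmetric]
      by (simp only: times_divide_eq_right)
  qed
  finally show ?thesis .
qed

section \<open>Reshaping by randomized evolution\<close>

text \<open>The increments of the rotated product stand between unrelated unitaries and are not
  Hermitian, as the moment bounds require. Both parts are Hermitian, the second because of the
  factor \<open>- \<i> / 2\<close>, and neither exceeds the whole in spectral norm.\<close>

definition herm_part :: "'n cmat \<Rightarrow> 'n::finite cmat" where
  "herm_part Z = (1 / 2) *\<^sub>R (Z + dagger Z)"
definition skew_part :: "'n cmat \<Rightarrow> 'n::finite cmat" where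
  "skew_part Z = cscale (- \<i> / 2) (Z - dagger Z)"

lemma herm_skew: "Z = herm_part Z + cscale \<i> (skew_part Z)"
  by (simp add: herm_part_def skew_part_def scaleR_cscale cscale_cscale)
    (simp add: vec_eq_iff mat_nth field_simps)

lemma hermitian_herm_part: "hermitian (herm_part Z)"
  by (simp add: hermitian_def herm_part_def dagger_scaleR dagger_add add.commute)

lemma hermitian_skew_part: "hermitian (skew_part Z)"
  by (simp add: hermitian_def skew_part_def vec_eq_iff mat_nth algebra_simps)

lemma spectral_norm_herm_part: "spectral_norm (herm_part Z) \<le> spectral_norm Z"
proof -
  have "spectral_norm (herm_part Z) \<le> 1 / 2 * spectral_norm (Z + dagger Z)"
    using spectral_norm_cscale[of "complex_of_real (1 / 2)" "Z + dagger Z"]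
    unfolding herm_part_def scaleR_cscale by simp
  then show ?thesis using spectral_norm_triangle[of Z "dagger Z"] by (simp add: spectral_norm_dagger)
qed

lemma spectral_norm_skew_part: "spectral_norm (skew_part Z) \<le> spectral_norm Z"
proof -
  have "spectral_norm (skew_part Z) \<le> 1 / 2 * spectral_norm (Z - dagger Z)"
    using spectral_norm_cscale[of "- \<i> / 2" "Z - dagger Z"]
    unfolding skew_part_def by (simp add: norm_divide)
  then show ?thesis using spectral_norm_diff[of Z "dagger Z"] by (simp add: spectral_norm_dagger)
qed

lemma sum_herm_part: "(\<Sum>s\<in>S. herm_part (f s)) = herm_part (\<Sum>s\<in>S. f s)"
  by (simp add: herm_part_def dagger_sum sum.distrib scaleR_sum_right scaleR_right_distrib)

lemma sum_skew_part: "(\<Sum>s\<in>S. skew_part (f s)) = skew_part (\<Sum>s\<in>S. f s)"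
  by (simp add: skew_part_def dagger_sum cscale_diff_right cscale_sum_right sum_subtractf)

context onb
begin

lemma unitary_conjugated_product:
  assumes "hermitian H" shows "unitary (conjugated_product b H \<Delta> ss)"
  by (induction ss)
    (simp_all add: unitary_mult unitary_dagger unitary_phase_unitary unitary_evol assms)

lemma unitary_reshaped_evol:
  assumes "hermitian H" "V \<in> set_pmf (reshaped_evol b H L \<tau>)" shows "unitary V"
  using assms by (auto simp: reshaped_evol_def unitary_conjugated_product)

text \<open>
  In the frame rotating with the target evolution the product is \<open>1\<close> plus a martingale plus a drift,
  the latter coming from the difference between the averaged and the target step.
\<close>

lemma reshaping_martingale:
  fixes L :: nat and \<tau> :: real
  assumes H: "hermitian H" and L: "L \<ge> 1"
  defines "K \<equiv> (spectral_norm H)\<^sup>2 * \<tau>\<^sup>2 / real L"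
  assumes r: "r > 0"
  shows "measure_pmf.prob (reshaped_evol b H L \<tau>) {V. spectral_norm (evol (diag_part b H) \<tau> - V) \<le> 2 * r + K}
    \<ge> 1 - 2 * real CARD('n) * (real q * (4 * K) / r\<^sup>2) ^ q"
proof -
  define \<Delta> where "\<Delta> = \<tau> / real L"
  define W where "W s = dagger (phase_unitary b s) ** evol H \<Delta> ** phase_unitary b s" for s
  define D where "D = diag_part b (evol H \<Delta>)"
  define V where "V = conjugated_product b H \<Delta>"
  \<comment> \<open>The target run backwards over \<open>n\<close> steps: multiplied by it, a
    perfect product would stay at the identity.\<close>
  define Q where "Q n = evol (diag_part b H) (- (real n * \<Delta>))" for n :: nat
  define U0 where "U0 = evol (diag_part b H) \<Delta>"
  let ?a = "spectral_norm H * \<bar>\<Delta>\<bar>"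
  let ?u = "2 * ?a"
  have Hd: "hermitian (diag_part b H)" by (rule hermitian_diag_part[OF H])
  have VC: "V (s # ss) = W s ** V ss" for s ss by (simp add: V_def W_def)
  have uV: "unitary (V ss)" for ss unfolding V_def by (rule unitary_conjugated_product[OF H])
  have uQ: "unitary (Q n)" for n unfolding Q_def by (rule unitary_evol[OF Hd])
  have QU: "Q (Suc n) ** U0 = Q n" for n
    by (simp add: Q_def U0_def evol_add[OF Hd, symmetric] algebra_simps)
  have sumW: "(\<Sum>s<CARD('n). W s) = real CARD('n) *\<^sub>R D"
    using twirl[of "evol H \<Delta>"] unfolding D_def W_def by (simp flip: twirl)
  have dW: "spectral_norm (W s - D) \<le> ?u" for s
  proof -
    have "W s - mat 1 = dagger (phase_unitary b s) ** (evol H \<Delta> - mat 1) ** phase_unitary b s"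
      using unitary_phase_unitary[of s] by (simp add: W_def mult_diff_left mult_diff_right unitary_def)
    then have "spectral_norm (W s - mat 1) \<le> spectral_norm (dagger (phase_unitary b s) ** (evol H \<Delta> - mat 1)) * spectral_norm (phase_unitary b s)"
      using spectral_norm_mult by metis
    also have "\<dots> = spectral_norm (evol H \<Delta> - mat 1) * spectral_norm (phase_unitary b s)"
      by (simp add: spectral_norm_unitary_mult unitary_dagger unitary_phase_unitary)
    also have "\<dots> \<le> ?a * 1"
      by (intro mult_mono evol_minus_1 H unitary_spectral_norm unitary_phase_unitary) (auto simp: spectral_norm_nonneg)
    finally have 1: "spectral_norm (W s - mat 1) \<le> ?a" by simp
    have "spectral_norm (D - mat 1) = spectral_norm (diag_part b (evol H \<Delta> - mat 1))"
      by (simp add: D_def diag_part_diff diag_part_mat1)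
    also have "\<dots> \<le> ?a" using spectral_norm_diag_part evol_minus_1[OF H] order_trans by blast
    finally have 2: "spectral_norm (D - mat 1) \<le> ?a" .
    have "W s - D = (W s - mat 1) - (D - mat 1)" by simp
    then show ?thesis using spectral_norm_diff[of "W s - mat 1" "D - mat 1"] 1 2 by simp
  qed
  have dD: "spectral_norm (D - U0) \<le> ?a\<^sup>2"
    using diag_part_evol[OF H, of \<Delta>] by (simp add: D_def U0_def power_mult_distrib)
  have sandwich: "spectral_norm (Q n ** X ** V ss) \<le> spectral_norm X" for n X ss
  proof -
    have "spectral_norm (Q n ** X ** V ss) \<le> spectral_norm (Q n ** X) * spectral_norm (V ss)"
      by (rule spectral_norm_mult)
    also have "\<dots> \<le> spectral_norm X * 1"
      by (intro mult_mono unitary_spectral_norm uV) (auto simp: spectral_norm_unitary_mult uQ spectral_norm_nonneg)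
    finally show ?thesis by simp
  qed
  \<comment> \<open>\<open>W s - D\<close> is the deviation of a step from its average over
    \<open>s\<close>, hence centred for each past \<open>ss\<close>; the unitaries on both sides do
    not enlarge it.\<close>
  define Y where "Y ss s = Q (Suc (length ss)) ** (W s - D) ** V ss" for ss s
  define A where "A = rec_list 0 (\<lambda>s ss m. m + herm_part (Y ss s))"
  define B where "B = rec_list 0 (\<lambda>s ss m. m + skew_part (Y ss s))"
  \<comment> \<open>The drift: the average step \<open>D\<close> differs from the target step
    \<open>U0\<close> only to second order in \<open>\<Delta>\<close>, so that all \<open>L\<close>
    steps together contribute at most \<open>K\<close>, which is of order
    \<open>1 / L\<close>.\<close>
  define F where "F = rec_list 0 (\<lambda>(s :: nat) ss m. m + Q (Suc (length ss)) ** (D - U0) ** V ss)"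
  have A: "A [] = 0" "A (s # ss) = A ss + herm_part (Y ss s)" for s ss by (simp_all add: A_def)
  have B: "B [] = 0" "B (s # ss) = B ss + skew_part (Y ss s)" for s ss by (simp_all add: B_def)
  have F: "F [] = 0" "F (s # ss) = F ss + Q (Suc (length ss)) ** (D - U0) ** V ss" for s ss by (simp_all add: F_def)
  have Yn: "spectral_norm (Y ss s) \<le> ?u" for ss s
    unfolding Y_def using sandwich dW order_trans by blast
  have Y0: "(\<Sum>s<CARD('n). Y ss s) = 0" for ss
  proof -
    have "(\<Sum>s<CARD('n). Y ss s) = Q (Suc (length ss)) ** (\<Sum>s<CARD('n). W s - D) ** V ss"
      by (simp add: Y_def mult_sum_left mult_sum_right)
    also have "(\<Sum>s<CARD('n). W s - D) = 0"
      by (simp add: sum_subtractf sumW sum_constant_scaleR del: sum_constant)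
    finally show ?thesis by simp
  qed
  have R: "Q (length ss) ** V ss = mat 1 + (A ss + cscale \<i> (B ss)) + F ss" for ss
  proof (induction ss)
    case Nil
    have "Q 0 = mat 1" by (simp add: Q_def evol_0[OF Hd])
    then show ?case by (simp add: A B F V_def)
  next
    case (Cons s ss)
    have "Q (length (s # ss)) ** V (s # ss) = Q (Suc (length ss)) ** ((W s - D) + (D - U0) + U0) ** V ss"
      by (simp add: VC matrix_mul_assoc)
    also have "\<dots> = Y ss s + Q (Suc (length ss)) ** (D - U0) ** V ss + Q (length ss) ** V ss"
      unfolding Y_def matrix_add_ldistrib mult_add_left QU by simp
    also have "\<dots> = (herm_part (Y ss s) + cscale \<i> (skew_part (Y ss s))) + Q (Suc (length ss)) ** (D - U0) ** V ss
        + (mat 1 + (A ss + cscale \<i> (B ss)) + F ss)"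
      unfolding Cons.IH by (subst herm_skew[of "Y ss s"]) (rule refl)
    finally show ?case by (simp add: A B F cscale_add_right algebra_simps)
  qed
  have Fn: "spectral_norm (F ss) \<le> real (length ss) * ?a\<^sup>2" for ss
  proof (induction ss)
    case (Cons s ss)
    have "spectral_norm (F (s # ss)) \<le> spectral_norm (F ss) + spectral_norm (Q (Suc (length ss)) ** (D - U0) ** V ss)"
      unfolding F by (rule spectral_norm_triangle)
    also have "\<dots> \<le> real (length ss) * ?a\<^sup>2 + ?a\<^sup>2"
      using Cons.IH sandwich[of "Suc (length ss)" "D - U0" ss] dD by linarith
    finally show ?case by (simp add: algebra_simps)
  qed (simp add: F)
  have a2: "?a\<^sup>2 = (spectral_norm H)\<^sup>2 * \<tau>\<^sup>2 / (real L)\<^sup>2"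
    by (simp add: \<Delta>_def power_mult_distrib power_divide)
  \<comment> \<open>A step and its average both lie within \<open>?a\<close> of the identity, so
    deviations are at most \<open>2 * ?a\<close>; squaring gives the factor 4.\<close>
  have K: "real L * ?a\<^sup>2 = K" "real L * ?u\<^sup>2 = 4 * K"
    unfolding power_mult_distrib[of 2] a2 K_def using L by (simp_all add: power2_eq_square field_simps)
  let ?R = "replicate_pmf L (pmf_of_set {..<CARD('n)})"
  let ?PA = "measure_pmf.prob ?R {ss. r < spectral_norm (A ss)}"
  let ?PB = "measure_pmf.prob ?R {ss. r < spectral_norm (B ss)}"
  let ?good = "{ss. spectral_norm (evol (diag_part b H) \<tau> - V ss) \<le> 2 * r + K}"
  have ne: "finite {..<CARD('n)}" "{..<CARD('n)} \<noteq> {}" by (auto simp: lessThan_empty_iff)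
  have qu: "real q * real L * ?u\<^sup>2 = real q * (4 * K)" by (simp only: mult.assoc K(2))
  have "?PA \<le> real CARD('n) * (real q * real L * ?u\<^sup>2 / r\<^sup>2) ^ q"
  proof (rule martingale_tail[OF ne A hermitian_herm_part order_trans[OF spectral_norm_herm_part Yn] _ r])
    show "(\<Sum>s<CARD('n). herm_part (Y ss s)) = 0" for ss
      unfolding sum_herm_part Y0 by (simp add: herm_part_def)
  qed
  then have PA: "?PA \<le> real CARD('n) * (real q * (4 * K) / r\<^sup>2) ^ q" by (simp only: qu)
  have "?PB \<le> real CARD('n) * (real q * real L * ?u\<^sup>2 / r\<^sup>2) ^ q"
  proof (rule martingale_tail[OF ne B hermitian_skew_part order_trans[OF spectral_norm_skew_part Yn] _ r])
    show "(\<Sum>s<CARD('n). skew_part (Y ss s)) = 0" for ss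
      unfolding sum_skew_part Y0 by (simp add: skew_part_def)
  qed
  then have PB: "?PB \<le> real CARD('n) * (real q * (4 * K) / r\<^sup>2) ^ q" by (simp only: qu)
  have len: "length ss = L" if "ss \<in> set_pmf ?R" for ss
    using that by (simp add: set_replicate_pmf)
  have good: "ss \<in> ?good \<union> {ss. r < spectral_norm (A ss)} \<union> {ss. r < spectral_norm (B ss)}"
    if ss: "ss \<in> set_pmf ?R" for ss
  proof -
    have "spectral_norm (evol (diag_part b H) \<tau> - V ss) \<le> 2 * r + K"
      if "spectral_norm (A ss) \<le> r" "spectral_norm (B ss) \<le> r"
    proof -
      have Q1: "Q L ** evol (diag_part b H) \<tau> = mat 1"
        using L by (simp add: Q_def evol_add[OF Hd, symmetric] \<Delta>_def evol_0[OF Hd])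
      have "spectral_norm (evol (diag_part b H) \<tau> - V ss) = spectral_norm (Q L ** (evol (diag_part b H) \<tau> - V ss))"
        by (simp add: spectral_norm_unitary_mult uQ)
      also have "Q L ** (evol (diag_part b H) \<tau> - V ss) = - (A ss + cscale \<i> (B ss) + F ss)"
        using R[of ss] by (simp add: mult_diff_right Q1 len[OF ss])
      also have "spectral_norm \<dots> \<le> spectral_norm (A ss + cscale \<i> (B ss)) + spectral_norm (F ss)"
        unfolding spectral_norm_minus by (rule spectral_norm_triangle)
      also have "spectral_norm (A ss + cscale \<i> (B ss)) \<le> spectral_norm (A ss) + spectral_norm (B ss)"
        using spectral_norm_triangle[of "A ss" "cscale \<i> (B ss)"] spectral_norm_cscale[of \<i> "B ss"] by simp
      finally show ?thesis using that Fn[of ss] len[OF ss] K(1) by simp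
    qed
    then show ?thesis by fastforce
  qed
  have "1 = measure_pmf.prob ?R (?good \<union> {ss. r < spectral_norm (A ss)} \<union> {ss. r < spectral_norm (B ss)})"
    using good by (subst measure_pmf.prob_eq_1[THEN iffD2]) (auto simp: AE_measure_pmf_iff)
  also have "\<dots> \<le> measure_pmf.prob ?R ?good + ?PA + ?PB"
    using measure_Un_le[of ?good "measure_pmf ?R" "{ss. r < spectral_norm (A ss)}"]
      measure_Un_le[of "?good \<union> {ss. r < spectral_norm (A ss)}" "measure_pmf ?R" "{ss. r < spectral_norm (B ss)}"]
    by simp
  finally have "1 - 2 * real CARD('n) * (real q * (4 * K) / r\<^sup>2) ^ q \<le> measure_pmf.prob ?R ?good"
    using PA PB by simp
  also have "measure_pmf.prob ?R ?good = measure_pmf.prob (reshaped_evol b H L \<tau>) {V. spectral_norm (evol (diag_part b H) \<tau> - V) \<le> 2 * r + K}"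
    by (simp add: reshaped_evol_def V_def \<Delta>_def vimage_def)
  finally show ?thesis .
qed

text \<open>With a moment order \<open>q\<close> between \<open>3 * l\<close> and
  \<open>5 * l\<close> for \<open>l = c * ln N\<close>, the base of the tail bound is at most
  \<open>exp (- 1)\<close>, so its power is at most \<open>N powr (- 3 * c)\<close>. The prefactor
  \<open>2 * N\<close> is at most \<open>N\<^sup>2\<close>, and \<open>2 - 3 * c \<le> - c\<close>
  for \<open>c \<ge> 1\<close>. The constant \<open>10 ^ 4\<close> is generous.\<close>

theorem reshaping_error:
  fixes L :: nat and \<tau> c \<epsilon> :: real
  assumes H: "hermitian H" and c: "c \<ge> 1" and \<epsilon>: "\<epsilon> > 0" and L: "L \<ge> 1"
    and big: "real L \<ge> 10 ^ 4 * c * (ln (real CARD('n)) * (spectral_norm H)\<^sup>2 * \<tau>\<^sup>2 / \<epsilon>\<^sup>2)"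
  shows "measure_pmf.prob (reshaped_evol b H L \<tau>) {V. spectral_norm (evol (diag_part b H) \<tau> - V) \<le> \<epsilon>}
    \<ge> 1 - real CARD('n) powr (- c)"
proof -
  let ?N = "real CARD('n)"
  let ?P = "\<lambda>e. measure_pmf.prob (reshaped_evol b H L \<tau>) {V. spectral_norm (evol (diag_part b H) \<tau> - V) \<le> e}"
  \<comment> \<open>For \<open>N = 1\<close> the claimed lower bound on the probability is zero, and
    an error of \<open>2\<close> is never exceeded by two unitaries. Without these cases
    \<open>ln N\<close> is bounded below and the drift, quadratic in \<open>\<epsilon>\<close>, is
    small against \<open>\<epsilon>\<close>.\<close>
  consider "CARD('n) = 1" | "\<epsilon> \<ge> 2" | "CARD('n) \<ge> 2" "\<epsilon> < 2"
    using zero_less_card_finite[where 'a='n] by linarith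
  then show ?thesis
  proof cases
    case 1 then show ?thesis by simp
  next
    case 2
    have "spectral_norm (evol (diag_part b H) \<tau> - V) \<le> \<epsilon>" if "V \<in> set_pmf (reshaped_evol b H L \<tau>)" for V
      using spectral_norm_diff[of "evol (diag_part b H) \<tau>" V] 2
        unitary_spectral_norm[OF unitary_reshaped_evol[OF H that]]
        unitary_spectral_norm[OF unitary_evol[OF hermitian_diag_part[OF H]], of \<tau>] by linarith
    then have "?P \<epsilon> = 1"
      by (subst measure_pmf.prob_eq_1) (auto simp: AE_measure_pmf_iff)
    then show ?thesis by simp
  next
    case 3
    define K where "K = (spectral_norm H)\<^sup>2 * \<tau>\<^sup>2 / real L"
    define l where "l = c * ln ?N"
    have ln2: "ln ?N \<ge> 1 / 2"
    proof -
      have "exp (1 / 2 :: real) \<le> 2" using exp_bound_half[of "1/2 :: real"] by simp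
      also have "\<dots> \<le> ?N" using 3 by simp
      finally show ?thesis using 3 by (subst ln_ge_iff) auto
    qed
    have l: "l \<ge> 1 / 2" unfolding l_def using mult_mono[OF c ln2] c ln2 by simp
    have K0: "K \<ge> 0" by (simp add: K_def)
    have KL: "10 ^ 4 * l * K \<le> \<epsilon>\<^sup>2"
    proof -
      have "10 ^ 4 * l * ((spectral_norm H)\<^sup>2 * \<tau>\<^sup>2) / \<epsilon>\<^sup>2 \<le> real L" using big by (simp add: l_def mult_ac)
      then have "10 ^ 4 * l * ((spectral_norm H)\<^sup>2 * \<tau>\<^sup>2) \<le> real L * \<epsilon>\<^sup>2" using \<epsilon> by (simp add: divide_le_eq)
      then show ?thesis using L by (simp add: K_def divide_le_eq mult_ac)
    qed
    \<comment> \<open>The Hermitian and the skew martingale get \<open>49 / 100\<close> of the error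
      each, which leaves a fiftieth for the drift \<open>K\<close>.\<close>
    define r where "r = 49 / 100 * \<epsilon>"
    have r: "r > 0" using \<epsilon> by (simp add: r_def)
    define q where "q = nat \<lceil>3 * l\<rceil>"
    have q: "3 * l \<le> real q" "real q \<le> 5 * l"
    proof -
      show "3 * l \<le> real q" unfolding q_def by linarith
      have "real q < 3 * l + 1" unfolding q_def using l by linarith
      then show "real q \<le> 5 * l" using l by linarith
    qed
    have "10 ^ 4 * (1 / 2) * K \<le> 10 ^ 4 * l * K" using l K0 by (intro mult_right_mono mult_left_mono) auto
    from order_trans[OF this KL] have "5000 * K \<le> \<epsilon> * \<epsilon>" by (simp add: power2_eq_square)
    also have "\<dots> \<le> 2 * \<epsilon>" using 3 \<epsilon> by (intro mult_right_mono) auto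
    finally have "2 * r + K \<le> \<epsilon>" using \<epsilon> by (simp add: r_def)
    then have mono: "?P (2 * r + K) \<le> ?P \<epsilon>"
      by (intro measure_pmf.finite_measure_mono) auto
    have x: "real q * (4 * K) / r\<^sup>2 \<le> exp (- 1)"
    proof -
      have "real q * (4 * K) \<le> (5 * l) * (4 * K)" using q K0 by (intro mult_right_mono) auto
      also have "\<dots> \<le> 20 / 10 ^ 4 * \<epsilon>\<^sup>2" using KL by simp
      also have "\<dots> \<le> 1 / 3 * r\<^sup>2" by (simp add: r_def power_mult_distrib power_divide)
      finally have "real q * (4 * K) / r\<^sup>2 \<le> 1 / 3" using r by (simp add: divide_le_eq)
      also have "\<dots> \<le> exp (- 1)" using exp_le by (simp add: exp_minus field_simps)
      finally show ?thesis .
    qed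
    have "?N * 2 * (real q * (4 * K) / r\<^sup>2) ^ q \<le> ?N * ?N * exp (- 1) ^ q"
      using 3 x K0 by (intro mult_mono power_mono) auto
    also have "exp (- 1) ^ q = exp (- real q)" by (simp add: exp_of_nat_mult[symmetric])
    also have "\<dots> \<le> exp (- (3 * l))" using q by simp
    also have "exp (- (3 * l)) = ?N powr (- 3 * c)" by (simp add: powr_def l_def mult_ac)
    finally have "2 * ?N * (real q * (4 * K) / r\<^sup>2) ^ q \<le> ?N powr 2 * ?N powr (- 3 * c)"
      using 3 by (simp add: mult_ac powr_numeral power2_eq_square)
    also have "\<dots> = ?N powr (2 - 3 * c)" unfolding powr_add[symmetric] by simp
    also have "\<dots> \<le> ?N powr (- c)" using 3 c by (intro powr_mono) auto
    finally have "2 * ?N * (real q * (4 * K) / r\<^sup>2) ^ q \<le> ?N powr (- c)" .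
    then show ?thesis
      using reshaping_martingale[OF H L r, of q \<tau>] mono unfolding K_def by linarith
  qed
qed

end

section \<open>The swap protocol, with exact and with randomized free evolution\<close>

section \<open>The swap protocol\<close>

lemma mv_scaleR: "A *v (r *\<^sub>R v) = r *\<^sub>R (A *v v)" for A :: "'n::finite cmat"
  by (simp add: vec_eq_iff mat_nth scaleR_sum_right)

lemma sum_nth_distinct:
  assumes "distinct zs" shows "(\<Sum>j<length zs. f (zs ! j)) = (\<Sum>z\<in>set zs. f z)"
  using assms by (simp add: sum_list_distinct_conv_sum_set[symmetric] sum_list_sum_nth atLeast0LessThan)

context onb
begin

lemma swap_unitary_basis:
  assumes "k < CARD('n)" "k' < CARD('n)" "j < CARD('n)" "k \<noteq> k'"
  shows "swap_unitary b k k' *v b j = b (if j = k then k' else if j = k' then k else j)"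
proof -
  have "(\<Sum>k''\<in>{..<CARD('n)} - {k, k'}. ketbra (b k'') (b k'') *v b j) =
      (\<Sum>k''\<in>{..<CARD('n)} - {k, k'}. if k'' = j then b j else 0)"
    using assms by (intro sum.cong) (auto simp: ketbra_mv braket_basis)
  also have "\<dots> = (if j = k \<or> j = k' then 0 else b j)" using assms by simp
  finally show ?thesis
    using assms by (simp add: swap_unitary_def matrix_vector_mult_add_rdistrib sum_mv ketbra_mv braket_basis)
qed

lemma unitary_swap_unitary:
  assumes "k < CARD('n)" "k' < CARD('n)" "k \<noteq> k'" shows "unitary (swap_unitary b k k')"
proof -
  have d: "dagger (swap_unitary b k k') = swap_unitary b k k'"
    by (simp add: swap_unitary_def dagger_add dagger_sum dagger_ketbra add.commute)
  have "swap_unitary b k k' ** swap_unitary b k k' = mat 1"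
    by (rule mat_eqI)
      (use assms in \<open>auto simp: matrix_vector_mul_assoc[symmetric] swap_unitary_basis\<close>)
  then show ?thesis by (simp add: unitary_def d)
qed

lemma basis_inj: "k < CARD('n) \<Longrightarrow> j < CARD('n) \<Longrightarrow> b k = b j \<longleftrightarrow> k = j"
  using braket_basis[of k j] braket_basis[of k k] by (auto split: if_splits)

abbreviation free :: "(nat \<Rightarrow> real) \<Rightarrow> real \<Rightarrow> 'n cmat" where
  "free h \<tau> \<equiv> diag_op (\<lambda>k. cis (- (h k * \<tau>)))"

lemma free_add: "free h \<sigma> ** free h \<tau> = free h (\<sigma> + \<tau>)"
  unfolding diag_op_mult by (simp add: cis_mult algebra_simps)

text \<open>Free evolution in front of the propagator moves its starting time back; this merges two
  intervals once the pulse between them is dropped.\<close>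

lemma pulsed_absorb: "pulsed (free h) r qs T *v (free h (r - s) *v v) = pulsed (free h) s qs T *v v"
proof (cases qs)
  case Nil then show ?thesis by (simp add: matrix_vector_mul_assoc free_add)
next
  case (Cons p ps)
  obtain r' S where p: "p = (r', S)" by (cases p)
  have "pulsed (free h) r' ps T ** S ** free h (r' - r) ** free h (r - s) =
      pulsed (free h) r' ps T ** S ** (free h (r' - r) ** free h (r - s))"
    by (simp add: matrix_mul_assoc)
  then show ?thesis by (simp add: Cons p matrix_vector_mul_assoc free_add)
qed

text \<open>In the merged schedule the pulses of one branch interrupt the intervals of the other. If
  every pulse sends basis vectors labelled by \<open>Z\<close> to such vectors, those fixing all of
  them can be deleted for a start in \<open>Z\<close>, which isolates one branch.\<close>

lemma pulsed_filter:
  assumes Z: "Z \<subseteq> {..<CARD('n)}"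
    and ps: "\<And>p k. p \<in> set ps \<Longrightarrow> k \<in> Z \<Longrightarrow> \<exists>j\<in>Z. snd p *v b k = b j"
    and k: "k \<in> Z"
  shows "pulsed (free h) s ps T *v b k =
    pulsed (free h) s (filter (\<lambda>p. \<exists>k\<in>Z. snd p *v b k \<noteq> b k) ps) T *v b k"
  using ps k
proof (induction ps arbitrary: s k)
  case Nil then show ?case by simp
next
  case (Cons p ps)
  obtain r S where p: "p = (r, S)" by (cases p)
  let ?F = "filter (\<lambda>p. \<exists>k\<in>Z. snd p *v b k \<noteq> b k)"
  have k: "k < CARD('n)" using Cons.prems(2) Z by auto
  obtain j where j: "j \<in> Z" "S *v b k = b j" using Cons.prems(1)[of p k] Cons.prems(2) by (auto simp: p)
  have free: "free h (r - s) *v b k = cis (- (h k * (r - s))) *s b k" using k by (rule diag_op_basis)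
  have "pulsed (free h) s (p # ps) T *v b k =
      pulsed (free h) r ps T *v (S *v (free h (r - s) *v b k))"
    by (simp add: p matrix_vector_mul_assoc matrix_mul_assoc)
  also have "\<dots> = cis (- (h k * (r - s))) *s (pulsed (free h) r ps T *v b j)"
    by (simp only: free mv_cscale j)
  also have "\<dots> = cis (- (h k * (r - s))) *s (pulsed (free h) r (?F ps) T *v b j)"
    using Cons.IH[of j r] Cons.prems(1) j(1) by simp
  finally have L: "pulsed (free h) s (p # ps) T *v b k =
    cis (- (h k * (r - s))) *s (pulsed (free h) r (?F ps) T *v b j)" .
  show ?case
  proof (cases "\<exists>k\<in>Z. S *v b k \<noteq> b k")
    case True
    have "pulsed (free h) s (?F (p # ps)) T *v b k =
        pulsed (free h) r (?F ps) T *v (S *v (free h (r - s) *v b k))"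
      using True by (simp add: p matrix_vector_mul_assoc matrix_mul_assoc)
    then show ?thesis unfolding L by (simp only: free mv_cscale j)
  next
    case False
    then have "b j = b k" using j(2) Cons.prems(2) by auto
    have "pulsed (free h) s (?F (p # ps)) T *v b k = pulsed (free h) s (?F ps) T *v b k"
      using False by (simp add: p)
    also have "\<dots> = pulsed (free h) r (?F ps) T *v (free h (r - s) *v b k)"
      by (rule pulsed_absorb[symmetric])
    finally show ?thesis unfolding L by (simp only: free mv_cscale \<open>b j = b k\<close>)
  qed
qed

text \<open>One branch in isolation. Weights enter through the quotients
  \<open>a z * t / (\<Sum>z\<in>set zs. a z)\<close>, so the same lemmas serve the negative
  eigenvalues, for which numerator and denominator are both negative.\<close>

context
  fixes a :: "nat \<Rightarrow> real" and t :: real and zs :: "nat list"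
  assumes zs: "distinct zs" "zs \<noteq> []" "set zs \<subseteq> {..<CARD('n)}"
    and nonneg: "\<And>z. z \<in> set zs \<Longrightarrow> 0 \<le> a z * t / (\<Sum>z\<in>set zs. a z)"
    and total: "(\<Sum>z\<in>set zs. a z) \<noteq> 0"
begin

lemma sorted_branch_pulses: "sorted (map fst (branch_pulses b a t zs))"
proof -
  have "(\<Sum>j\<le>i. a (zs ! j) * t / (\<Sum>z\<in>set zs. a z)) \<le> (\<Sum>j\<le>k. a (zs ! j) * t / (\<Sum>z\<in>set zs. a z))"
    if "i \<le> k" "k < length zs - 1" for i k
    using that by (intro sum_mono2 nonneg) auto
  then show ?thesis
    by (auto simp: branch_pulses_def sorted_iff_nth_mono)
qed

lemma branch_pulses_closed:
  assumes "p \<in> set (branch_pulses b a t zs)" "k < CARD('n)"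
  shows "\<exists>j. (k \<in> set zs \<longrightarrow> j \<in> set zs) \<and> (k \<notin> set zs \<longrightarrow> j = k) \<and> snd p *v b k = b j"
    and "\<exists>k\<in>set zs. snd p *v b k \<noteq> b k" "unitary (snd p)"
proof -
  obtain i where i: "i < length zs - 1" "snd p = swap_unitary b (zs ! i) (zs ! Suc i)"
    using assms(1) by (auto simp: branch_pulses_def)
  have z: "zs ! i \<in> set zs" "zs ! Suc i \<in> set zs" "zs ! i \<noteq> zs ! Suc i"
    using i zs(1) by (auto simp: nth_eq_iff_index_eq)
  then have lt: "zs ! i < CARD('n)" "zs ! Suc i < CARD('n)" using zs(3) by auto
  show "\<exists>j. (k \<in> set zs \<longrightarrow> j \<in> set zs) \<and> (k \<notin> set zs \<longrightarrow> j = k) \<and> snd p *v b k = b j"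
    unfolding i(2) swap_unitary_basis[OF lt assms(2) z(3)] using z by (intro exI conjI) auto
  show "\<exists>k\<in>set zs. snd p *v b k \<noteq> b k"
    using z lt by (intro bexI[of _ "zs ! i"]) (auto simp: i(2) swap_unitary_basis basis_inj)
  show "unitary (snd p)" unfolding i(2) using lt z by (intro unitary_swap_unitary)
qed

text \<open>Each interval multiplies the current basis vector by a phase and each swap carries it to
  the next label. Induction backwards from the last interval collects the phases into a weighted
  mean of \<open>h\<close>.\<close>

lemma branch_evolution:
  "pulsed (free h) 0 (branch_pulses b a t zs) t *v b (hd zs) =
    cis (- ((\<Sum>z\<in>set zs. a z * h z) * t / (\<Sum>z\<in>set zs. a z))) *s b (last zs)"
proof -
  define A where "A = (\<Sum>z\<in>set zs. a z)"
  define d where "d j = a (zs ! j) * t / A" for j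
  define \<tau> where "\<tau> i = (\<Sum>j<i. d j)" for i
  define n where "n = length zs"
  have n: "n > 0" using zs by (simp add: n_def)
  have tot: "\<tau> n = t"
  proof -
    have "\<tau> n = (\<Sum>z\<in>set zs. a z * t / A)"
      unfolding \<tau>_def d_def n_def by (rule sum_nth_distinct[OF zs(1)])
    also have "\<dots> = (\<Sum>z\<in>set zs. a z) * t / A" by (simp add: sum_divide_distrib sum_distrib_right)
    finally show ?thesis using total by (simp add: A_def)
  qed
  \<comment> \<open>The swap with index \<open>i\<close> happens at \<open>\<tau> (Suc i)\<close>,
    the end of the interval with index \<open>i\<close>.\<close>
  let ?p = "\<lambda>i. (\<tau> (Suc i), swap_unitary b (zs ! i) (zs ! Suc i))"
  have bp: "branch_pulses b a t zs = map ?p [0..<n - 1]"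
    by (simp add: branch_pulses_def \<tau>_def d_def A_def n_def lessThan_Suc_atMost)
  have lt: "zs ! i < CARD('n)" if "i < n" for i using that zs(3) nth_mem by (force simp: n_def)
  have "pulsed (free h) (\<tau> i) (map ?p [i..<n - 1]) t *v b (zs ! i) =
      cis (- (\<Sum>j\<in>{i..<n}. h (zs ! j) * d j)) *s b (zs ! (n - 1))" if "i \<le> n - 1" for i
    using that
  proof (induction i rule: inc_induct)
    case base
    have "t - \<tau> (n - 1) = d (n - 1)"
      unfolding tot[symmetric] \<tau>_def using n by (cases n) auto
    moreover have "{n - 1..<n} = {n - 1}" using n by auto
    ultimately show ?case using n lt by (simp add: diag_op_basis)
  next
    case (step i)
    have i: "i < n" "Suc i < n" using step by auto
    have ne: "zs ! i \<noteq> zs ! Suc i" using i zs(1) by (simp add: n_def nth_eq_iff_index_eq)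
    have up: "[i..<n - 1] = i # [Suc i..<n - 1]" using step by (simp add: upt_conv_Cons)
    have di: "\<tau> (Suc i) - \<tau> i = d i" by (simp add: \<tau>_def)
    have S: "swap_unitary b (zs ! i) (zs ! Suc i) *v b (zs ! i) = b (zs ! Suc i)"
      using lt i ne by (simp add: swap_unitary_basis)
    have "pulsed (free h) (\<tau> i) (map ?p [i..<n - 1]) t *v b (zs ! i) =
        pulsed (free h) (\<tau> (Suc i)) (map ?p [Suc i..<n - 1]) t *v
          (swap_unitary b (zs ! i) (zs ! Suc i) *v (free h (d i) *v b (zs ! i)))"
      unfolding up by (simp add: di matrix_vector_mul_assoc matrix_mul_assoc)
    also have "\<dots> = cis (- (h (zs ! i) * d i)) *s
        (pulsed (free h) (\<tau> (Suc i)) (map ?p [Suc i..<n - 1]) t *v b (zs ! Suc i))"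
      by (simp only: diag_op_basis[OF lt[OF i(1)]] mv_cscale S)
    also have "\<dots> = cis (- (\<Sum>j\<in>{i..<n}. h (zs ! j) * d j)) *s b (zs ! (n - 1))"
      unfolding step.IH using i
      by (simp add: vector_smult_assoc cis_mult sum.atLeast_Suc_lessThan)
    finally show ?case .
  qed
  from this[of 0] have "pulsed (free h) 0 (branch_pulses b a t zs) t *v b (zs ! 0) =
      cis (- (\<Sum>j<n. h (zs ! j) * d j)) *s b (zs ! (n - 1))"
    by (simp add: bp \<tau>_def atLeast0LessThan)
  also have "(\<Sum>j<n. h (zs ! j) * d j) = (\<Sum>z\<in>set zs. h z * (a z * t / A))"
    unfolding d_def n_def by (rule sum_nth_distinct[OF zs(1)])
  also have "\<dots> = (\<Sum>z\<in>set zs. a z * h z) * t / A"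
    unfolding sum_divide_distrib sum_distrib_right by (simp add: mult_ac)
  finally show ?thesis using zs by (simp add: hd_conv_nth last_conv_nth n_def A_def)
qed

end

end

locale swap_protocol = onb b for b :: "nat \<Rightarrow> 'n::finite cvec" +
  fixes a :: "nat \<Rightarrow> real" and t :: real and xs ys :: "nat list"
  assumes xs: "distinct xs" "set xs = {k. k < CARD('n) \<and> a k > 0}"
    and ys: "distinct ys" "set ys = {k. k < CARD('n) \<and> a k < 0}"
    and traceless_a: "(\<Sum>k<CARD('n). a k) = 0"
    and nontrivial_a: "\<exists>k<CARD('n). a k \<noteq> 0"
    and t: "0 < t"
begin

lemma split_sum:
  fixes f :: "nat \<Rightarrow> real"
  assumes "\<And>k. k < CARD('n) \<Longrightarrow> a k = 0 \<Longrightarrow> f k = 0"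
  shows "(\<Sum>k<CARD('n). f k) = (\<Sum>k\<in>set xs. f k) + (\<Sum>k\<in>set ys. f k)"
proof -
  have "(\<Sum>k<CARD('n). f k) = (\<Sum>k\<in>set xs \<union> set ys. f k)"
    using assms by (intro sum.mono_neutral_right) (auto simp: xs ys not_less intro: antisym)
  also have "\<dots> = (\<Sum>k\<in>set xs. f k) + (\<Sum>k\<in>set ys. f k)"
    by (rule sum.union_disjoint) (auto simp: xs ys)
  finally show ?thesis .
qed

text \<open>Tracelessness makes the positive and the negative part equally heavy, each half of the
  trace norm; this is the factor 2 in the phase.\<close>

lemma sum_xs: "(\<Sum>x\<in>set xs. a x) = (\<Sum>k<CARD('n). \<bar>a k\<bar>) / 2" and sum_ys: "(\<Sum>y\<in>set ys. a y) = - (\<Sum>k<CARD('n). \<bar>a k\<bar>) / 2"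
proof -
  have "(\<Sum>k<CARD('n). \<bar>a k\<bar>) = (\<Sum>x\<in>set xs. \<bar>a x\<bar>) + (\<Sum>y\<in>set ys. \<bar>a y\<bar>)" by (rule split_sum) simp
  also have "(\<Sum>x\<in>set xs. \<bar>a x\<bar>) = (\<Sum>x\<in>set xs. a x)" by (rule sum.cong) (auto simp: xs)
  also have "(\<Sum>y\<in>set ys. \<bar>a y\<bar>) = (\<Sum>y\<in>set ys. - a y)" by (rule sum.cong) (auto simp: ys)
  finally have 1: "(\<Sum>k<CARD('n). \<bar>a k\<bar>) = (\<Sum>x\<in>set xs. a x) - (\<Sum>y\<in>set ys. a y)" by (simp add: sum_negf)
  have 2: "(\<Sum>x\<in>set xs. a x) + (\<Sum>y\<in>set ys. a y) = 0" using split_sum[of a] traceless_a by simp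
  show "(\<Sum>x\<in>set xs. a x) = (\<Sum>k<CARD('n). \<bar>a k\<bar>) / 2" "(\<Sum>y\<in>set ys. a y) = - (\<Sum>k<CARD('n). \<bar>a k\<bar>) / 2" using 1 2 by linarith+
qed

lemma tn_pos: "0 < (\<Sum>k<CARD('n). \<bar>a k\<bar>)"
proof -
  obtain k where "k < CARD('n)" "a k \<noteq> 0" using nontrivial_a by blast
  then show ?thesis by (intro sum_pos2[of _ k]) auto
qed

lemma xs_ne: "xs \<noteq> []" and ys_ne: "ys \<noteq> []"
  using sum_xs sum_ys tn_pos by auto

lemma disjoint: "set xs \<inter> set ys = {}" by (auto simp: xs ys)
lemma xs_lt: "set xs \<subseteq> {..<CARD('n)}" and ys_lt: "set ys \<subseteq> {..<CARD('n)}" by (auto simp: xs ys)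

lemma ends_lt: "last xs < CARD('n)" "last ys < CARD('n)" "hd xs < CARD('n)" "hd ys < CARD('n)"
  using xs_lt ys_lt last_in_set[OF xs_ne] last_in_set[OF ys_ne] hd_in_set[OF xs_ne] hd_in_set[OF ys_ne]
  by auto

lemma last_ne: "last xs \<noteq> last ys" and hd_ne: "hd xs \<noteq> hd ys"
  using disjoint xs_ne ys_ne last_in_set hd_in_set by (metis IntI empty_iff)+

lemma xs_total: "(\<Sum>x\<in>set xs. a x) \<noteq> 0" and ys_total: "(\<Sum>y\<in>set ys. a y) \<noteq> 0"
  using sum_xs sum_ys tn_pos by auto

lemma xs_nonneg: "z \<in> set xs \<Longrightarrow> 0 \<le> a z * t / (\<Sum>z\<in>set xs. a z)"
  using sum_xs tn_pos t by (auto simp: xs intro!: divide_nonneg_nonneg)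
lemma ys_nonneg: "z \<in> set ys \<Longrightarrow> 0 \<le> a z * t / (\<Sum>z\<in>set ys. a z)"
proof -
  assume "z \<in> set ys"
  then have "a z * t \<le> 0" using t by (intro mult_nonpos_nonneg) (auto simp: ys)
  moreover have "(\<Sum>z\<in>set ys. a z) < 0" using sum_ys tn_pos by simp
  ultimately show ?thesis by (rule divide_nonpos_neg)
qed

lemmas X = xs(1) xs_ne xs_lt xs_nonneg xs_total
lemmas Y = ys(1) ys_ne ys_lt ys_nonneg ys_total

lemma set_schedule:
  "set (swap_schedule b a t xs ys) = set (branch_pulses b a t xs) \<union> set (branch_pulses b a t ys)"
  by (simp add: swap_schedule_def)

lemma schedule_unitary: "p \<in> set (swap_schedule b a t xs ys) \<Longrightarrow> unitary (snd p)"
  unfolding set_schedule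
  using branch_pulses_closed(3)[OF X _ ends_lt(1)] branch_pulses_closed(3)[OF Y _ ends_lt(1)] by blast

lemma schedule_length: "length (swap_schedule b a t xs ys) = card (set xs) + card (set ys) - 2"
  using xs_ne ys_ne xs(1) ys(1)
  by (cases xs; cases ys) (simp_all add: swap_schedule_def branch_pulses_def distinct_card)

lemma xs_fixed: "p \<in> set (branch_pulses b a t ys) \<Longrightarrow> k \<in> set xs \<Longrightarrow> snd p *v b k = b k"
  using branch_pulses_closed(1)[OF Y, of p k] disjoint xs_lt by blast
lemma ys_fixed: "p \<in> set (branch_pulses b a t xs) \<Longrightarrow> k \<in> set ys \<Longrightarrow> snd p *v b k = b k"
  using branch_pulses_closed(1)[OF X, of p k] disjoint ys_lt by blast

text \<open>Swaps of the other branch fix every \<open>b k\<close> with \<open>k\<close> in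
  \<open>set xs\<close>, whereas each swap of this branch moves one of them. Filtering commutes with
  the stable sort, and the remaining list is already sorted, so it is the schedule of this branch
  alone.\<close>

lemma schedule_xs:
  "pulsed (free h) 0 (swap_schedule b a t xs ys) t *v b (hd xs) =
    cis (- ((\<Sum>z\<in>set xs. a z * h z) * t / (\<Sum>z\<in>set xs. a z))) *s b (last xs)"
proof -
  let ?F = "\<lambda>p. \<exists>k\<in>set xs. snd p *v b k \<noteq> b k"
  have "\<exists>j\<in>set xs. snd p *v b k = b j" if "p \<in> set (swap_schedule b a t xs ys)" "k \<in> set xs" for p k
    using that branch_pulses_closed(1)[OF X, of p k] xs_fixed xs_lt unfolding set_schedule by blast
  then have "pulsed (free h) 0 (swap_schedule b a t xs ys) t *v b (hd xs) =
      pulsed (free h) 0 (filter ?F (swap_schedule b a t xs ys)) t *v b (hd xs)"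
    by (rule pulsed_filter[OF xs_lt]) (use xs_ne in auto)
  also have "filter ?F (branch_pulses b a t xs) = branch_pulses b a t xs"
    using branch_pulses_closed(2)[OF X _ ends_lt(1)] by (simp add: filter_id_conv)
  moreover have "filter ?F (branch_pulses b a t ys) = []"
    using xs_fixed by (simp add: filter_empty_conv)
  ultimately have "pulsed (free h) 0 (swap_schedule b a t xs ys) t *v b (hd xs) =
      pulsed (free h) 0 (branch_pulses b a t xs) t *v b (hd xs)"
    by (simp add: swap_schedule_def filter_sort sort_key_id_if_sorted sorted_branch_pulses[OF X])
  then show ?thesis using branch_evolution[OF X] by simp
qed

lemma schedule_ys:
  "pulsed (free h) 0 (swap_schedule b a t xs ys) t *v b (hd ys) =
    cis (- ((\<Sum>z\<in>set ys. a z * h z) * t / (\<Sum>z\<in>set ys. a z))) *s b (last ys)"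
proof -
  let ?F = "\<lambda>p. \<exists>k\<in>set ys. snd p *v b k \<noteq> b k"
  have "\<exists>j\<in>set ys. snd p *v b k = b j" if "p \<in> set (swap_schedule b a t xs ys)" "k \<in> set ys" for p k
    using that branch_pulses_closed(1)[OF Y, of p k] ys_fixed ys_lt unfolding set_schedule by blast
  then have "pulsed (free h) 0 (swap_schedule b a t xs ys) t *v b (hd ys) =
      pulsed (free h) 0 (filter ?F (swap_schedule b a t xs ys)) t *v b (hd ys)"
    by (rule pulsed_filter[OF ys_lt]) (use ys_ne in auto)
  also have "filter ?F (branch_pulses b a t ys) = branch_pulses b a t ys"
    using branch_pulses_closed(2)[OF Y _ ends_lt(1)] by (simp add: filter_id_conv)
  moreover have "filter ?F (branch_pulses b a t xs) = []"
    using ys_fixed by (simp add: filter_empty_conv)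
  ultimately have "pulsed (free h) 0 (swap_schedule b a t xs ys) t *v b (hd ys) =
      pulsed (free h) 0 (branch_pulses b a t ys) t *v b (hd ys)"
    by (simp add: swap_schedule_def filter_sort sort_key_id_if_sorted sorted_branch_pulses[OF Y])
  then show ?thesis using branch_evolution[OF Y] by simp
qed

theorem swap_state_eq:
  assumes H: "hermitian H"
  defines "\<Phi> \<equiv> 2 * t / (\<Sum>k<CARD('n). \<bar>a k\<bar>) * Re (trace (diag_op (\<lambda>k. complex_of_real (a k)) ** H))"
  shows "\<exists>\<omega>. swap_state b a t xs ys H = cis \<omega> *s ((1 / sqrt 2) *\<^sub>R (b (last xs) + cis \<Phi> *s b (last ys)))"
proof -
  define h where "h k = Re (braket (b k) (H *v b k))" for k
  let ?fx = "(\<Sum>z\<in>set xs. a z * h z) * t / (\<Sum>z\<in>set xs. a z)"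
  let ?fy = "(\<Sum>z\<in>set ys. a z * h z) * t / (\<Sum>z\<in>set ys. a z)"
  have ev: "evol (diag_part b H) = free h"
    by (rule ext) (simp add: diag_part_hermitian[OF H] evol_diag_op h_def)
  have "Re (trace (diag_op (\<lambda>k. complex_of_real (a k)) ** H)) = (\<Sum>k<CARD('n). a k * h k)"
    by (simp add: trace_diag_op_mult h_def)
  also have "\<dots> = (\<Sum>k\<in>set xs. a k * h k) + (\<Sum>k\<in>set ys. a k * h k)" by (rule split_sum) simp
  \<comment> \<open>The two normalizing totals are opposite, so the difference of the two weighted
    means becomes a single sum over both signs.\<close>
  finally have \<Phi>: "\<Phi> = ?fx - ?fy"
    unfolding \<Phi>_def sum_xs sum_ys using tn_pos by (simp add: field_simps)
  have "swap_state b a t xs ys H = (1 / sqrt 2) *\<^sub>R (cis (- ?fx) *s b (last xs) + cis (- ?fy) *s b (last ys))"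
    by (simp add: swap_state_def initial_state_def ev mv_scaleR matrix_vector_right_distrib
        schedule_xs schedule_ys)
  also have "\<dots> = cis (- ?fx) *s ((1 / sqrt 2) *\<^sub>R (b (last xs) + cis \<Phi> *s b (last ys)))"
    by (simp add: vec_eq_iff \<Phi> cis_mult[symmetric] cis_divide[symmetric] algebra_simps cis_inverse[symmetric] field_simps)
  finally show ?thesis by blast
qed

end

section \<open>The swap protocol with randomized free evolutions\<close>

text \<open>Convergence in probability with one \<open>\<epsilon>\<close> for both the error and the
  failure probability, so that halving a single number handles a product of two factors.\<close>

definition conv_in_prob :: "(nat \<Rightarrow> 'n::finite cmat pmf) \<Rightarrow> 'n cmat \<Rightarrow> bool" where
  "conv_in_prob P A \<longleftrightarrow>
    (\<forall>\<epsilon>>0. \<forall>\<^sub>F L in sequentially. measure_pmf.prob (P L) {V. spectral_norm (A - V) \<le> \<epsilon>} \<ge> 1 - \<epsilon>)"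

lemma (in onb) reshaped_evol_conv:
  assumes H: "hermitian H" and N: "CARD('n) \<ge> 2"
  shows "conv_in_prob (\<lambda>L. reshaped_evol b H L \<tau>) (evol (diag_part b H) \<tau>)"
  unfolding conv_in_prob_def
proof (intro allI impI)
  fix \<epsilon> :: real assume \<epsilon>: "\<epsilon> > 0"
  let ?N = "real CARD('n)"
  \<comment> \<open>\<open>c\<close> is large enough for the failure probability
    \<open>N powr (- c)\<close> to drop below \<open>\<epsilon>\<close>; this is where
    \<open>N \<ge> 2\<close> enters.\<close>
  define c where "c = max 1 (ln (1 / \<epsilon>) / ln ?N)"
  have lnN: "ln ?N > 0" using N by simp
  have "ln (1 / \<epsilon>) \<le> c * ln ?N" using lnN by (simp add: c_def pos_divide_le_eq[symmetric])
  then have "- c * ln ?N \<le> ln \<epsilon>" using \<epsilon> by (simp add: ln_div)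
  then have "?N powr (- c) \<le> exp (ln \<epsilon>)" unfolding powr_def using N by simp
  then have p: "?N powr (- c) \<le> \<epsilon>" using \<epsilon> by simp
  let ?B = "10 ^ 4 * c * (ln ?N * (spectral_norm H)\<^sup>2 * \<tau>\<^sup>2 / \<epsilon>\<^sup>2)"
  show "\<forall>\<^sub>F L in sequentially. measure_pmf.prob (reshaped_evol b H L \<tau>)
      {V. spectral_norm (evol (diag_part b H) \<tau> - V) \<le> \<epsilon>} \<ge> 1 - \<epsilon>"
    using eventually_ge_at_top[of "nat \<lceil>?B\<rceil> + 1"]
  proof eventually_elim
    case (elim L)
    then have "real L \<ge> ?B" by linarith
    then show ?case
      using reshaping_error[OF H, of c \<epsilon> L \<tau>] \<epsilon> elim p by (simp add: c_def)
  qed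
qed

lemma random_pulsed_Cons:
  "random_pulsed E s ((r, S) # ps) T =
    map_pmf (\<lambda>(V, W). W ** S ** V) (pair_pmf (E (r - s)) (random_pulsed E r ps T))"
  by (simp add: pair_pmf_def map_bind_pmf map_pmf_def bind_assoc_pmf bind_return_pmf)

text \<open>Errors of two factors add without amplification because all factors are unitary, and
  failure probabilities add by the union bound. Unitarity is therefore carried along in the
  induction over the pulses.\<close>

lemma random_pulsed_conv:
  fixes E :: "nat \<Rightarrow> real \<Rightarrow> 'n::finite cmat pmf" and F :: "real \<Rightarrow> 'n cmat"
  assumes E: "\<And>\<tau>. conv_in_prob (\<lambda>L. E L \<tau>) (F \<tau>)"
    and uE: "\<And>L \<tau> V. V \<in> set_pmf (E L \<tau>) \<Longrightarrow> unitary V" and uF: "\<And>\<tau>. unitary (F \<tau>)"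
    and uS: "\<And>p. p \<in> set ps \<Longrightarrow> unitary (snd p)"
  shows "conv_in_prob (\<lambda>L. random_pulsed (E L) s ps T) (pulsed F s ps T)
    \<and> (\<forall>L. \<forall>V\<in>set_pmf (random_pulsed (E L) s ps T). unitary V) \<and> unitary (pulsed F s ps T)"
  using uS
proof (induction ps arbitrary: s)
  case Nil then show ?case using E uE uF by simp
next
  case (Cons p ps)
  obtain r S where p: "p = (r, S)" by (cases p)
  have uS: "unitary S" using Cons.prems[of p] by (simp add: p)
  have IH: "conv_in_prob (\<lambda>L. random_pulsed (E L) r ps T) (pulsed F r ps T)"
    "\<And>L V. V \<in> set_pmf (random_pulsed (E L) r ps T) \<Longrightarrow> unitary V" "unitary (pulsed F r ps T)"
    using Cons.IH[of r] Cons.prems by auto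
  have "unitary (pulsed F s (p # ps) T)" by (simp add: p unitary_mult IH uS uF)
  moreover have "\<forall>L. \<forall>V\<in>set_pmf (random_pulsed (E L) s (p # ps) T). unitary V"
    unfolding p random_pulsed_Cons using IH(2) uE uS by (auto intro!: unitary_mult)
  moreover have "conv_in_prob (\<lambda>L. random_pulsed (E L) s (p # ps) T) (pulsed F s (p # ps) T)"
    unfolding conv_in_prob_def
  proof (intro allI impI)
    fix \<epsilon> :: real assume \<epsilon>: "\<epsilon> > 0"
    let ?A = "{V. spectral_norm (F (r - s) - V) \<le> \<epsilon> / 2}"
    let ?B = "{W. spectral_norm (pulsed F r ps T - W) \<le> \<epsilon> / 2}"
    have 1: "\<forall>\<^sub>F L in sequentially. measure_pmf.prob (E L (r - s)) ?A \<ge> 1 - \<epsilon> / 2"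
      using E[of "r - s"] \<epsilon> half_gt_zero unfolding conv_in_prob_def by blast
    have 2: "\<forall>\<^sub>F L in sequentially. measure_pmf.prob (random_pulsed (E L) r ps T) ?B \<ge> 1 - \<epsilon> / 2"
      using IH(1) \<epsilon> half_gt_zero unfolding conv_in_prob_def by blast
    from 1 2 show "\<forall>\<^sub>F L in sequentially. measure_pmf.prob (random_pulsed (E L) s (p # ps) T)
        {V. spectral_norm (pulsed F s (p # ps) T - V) \<le> \<epsilon>} \<ge> 1 - \<epsilon>"
    proof eventually_elim
      case (elim L)
      let ?P = "pair_pmf (E L (r - s)) (random_pulsed (E L) r ps T)"
      let ?G = "{VW. spectral_norm (pulsed F s (p # ps) T - snd VW ** S ** fst VW) \<le> \<epsilon>}"
      have PA: "measure_pmf.prob ?P {VW. fst VW \<in> - ?A} \<le> \<epsilon> / 2"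
      proof -
        have "measure_pmf.prob ?P {VW. fst VW \<in> - ?A} = measure_pmf.prob (map_pmf fst ?P) (- ?A)"
          by (simp add: vimage_def)
        also have "\<dots> = 1 - measure_pmf.prob (E L (r - s)) ?A"
          unfolding map_fst_pair_pmf using measure_pmf.prob_compl[of ?A "E L (r - s)"]
          by (simp add: Compl_eq_Diff_UNIV)
        finally show ?thesis using elim by simp
      qed
      have PB: "measure_pmf.prob ?P {VW. snd VW \<in> - ?B} \<le> \<epsilon> / 2"
      proof -
        have "measure_pmf.prob ?P {VW. snd VW \<in> - ?B} = measure_pmf.prob (map_pmf snd ?P) (- ?B)"
          by (simp add: vimage_def)
        also have "\<dots> = 1 - measure_pmf.prob (random_pulsed (E L) r ps T) ?B"
          unfolding map_snd_pair_pmf using measure_pmf.prob_compl[of ?B "random_pulsed (E L) r ps T"]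
          by (simp add: Compl_eq_Diff_UNIV)
        finally show ?thesis using elim by simp
      qed
      have good: "VW \<in> ?G \<union> {VW. fst VW \<in> - ?A} \<union> {VW. snd VW \<in> - ?B}" if VW: "VW \<in> set_pmf ?P" for VW
      proof -
        obtain V W where vw: "VW = (V, W)" by (cases VW)
        have uW: "unitary W" using VW IH(2) by (auto simp: vw)
        have "spectral_norm (pulsed F s (p # ps) T - W ** S ** V) \<le> \<epsilon>" if "V \<in> ?A" "W \<in> ?B"
        proof -
          let ?G = "pulsed F r ps T"
          have "pulsed F s (p # ps) T - W ** S ** V = (?G - W) ** (S ** F (r - s)) + (W ** S) ** (F (r - s) - V)"
            by (simp add: p mult_diff_left mult_diff_right matrix_mul_assoc)
          then have "spectral_norm (pulsed F s (p # ps) T - W ** S ** V) \<le>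
              spectral_norm (?G - W) * spectral_norm (S ** F (r - s)) + spectral_norm ((W ** S) ** (F (r - s) - V))"
            by (simp only:) (rule order_trans[OF spectral_norm_triangle add_right_mono[OF spectral_norm_mult]])
          also have "\<dots> = spectral_norm (?G - W) * spectral_norm (S ** F (r - s)) + spectral_norm (F (r - s) - V)"
            by (simp only: spectral_norm_unitary_mult[OF unitary_mult[OF uW uS]])
          also have "\<dots> \<le> (\<epsilon> / 2) * 1 + \<epsilon> / 2"
            using that \<epsilon>
            by (intro add_mono mult_mono unitary_spectral_norm unitary_mult uS uF spectral_norm_nonneg) auto
          finally show ?thesis by simp
        qed
        then show ?thesis by (auto simp: vw)
      qed
      have "1 = measure_pmf.prob ?P (?G \<union> {VW. fst VW \<in> - ?A} \<union> {VW. snd VW \<in> - ?B})"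
        using good by (subst measure_pmf.prob_eq_1[THEN iffD2]) (auto simp: AE_measure_pmf_iff)
      also have "\<dots> \<le> measure_pmf.prob ?P ?G + measure_pmf.prob ?P {VW. fst VW \<in> - ?A} + measure_pmf.prob ?P {VW. snd VW \<in> - ?B}"
        using measure_Un_le[of ?G "measure_pmf ?P" "{VW. fst VW \<in> - ?A}"]
          measure_Un_le[of "?G \<union> {VW. fst VW \<in> - ?A}" "measure_pmf ?P" "{VW. snd VW \<in> - ?B}"]
        by simp
      finally have "1 - \<epsilon> \<le> measure_pmf.prob ?P ?G" using PA PB by simp
      also have "measure_pmf.prob ?P ?G = measure_pmf.prob (random_pulsed (E L) s (p # ps) T)
        {V. spectral_norm (pulsed F s (p # ps) T - V) \<le> \<epsilon>}"
        unfolding p random_pulsed_Cons by (simp add: vimage_def case_prod_unfold)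
      finally show ?case .
    qed
  qed
  ultimately show ?case by blast
qed

section \<open>Spectral measurements and the interference observable\<close>

section \<open>Measuring an observable\<close>

text \<open>Settles the definite description in \<open>observable\<close>: of two orthogonal
  projections with the same range each acts as the identity on the other from the left, and taking
  adjoints makes them equal.\<close>

lemma (in onb) observable_eq:
  assumes M: "M = diag_op (\<lambda>k. complex_of_real (m k))"
  shows "observable M x = diag_op (\<lambda>k. if m k = x then 1 else 0)"
proof -
  define P where "P = diag_op (\<lambda>k. if m k = x then 1 else 0)"
  have hP: "hermitian P"
    unfolding hermitian_def P_def dagger_diag_op by (rule diag_op_cong) simp
  have PP: "P ** P = P" unfolding P_def diag_op_mult by (rule diag_op_cong) simp
  have MP: "M ** P = cscale (complex_of_real x) P"
    unfolding P_def M diag_op_mult diag_op_cscale by (rule diag_op_cong) simp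
  have rng: "range (\<lambda>v. P *v v) = {v. M *v v = complex_of_real x *s v}"
  proof (intro equalityI subsetI)
    fix v assume "v \<in> range (\<lambda>v. P *v v)"
    then obtain w where "v = P *v w" by blast
    then show "v \<in> {v. M *v v = complex_of_real x *s v}"
      by (simp add: matrix_vector_mul_assoc MP cscale_mv)
  next
    fix v assume v: "v \<in> {v. M *v v = complex_of_real x *s v}"
    have "P *v v = v"
    proof (rule vec_eqI)
      fix k assume k: "k < CARD('n)"
      have "complex_of_real (m k) * braket (b k) v = braket (b k) (M *v v)"
        by (simp add: M braket_diag_op[OF k])
      also have "\<dots> = complex_of_real x * braket (b k) v" using v by simp
      finally have "complex_of_real (m k) * braket (b k) v = complex_of_real x * braket (b k) v" .
      then have "m k = x \<or> braket (b k) v = 0" by (metis mult_right_cancel of_real_eq_iff)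
      then show "braket (b k) (P *v v) = braket (b k) v" using k by (auto simp: P_def braket_diag_op)
    qed
    then show "v \<in> range (\<lambda>v. P *v v)" by (metis rangeI)
  qed
  have "observable M x = P" unfolding observable_def
  proof (rule the_equality)
    fix R assume R: "hermitian R \<and> R ** R = R \<and> range (\<lambda>v. R *v v) = {v. M *v v = complex_of_real x *s v}"
    have id: "S ** T = T" if S: "S ** S = S" and ST: "range (\<lambda>v. S *v v) = range (\<lambda>v. T *v v)" for S T :: "'n cmat"
    proof (rule mat_eqI_braket)
      fix v
      have "T *v v \<in> range (\<lambda>v. S *v v)" unfolding ST by simp
      then obtain w where "T *v v = S *v w" by blast
      then show "(S ** T) *v v = T *v v" by (metis matrix_vector_mul_assoc S)
    qed
    have "R ** P = P" "P ** R = R" using R rng PP by (auto intro!: id)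
    then show "R = P" using R hP by (metis dagger_mult hermitian_def)
  qed (use hP PP rng in blast)
  then show ?thesis by (simp add: P_def)
qed

lemma (in onb) observable_support:
  assumes M: "M = diag_op (\<lambda>k. complex_of_real (m k))"
  shows "{x. observable M x \<noteq> 0} = m ` {..<CARD('n)}"
proof (intro equalityI subsetI)
  fix x assume x: "x \<in> {x. observable M x \<noteq> 0}"
  show "x \<in> m ` {..<CARD('n)}"
  proof (rule ccontr)
    assume "x \<notin> m ` {..<CARD('n)}"
    then have "observable M x = diag_op (\<lambda>k. 0)"
      unfolding observable_eq[OF M] by (intro diag_op_cong) auto
    then show False using x by (simp add: diag_op_def)
  qed
next
  fix x assume "x \<in> m ` {..<CARD('n)}"
  then obtain k where k: "k < CARD('n)" "x = m k" by blast
  then have "observable M x *v b k = b k" by (simp add: observable_eq[OF M] diag_op_basis)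
  then show "x \<in> {x. observable M x \<noteq> 0}" using basis_nonzero[OF k(1)] by auto
qed

text \<open>The sum runs over distinct outcomes, and coinciding values \<open>m k\<close> share one
  projection; the result is the function \<open>F\<close> of the observable.\<close>

lemma (in onb) sum_observable:
  assumes M: "M = diag_op (\<lambda>k. complex_of_real (m k))"
  shows "(\<Sum>x\<in>{x. observable M x \<noteq> 0}. cscale (complex_of_real (F x)) (observable M x)) =
    diag_op (\<lambda>k. complex_of_real (F (m k)))"
proof (rule mat_eqI)
  fix k assume k: "k < CARD('n)"
  have "(\<Sum>x\<in>m ` {..<CARD('n)}. cscale (complex_of_real (F x)) (observable M x)) *v b k =
      (\<Sum>x\<in>m ` {..<CARD('n)}. if x = m k then complex_of_real (F (m k)) *s b k else 0)"
    unfolding sum_mv observable_eq[OF M] by (rule sum.cong) (auto simp: cscale_mv diag_op_basis k)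
  also have "\<dots> = complex_of_real (F (m k)) *s b k" using k by simp
  finally show "(\<Sum>x\<in>{x. observable M x \<noteq> 0}. cscale (complex_of_real (F x)) (observable M x)) *v b k =
    diag_op (\<lambda>k. complex_of_real (F (m k))) *v b k"
    unfolding observable_support[OF M] using k by (simp add: diag_op_basis)
qed

lemma povm_observable:
  fixes M :: "'n::finite cmat"
  assumes "hermitian M" shows "povm (observable M)"
proof -
  obtain b m where d: "diagonalizes b m M" using spectral_theorem assms by metis
  interpret onb b using diagonalizes_onb d .
  have M: "M = diag_op (\<lambda>k. complex_of_real (m k))" using d by (simp add: diagonalizes_iff)
  have "finite {x. observable M x \<noteq> 0}" unfolding observable_support[OF M] by simp
  moreover have "psd (observable M x)" for x
  proof -
    have "diag_op (\<lambda>k. if m k = x then 1 else 0) = diag_op (\<lambda>k. complex_of_real (if m k = x then 1 else 0))"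
      by (rule diag_op_cong) simp
    then show ?thesis unfolding observable_eq[OF M] by (simp only:) (rule psd_diag_op, simp)
  qed
  moreover have "(\<Sum>x\<in>{x. observable M x \<noteq> 0}. observable M x) = mat 1"
    using sum_observable[OF M, of "\<lambda>_. 1"] by (simp add: diag_op_1)
  ultimately show ?thesis by (simp add: povm_def)
qed

text \<open>The mean and the squared deviation of an affine estimator are quadratic in the outcome,
  so the traces against \<open>1\<close>, \<open>M\<close> and \<open>M ** M\<close> determine
  both.\<close>

lemma observable_quadratic:
  fixes M \<rho> :: "'n::finite cmat"
  assumes "hermitian M"
  shows "(\<Sum>x\<in>{x. observable M x \<noteq> 0}. (u + w * x + v * x\<^sup>2) * Re (trace (\<rho> ** observable M x))) =
    u * Re (trace \<rho>) + w * Re (trace (\<rho> ** M)) + v * Re (trace (\<rho> ** (M ** M)))"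
proof -
  obtain b m where d: "diagonalizes b m M" using spectral_theorem assms by metis
  interpret onb b using diagonalizes_onb d .
  have M: "M = diag_op (\<lambda>k. complex_of_real (m k))" using d by (simp add: diagonalizes_iff)
  let ?F = "\<lambda>x. u + w * x + v * x\<^sup>2"
  have "(\<Sum>x\<in>{x. observable M x \<noteq> 0}. ?F x * Re (trace (\<rho> ** observable M x))) =
      Re (trace (\<rho> ** (\<Sum>x\<in>{x. observable M x \<noteq> 0}. cscale (complex_of_real (?F x)) (observable M x))))"
    by (simp add: mult_sum_right cscale_mult_right trace_sum trace_cscale flip: of_real_power of_real_mult of_real_add)
  also have "(\<Sum>x\<in>{x. observable M x \<noteq> 0}. cscale (complex_of_real (?F x)) (observable M x)) =
      diag_op (\<lambda>k. complex_of_real (?F (m k)))" by (rule sum_observable[OF M])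
  also have "\<dots> = cscale (complex_of_real u) (mat 1) + cscale (complex_of_real w) M + cscale (complex_of_real v) (M ** M)"
    unfolding M diag_op_mult diag_op_1[symmetric] diag_op_cscale diag_op_add
    by (rule diag_op_cong) (simp add: power2_eq_square)
  finally show ?thesis
    by (simp add: matrix_add_ldistrib cscale_mult_right trace_add trace_cscale)
qed

lemma pure_trace: "trace (ketbra \<psi> \<psi> ** X) = braket \<psi> (X *v \<psi>)"
  by (simp add: trace_mul_sym[of _ X] trace_mult_ketbra)

lemma est_mean_affine:
  fixes M :: "'n::finite cmat"
  assumes "hermitian M" "norm \<psi> = 1"
  shows "est_mean (observable M) (\<lambda>x. u + w * x) (ketbra \<psi> \<psi>) = u + w * Re (braket \<psi> (M *v \<psi>))"
  using observable_quadratic[OF assms(1), of u w 0 "ketbra \<psi> \<psi>"] assms(2)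
  by (simp add: est_mean_def pure_trace trace_ketbra braket_self)

lemma est_var_affine:
  fixes M :: "'n::finite cmat"
  assumes "hermitian M" "norm \<psi> = 1"
  shows "est_var (observable M) (\<lambda>x. u + w * x) (ketbra \<psi> \<psi>) =
    w\<^sup>2 * ((norm (M *v \<psi>))\<^sup>2 - (Re (braket \<psi> (M *v \<psi>)))\<^sup>2)"
proof -
  let ?m = "Re (braket \<psi> (M *v \<psi>))"
  have sq: "(u + w * x - (u + w * ?m))\<^sup>2 = (w * ?m)\<^sup>2 + (- 2 * w\<^sup>2 * ?m) * x + w\<^sup>2 * x\<^sup>2" for x
    by (simp add: power2_eq_square algebra_simps)
  have "Re (braket \<psi> (M *v (M *v \<psi>))) = (norm (M *v \<psi>))\<^sup>2"
    using assms(1) by (subst braket_mv) (simp add: hermitian_def braket_self)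
  then show ?thesis
    unfolding est_var_def est_mean_affine[OF assms] sq observable_quadratic[OF assms(1)]
    using assms(2)
    by (simp add: pure_trace trace_ketbra braket_self matrix_vector_mul_assoc[symmetric] del: matrix_vector_mul_assoc)
      (simp add: power2_eq_square algebra_simps)
qed

text \<open>On the span of \<open>b x\<close> and \<open>b y\<close> the operator \<open>M\<close>
  squares to the identity, so the second moment of the outcome is one and its variance is the
  squared cosine of \<open>\<Phi>\<close>. The global phase disappears in
  \<open>cnj c * c\<close>.\<close>

lemma (in onb) interference_measurement:
  fixes x y :: nat and \<omega> \<Phi> :: real
  assumes x: "x < CARD('n)" and y: "y < CARD('n)" and xy: "x \<noteq> y"
  defines "M \<equiv> cscale \<i> (ketbra (b x) (b y)) + dagger (cscale \<i> (ketbra (b x) (b y)))"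
    and "\<psi> \<equiv> cis \<omega> *s ((1 / sqrt 2) *\<^sub>R (b x + cis \<Phi> *s b y))"
  shows "norm \<psi> = 1" "Re (braket \<psi> (M *v \<psi>)) = - sin \<Phi>" "norm (M *v \<psi>) = 1"
proof -
  have bb: "braket (b x) (b x) = 1" "braket (b y) (b y) = 1" "braket (b x) (b y) = 0" "braket (b y) (b x) = 0"
    using braket_basis x y xy by auto
  define c where "c = cis \<omega> * complex_of_real (1 / sqrt 2)"
  have \<psi>: "\<psi> = c *s (b x + cis \<Phi> *s b y)"
    by (simp add: \<psi>_def c_def vec_eq_iff scaleR_conv_of_real[where 'a=complex] field_simps)
  have cc: "cnj c * c = 1 / 2"
  proof -
    have "cnj c * c = (cnj (cis \<omega>) * cis \<omega>) * complex_of_real (1 / sqrt 2 * (1 / sqrt 2))"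
      by (simp only: c_def complex_cnj_mult complex_cnj_complex_of_real of_real_mult mult_ac)
    also have "cnj (cis \<omega>) * cis \<omega> = 1" by (simp add: cis_cnj cis_mult)
    also have "1 / sqrt 2 * (1 / sqrt 2) = (1 / 2 :: real)" by simp
    finally show ?thesis by simp
  qed
  have nrm: "norm v = 1" if "braket v v = 1" for v :: "'n cvec"
  proof -
    have "complex_of_real ((norm v)\<^sup>2) = complex_of_real 1" using that by (simp add: braket_self)
    then have "(norm v)\<^sup>2 = 1" using of_real_eq_iff by blast
    then show ?thesis using power2_eq_imp_eq[of "norm v" 1] by simp
  qed
  have c\<Phi>: "cnj (cis \<Phi>) * cis \<Phi> = 1" by (simp add: cis_cnj cis_mult)
  have "braket \<psi> \<psi> = (cnj c * c) * (1 + cnj (cis \<Phi>) * cis \<Phi>)"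
    unfolding \<psi> by (simp add: braket_add_left braket_add_right braket_diff_left braket_diff_right bb algebra_simps)
  then show "norm \<psi> = 1" unfolding cc c\<Phi> by (intro nrm) simp
  have M\<psi>: "M *v \<psi> = c *s ((\<i> * cis \<Phi>) *s b x + (- \<i>) *s b y)"
    unfolding \<psi> M_def
    by (simp add: matrix_vector_mult_add_rdistrib cscale_mv dagger_cscale dagger_ketbra ketbra_mv braket_add_right bb vec_eq_iff algebra_simps)
  have "braket (M *v \<psi>) (M *v \<psi>) = (cnj c * c) * (cnj (cis \<Phi>) * cis \<Phi> + 1)"
    unfolding M\<psi> by (simp add: braket_add_left braket_add_right braket_diff_left braket_diff_right bb algebra_simps)
  then show "norm (M *v \<psi>) = 1" unfolding cc c\<Phi> by (intro nrm) simp
  have "braket \<psi> (M *v \<psi>) = (cnj c * c) * (\<i> * cis \<Phi> + (- \<i>) * cnj (cis \<Phi>))"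
    unfolding M\<psi> by (subst \<psi>) (simp add: braket_add_left braket_add_right braket_diff_left braket_diff_right bb algebra_simps)
  then have "Re (braket \<psi> (M *v \<psi>)) = Re (1 / 2 * (\<i> * cis \<Phi> + (- \<i>) * cnj (cis \<Phi>)))"
    unfolding cc by (rule arg_cong)
  also have "\<dots> = - sin \<Phi>" by simp
  finally show "Re (braket \<psi> (M *v \<psi>)) = - sin \<Phi>" .
qed

lemma expectation_value_lipschitz:
  fixes M :: "'n::finite cmat"
  assumes "norm \<psi> = 1" "norm \<phi> = 1"
  shows "\<bar>Re (braket \<psi> (M *v \<psi>)) - Re (braket \<phi> (M *v \<phi>))\<bar> \<le> 2 * spectral_norm M * norm (\<psi> - \<phi>)"
proof -
  have "braket \<psi> (M *v \<psi>) - braket \<phi> (M *v \<phi>) = braket (\<psi> - \<phi>) (M *v \<psi>) + braket \<phi> (M *v (\<psi> - \<phi>))"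
    by (simp add: braket_diff_left braket_diff_right matrix_vector_mult_diff_distrib)
  then have "\<bar>Re (braket \<psi> (M *v \<psi>)) - Re (braket \<phi> (M *v \<phi>))\<bar> \<le>
      cmod (braket (\<psi> - \<phi>) (M *v \<psi>) + braket \<phi> (M *v (\<psi> - \<phi>)))"
    using abs_Re_le_cmod by (metis minus_complex.sel(1))
  also have "\<dots> \<le> cmod (braket (\<psi> - \<phi>) (M *v \<psi>)) + cmod (braket \<phi> (M *v (\<psi> - \<phi>)))"
    by (rule norm_triangle_ineq)
  also have "\<dots> \<le> spectral_norm M * norm (\<psi> - \<phi>) * norm \<psi> + spectral_norm M * norm \<phi> * norm (\<psi> - \<phi>)"
    by (intro add_mono norm_braket_mv_le)
  finally show ?thesis using assms by simp
qed

section \<open>The lower bound: perturbation of controlled evolutions and sensitivity of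
  estimators\<close>

section \<open>Controlled evolutions\<close>

lemma bounded_bilinear_cscale: "bounded_bilinear (cscale :: complex \<Rightarrow> 'n::finite cmat \<Rightarrow> 'n cmat)"
  unfolding bilinear_conv_bounded_bilinear[symmetric] bilinear_def
  by (auto intro!: linearI simp: cscale_add_right cscale_add_left vec_eq_iff mat_nth scaleR_conv_of_real[where 'a=complex])

lemma bounded_linear_dagger: "bounded_linear (dagger :: 'n::finite cmat \<Rightarrow> 'n cmat)"
  unfolding linear_conv_bounded_linear[symmetric]
  by (auto intro!: linearI simp: dagger_add dagger_scaleR)

lemma bounded_linear_mv_left: "bounded_linear (\<lambda>A :: 'n::finite cmat. A *v v)"
  unfolding linear_conv_bounded_linear[symmetric]
  by (auto intro!: linearI simp: matrix_vector_mult_add_rdistrib scaleR_mv)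

lemma unitary_if_left_inverse: "dagger U ** U = mat 1 \<Longrightarrow> unitary (U :: 'n::finite cmat)"
  by (simp add: unitary_def matrix_left_right_inverse)

text \<open>For a Hermitian generator the two terms in the derivative of
  \<open>dagger (U s) ** U s\<close> cancel, so this product keeps its initial value.\<close>

lemma hermitian_flow_unitary:
  fixes U G :: "real \<Rightarrow> 'd::finite cmat"
  assumes U0: "U 0 = mat 1" and G: "\<And>s. s \<in> {0..\<tau>} \<Longrightarrow> hermitian (G s)"
    and U: "\<And>s. s \<in> {0..\<tau>} \<Longrightarrow> (U has_vector_derivative cscale (- \<i>) (G s ** U s)) (at s within {0..\<tau>})"
    and s: "s \<in> {0..\<tau>}"
  shows "unitary (U s)"
proof -
  have "((\<lambda>s. dagger (U s) ** U s) has_vector_derivative 0) (at s within {0..\<tau>})" if s: "s \<in> {0..\<tau>}" for s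
  proof -
    have "((\<lambda>s. dagger (U s) ** U s) has_vector_derivative
        dagger (U s) ** cscale (- \<i>) (G s ** U s) + dagger (cscale (- \<i>) (G s ** U s)) ** U s) (at s within {0..\<tau>})"
      by (intro bounded_bilinear.has_vector_derivative[OF bounded_bilinear_mmult]
          bounded_linear.has_vector_derivative[OF bounded_linear_dagger] U s)
    moreover have "dagger (U s) ** cscale (- \<i>) (G s ** U s) + dagger (cscale (- \<i>) (G s ** U s)) ** U s = 0"
      using G[OF s]
      by (simp add: dagger_cscale dagger_mult hermitian_def cscale_mult_left cscale_mult_right matrix_mul_assoc
          cscale_add_left[symmetric])
    ultimately show ?thesis by simp
  qed
  then obtain c where c: "\<And>s. s \<in> {0..\<tau>} \<Longrightarrow> dagger (U s) ** U s = c"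
    using has_vector_derivative_zero_constant[of "{0..\<tau>}" "\<lambda>s. dagger (U s) ** U s"] by auto
  have "dagger (U s) ** U s = dagger (U 0) ** U 0" using c[OF s] c[of 0] s by auto
  then show ?thesis by (intro unitary_if_left_inverse) (simp add: U0)
qed

text \<open>Duhamel's formula: \<open>U\<^sup>\<dagger> U'\<close> is differentiated; the phase absorbs the multiple of the identity.\<close>

lemma hermitian_flow_perturbation:
  fixes U U' G G' :: "real \<Rightarrow> 'd::finite cmat" and c \<tau> :: real
  assumes \<tau>: "0 \<le> \<tau>"
    and U0: "U 0 = mat 1" "U' 0 = mat 1"
    and G: "\<And>s. s \<in> {0..\<tau>} \<Longrightarrow> hermitian (G s)" "\<And>s. s \<in> {0..\<tau>} \<Longrightarrow> hermitian (G' s)"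
    and U: "\<And>s. s \<in> {0..\<tau>} \<Longrightarrow> (U has_vector_derivative cscale (- \<i>) (G s ** U s)) (at s within {0..\<tau>})"
    and U': "\<And>s. s \<in> {0..\<tau>} \<Longrightarrow> (U' has_vector_derivative cscale (- \<i>) (G' s ** U' s)) (at s within {0..\<tau>})"
    and \<kappa>: "\<And>s. s \<in> {0..\<tau>} \<Longrightarrow> spectral_norm (G' s - G s - cscale (complex_of_real c) (mat 1)) \<le> \<kappa>"
  shows "spectral_norm (cscale (cis (c * \<tau>)) (U' \<tau>) - U \<tau>) \<le> \<kappa> * \<tau>"
proof -
  define e where "e s = exp (s *\<^sub>R (\<i> * complex_of_real c))" for s
  have e: "e s = cis (c * s)" for s by (simp add: e_def cis_conv_exp scaleR_conv_of_real mult_ac)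
  have de: "(e has_vector_derivative e s * (\<i> * complex_of_real c)) (at s within {0..\<tau>})" for s
    unfolding e_def by (rule exp_scaleR_has_vector_derivative_right)
  have uU: "unitary (U s)" and uU': "unitary (U' s)" if "s \<in> {0..\<tau>}" for s
    using hermitian_flow_unitary[of U \<tau> G s] hermitian_flow_unitary[of U' \<tau> G' s] U0 G U U' that by blast+
  define Y where "Y s = cscale (e s) (dagger (U s) ** U' s)" for s
  define Y' where "Y' s = cscale (e s * (- \<i>)) (dagger (U s) ** (G' s - G s - cscale (complex_of_real c) (mat 1)) ** U' s)" for s
  have dY: "(Y has_vector_derivative Y' s) (at s within {0..\<tau>})" if s: "s \<in> {0..\<tau>}" for s
  proof -
    have "(Y has_vector_derivative
        cscale (e s) (dagger (U s) ** cscale (- \<i>) (G' s ** U' s) + dagger (cscale (- \<i>) (G s ** U s)) ** U' s)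
        + cscale (e s * (\<i> * complex_of_real c)) (dagger (U s) ** U' s)) (at s within {0..\<tau>})"
      unfolding Y_def
      by (intro bounded_bilinear.has_vector_derivative[OF bounded_bilinear_cscale]
          bounded_bilinear.has_vector_derivative[OF bounded_bilinear_mmult]
          bounded_linear.has_vector_derivative[OF bounded_linear_dagger] U U' de s)
    moreover have "cscale (e s) (dagger (U s) ** cscale (- \<i>) (G' s ** U' s) + dagger (cscale (- \<i>) (G s ** U s)) ** U' s)
        + cscale (e s * (\<i> * complex_of_real c)) (dagger (U s) ** U' s) = Y' s"
      using G(1)[OF s]
      by (simp add: Y'_def dagger_cscale dagger_mult hermitian_def cscale_mult_left cscale_mult_right matrix_mul_assoc
          cscale_cscale mult_diff_left mult_diff_right cscale_diff_right cscale_add_right mult.assoc)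
        (simp add: cscale_uminus_left)
    ultimately show ?thesis by simp
  qed
  have Y'n: "spectral_norm (Y' s) \<le> \<kappa>" if s: "s \<in> {0..\<tau>}" for s
  proof -
    let ?X = "G' s - G s - cscale (complex_of_real c) (mat 1)"
    have "spectral_norm (Y' s) \<le> spectral_norm (dagger (U s) ** ?X ** U' s)"
      using spectral_norm_cscale[of "e s * (- \<i>)" "dagger (U s) ** ?X ** U' s"]
      by (simp add: Y'_def e norm_mult)
    also have "\<dots> \<le> spectral_norm (dagger (U s) ** ?X) * spectral_norm (U' s)" by (rule spectral_norm_mult)
    also have "\<dots> \<le> spectral_norm ?X * 1"
      by (intro mult_mono unitary_spectral_norm uU' s)
        (simp_all add: spectral_norm_unitary_mult[OF unitary_dagger[OF uU[OF s]]] spectral_norm_nonneg)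
    finally show ?thesis using \<kappa>[OF s] by simp
  qed
  have \<kappa>0: "0 \<le> \<kappa>" using \<kappa>[of 0] \<tau> spectral_norm_nonneg order_trans by (metis atLeastAtMost_iff order_refl)
  have "spectral_norm (Y \<tau> - Y 0) \<le> \<kappa> * \<tau>"
  proof (rule spectral_norm_leI)
    fix v
    \<comment> \<open>The control is an arbitrary function of time, so \<open>Y'\<close> need not be
      integrable; the mean value inequality takes the place of the integral in Duhamel's
      formula.\<close>
    have "norm (Y \<tau> *v v - Y 0 *v v) \<le> (\<kappa> * norm v) * norm (\<tau> - 0)"
    proof (rule differentiable_bound[of "{0..\<tau>}" "\<lambda>s. Y s *v v" "\<lambda>s h. h *\<^sub>R (Y' s *v v)"])
      fix s assume s: "s \<in> {0..\<tau>}"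
      show "((\<lambda>s. Y s *v v) has_derivative (\<lambda>h. h *\<^sub>R (Y' s *v v))) (at s within {0..\<tau>})"
        using bounded_linear.has_vector_derivative[OF bounded_linear_mv_left dY[OF s]]
        by (simp add: has_vector_derivative_def)
      show "onorm (\<lambda>h. h *\<^sub>R (Y' s *v v)) \<le> \<kappa> * norm v"
      proof (rule onorm_le)
        fix h :: real
        have "norm (Y' s *v v) \<le> \<kappa> * norm v"
          using norm_mv_le[of "Y' s" v] mult_right_mono[OF Y'n[OF s], of "norm v"] by simp
        then have "norm h * norm (Y' s *v v) \<le> norm h * (\<kappa> * norm v)" by (rule mult_left_mono) simp
        then show "norm (h *\<^sub>R (Y' s *v v)) \<le> \<kappa> * norm v * norm h" by (simp add: mult_ac)
      qed
    qed (use \<tau> in auto)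
    then show "norm ((Y \<tau> - Y 0) *v v) \<le> \<kappa> * \<tau> * norm v"
      using \<tau> by (simp add: matrix_vector_mult_diff_rdistrib mult_ac)
  qed
  also have "Y \<tau> - Y 0 = dagger (U \<tau>) ** (cscale (cis (c * \<tau>)) (U' \<tau>) - U \<tau>)"
    using uU[of \<tau>] \<tau> by (simp add: Y_def e U0 mult_diff_right cscale_mult_right unitary_def)
  also have "spectral_norm \<dots> = spectral_norm (cscale (cis (c * \<tau>)) (U' \<tau>) - U \<tau>)"
    using uU[of \<tau>] \<tau> by (simp add: spectral_norm_unitary_mult unitary_dagger)
  finally show ?thesis .
qed

text \<open>A pulse is the same for both parameters, and a control Hamiltonian cancels from the
  difference of generators. Under composition the errors add, the factors being unitary, while the
  phases multiply to the one of the total time.\<close>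

lemma controlled_perturbation:
  fixes H :: "real^'m::finite \<Rightarrow> 'd::finite cmat" and c \<kappa> :: real
  assumes "controlled H t U" and H: "\<And>\<theta>. hermitian (H \<theta>)"
    and \<kappa>: "spectral_norm (H \<theta>' - H \<theta> - cscale (complex_of_real c) (mat 1)) \<le> \<kappa>"
  shows "(\<forall>\<theta>. unitary (U \<theta>)) \<and> spectral_norm (cscale (cis (c * t)) (U \<theta>') - U \<theta>) \<le> \<kappa> * t"
  using assms(1)
proof induction
  case (pulse W)
  then show ?case by simp
next
  case (drive \<tau> Hc U)
  have h: "hermitian (H \<theta> + Hc s)" if "s \<in> {0..\<tau>}" for \<theta> s by (intro hermitian_add H drive.hyps(2) that)
  have "unitary (U \<theta> \<tau>)" for \<theta>
    by (rule hermitian_flow_unitary[of "U \<theta>" \<tau> "\<lambda>s. H \<theta> + Hc s"]) (use drive.hyps h in auto)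
  moreover have "spectral_norm (cscale (cis (c * \<tau>)) (U \<theta>' \<tau>) - U \<theta> \<tau>) \<le> \<kappa> * \<tau>"
    by (rule hermitian_flow_perturbation[of \<tau> "U \<theta>" "U \<theta>'" "\<lambda>s. H \<theta> + Hc s" "\<lambda>s. H \<theta>' + Hc s"])
      (use drive.hyps h \<kappa> in auto)
  ultimately show ?case by blast
next
  case (seq \<tau>\<^sub>1 U\<^sub>1 \<tau>\<^sub>2 U\<^sub>2)
  let ?V1 = "cscale (cis (c * \<tau>\<^sub>1)) (U\<^sub>1 \<theta>')" and ?V2 = "cscale (cis (c * \<tau>\<^sub>2)) (U\<^sub>2 \<theta>')"
  have u: "unitary (U\<^sub>1 \<theta>)" "unitary (U\<^sub>2 \<theta>)" for \<theta> using seq.IH by auto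
  have V1: "spectral_norm ?V1 \<le> 1"
    using spectral_norm_cscale[of "cis (c * \<tau>\<^sub>1)" "U\<^sub>1 \<theta>'"] unitary_spectral_norm[OF u(1)] order_trans by fastforce
  have "cscale (cis (c * (\<tau>\<^sub>1 + \<tau>\<^sub>2))) (U\<^sub>2 \<theta>' ** U\<^sub>1 \<theta>') - U\<^sub>2 \<theta> ** U\<^sub>1 \<theta> =
      (?V2 - U\<^sub>2 \<theta>) ** ?V1 + U\<^sub>2 \<theta> ** (?V1 - U\<^sub>1 \<theta>)"
    by (simp add: mult_diff_left mult_diff_right cscale_mult_left cscale_mult_right cscale_cscale cis_mult
        cscale_diff_right distrib_left add.commute)
  then have "spectral_norm (cscale (cis (c * (\<tau>\<^sub>1 + \<tau>\<^sub>2))) (U\<^sub>2 \<theta>' ** U\<^sub>1 \<theta>') - U\<^sub>2 \<theta> ** U\<^sub>1 \<theta>)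
      \<le> spectral_norm ((?V2 - U\<^sub>2 \<theta>) ** ?V1) + spectral_norm (U\<^sub>2 \<theta> ** (?V1 - U\<^sub>1 \<theta>))"
    by (simp only:) (rule spectral_norm_triangle)
  also have "\<dots> \<le> spectral_norm (?V2 - U\<^sub>2 \<theta>) * spectral_norm ?V1 + spectral_norm (?V1 - U\<^sub>1 \<theta>)"
    by (intro add_mono spectral_norm_mult) (simp add: spectral_norm_unitary_mult u)
  also have "\<dots> \<le> (\<kappa> * \<tau>\<^sub>2) * 1 + \<kappa> * \<tau>\<^sub>1"
    using seq.IH V1 spectral_norm_nonneg[of "?V2 - U\<^sub>2 \<theta>"]
    by (intro add_mono mult_mono spectral_norm_nonneg) auto
  finally show ?case using u by (auto simp: algebra_simps intro!: unitary_mult)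
qed

lemma with_ancilla_mv: "(with_ancilla A *v w) $ (i, k) = (A *v (\<chi> j. w $ (j, k))) $ i"
  for w :: "('n::finite \<times> 'k::finite) cvec"
proof -
  have "(with_ancilla A *v w) $ (i, k) = (\<Sum>j\<in>UNIV. \<Sum>l\<in>UNIV. (if k = l then A $ i $ j else 0) * w $ (j, l))"
    by (simp add: with_ancilla_def mat_nth sum.cartesian_product UNIV_Times_UNIV[symmetric] case_prod_unfold
        del: UNIV_Times_UNIV cong: if_cong)
  also have "\<dots> = (\<Sum>j\<in>UNIV. A $ i $ j * w $ (j, k))"
    by (simp add: if_distrib[where f="\<lambda>x. x * _"] cong: if_cong)
  finally show ?thesis by (simp add: mat_nth)
qed

text \<open>The ancilla label cuts a vector into slices on which \<open>A\<close> acts separately,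
  and their squared norms add. An ancilla therefore cannot increase the rate at which propagators
  move apart.\<close>

lemma spectral_norm_with_ancilla:
  "spectral_norm (with_ancilla A :: ('n::finite \<times> 'k::finite) cmat) \<le> spectral_norm A"
proof (rule spectral_norm_leI)
  fix w :: "('n \<times> 'k) cvec"
  have n2: "(norm u)\<^sup>2 = (\<Sum>k\<in>UNIV. (norm (\<chi> j. u $ (j, k)))\<^sup>2)" for u :: "('n \<times> 'k) cvec"
  proof -
    have sq: "(norm v)\<^sup>2 = (\<Sum>j\<in>UNIV. (cmod (v $ j))\<^sup>2)" for v :: "'i::finite cvec"
      by (simp add: norm_vec_def L2_set_def sum_nonneg)
    have "(norm u)\<^sup>2 = (\<Sum>j\<in>UNIV. \<Sum>k\<in>UNIV. (cmod (u $ (j, k)))\<^sup>2)"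
      by (simp add: sq sum.cartesian_product UNIV_Times_UNIV[symmetric] case_prod_unfold del: UNIV_Times_UNIV)
    also have "\<dots> = (\<Sum>k\<in>UNIV. \<Sum>j\<in>UNIV. (cmod (u $ (j, k)))\<^sup>2)" by (rule sum.swap)
    finally show ?thesis by (simp add: sq)
  qed
  have "(norm (with_ancilla A *v w))\<^sup>2 = (\<Sum>k\<in>UNIV. (norm (A *v (\<chi> j. w $ (j, k))))\<^sup>2)"
    unfolding n2 with_ancilla_mv by simp
  also have "\<dots> \<le> (\<Sum>k\<in>UNIV. (spectral_norm A * norm (\<chi> j. w $ (j, k)))\<^sup>2)"
    by (intro sum_mono power_mono norm_mv_le) auto
  also have "\<dots> = (spectral_norm A * norm w)\<^sup>2"
    by (simp add: power_mult_distrib n2[of w] sum_distrib_left)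
  finally show "norm (with_ancilla A *v w) \<le> spectral_norm A * norm w"
    by (rule power2_le_imp_le) (simp add: spectral_norm_nonneg)
qed

lemma with_ancilla_diff: "with_ancilla (A - B) = with_ancilla A - with_ancilla B"
  by (simp add: vec_eq_iff with_ancilla_def)
lemma with_ancilla_cscale: "with_ancilla (cscale c A) = cscale c (with_ancilla A)"
  by (simp add: vec_eq_iff with_ancilla_def mat_nth)
lemma with_ancilla_mat1: "with_ancilla (mat 1) = mat 1"
  by (auto simp: vec_eq_iff with_ancilla_def mat_def)
lemma hermitian_with_ancilla: "hermitian A \<Longrightarrow> hermitian (with_ancilla A)"
  by (auto simp: hermitian_def vec_eq_iff with_ancilla_def mat_nth)

section \<open>The lower bound\<close>

lemma psd_factor:
  fixes E :: "'d::finite cmat"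
  assumes "psd E" obtains R where "E = dagger R ** R"
proof -
  obtain b e where d: "diagonalizes b e E" using spectral_theorem assms unfolding psd_def by metis
  interpret onb b using diagonalizes_onb d .
  have E: "E = diag_op (\<lambda>k. complex_of_real (e k))" using d by (simp add: diagonalizes_iff)
  have e: "0 \<le> e k" if "k < CARD('d)" for k
  proof -
    have "0 \<le> Re (braket (b k) (E *v b k))" using assms by (simp add: psd_def)
    then show ?thesis using that by (simp add: E diag_op_basis braket_basis)
  qed
  have "E = diag_op (\<lambda>k. complex_of_real (sqrt (e k)) * complex_of_real (sqrt (e k)))"
    unfolding E by (rule diag_op_cong) (simp add: e flip: of_real_mult)
  then have "E = dagger (diag_op (\<lambda>k. complex_of_real (sqrt (e k)))) ** diag_op (\<lambda>k. complex_of_real (sqrt (e k)))"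
    by (simp add: dagger_diag_op diag_op_mult)
  then show ?thesis using that by blast
qed

text \<open>Operator Cauchy-Schwarz: the square of the averaged operator is at most the average of
  the squares. Effects are general positive matrices, so each is factored as
  \<open>dagger R ** R\<close>, and the factors together form an isometry.\<close>

lemma povm_square_le:
  fixes E :: "real \<Rightarrow> 'd::finite cmat" and w :: "real \<Rightarrow> real"
  assumes E: "povm E"
  defines "F \<equiv> \<Sum>x\<in>{x. E x \<noteq> 0}. cscale (complex_of_real (w x)) (E x)"
  shows "(norm (F *v v))\<^sup>2 \<le> (\<Sum>x\<in>{x. E x \<noteq> 0}. (w x)\<^sup>2 * Re (braket v (E x *v v)))"
proof -
  let ?S = "{x. E x \<noteq> 0}"
  have psd: "psd (E x)" for x using E by (simp add: povm_def)
  then have "\<exists>R. E x = dagger R ** R" for x using psd_factor by metis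
  then obtain R where R: "\<And>x. E x = dagger (R x) ** R x" by metis
  have ER: "braket u (E x *v u') = braket (R x *v u) (R x *v u')" for x u u'
    by (simp add: R matrix_vector_mul_assoc[symmetric] braket_mv)
  have one: "(\<Sum>x\<in>?S. (norm (R x *v u))\<^sup>2) = (norm u)\<^sup>2" for u
  proof -
    have "complex_of_real (\<Sum>x\<in>?S. (norm (R x *v u))\<^sup>2) = braket u ((\<Sum>x\<in>?S. E x) *v u)"
      unfolding sum_mv braket_sum_right ER by (simp add: braket_self)
    also have "\<dots> = complex_of_real ((norm u)\<^sup>2)" using E by (simp add: povm_def braket_self)
    finally show ?thesis using of_real_eq_iff by blast
  qed
  let ?u = "F *v v"
  have F: "braket u (F *v v) = (\<Sum>x\<in>?S. complex_of_real (w x) * braket (R x *v u) (R x *v v))" for u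
    unfolding F_def sum_mv cscale_mv braket_sum_right braket_smult_right ER ..
  have "(norm ?u)\<^sup>2 = Re (braket ?u ?u)" by (simp add: braket_self)
  also have "\<dots> = (\<Sum>x\<in>?S. w x * Re (braket (R x *v ?u) (R x *v v)))"
    unfolding F by simp
  \<comment> \<open>Young's inequality with equal weights: by completeness the first squares sum to
    half of the left-hand side and are absorbed there.\<close>
  also have "\<dots> \<le> (\<Sum>x\<in>?S. ((norm (R x *v ?u))\<^sup>2 + (w x)\<^sup>2 * (norm (R x *v v))\<^sup>2) / 2)"
  proof (rule sum_mono)
    fix x
    let ?r = "Re (braket (R x *v ?u) (R x *v v))"
    have "w x * ?r \<le> \<bar>w x\<bar> * \<bar>?r\<bar>" using abs_ge_self[of "w x * ?r"] by (simp add: abs_mult)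
    also have "\<dots> \<le> \<bar>w x\<bar> * (norm (R x *v ?u) * norm (R x *v v))"
      by (intro mult_left_mono order_trans[OF abs_Re_le_cmod norm_braket_le]) simp
    also have "\<dots> \<le> ((norm (R x *v ?u))\<^sup>2 + (\<bar>w x\<bar> * norm (R x *v v))\<^sup>2) / 2"
      using sum_squares_bound[of "norm (R x *v ?u)" "\<bar>w x\<bar> * norm (R x *v v)"] by (simp add: mult_ac)
    finally show "w x * Re (braket (R x *v ?u) (R x *v v)) \<le> ((norm (R x *v ?u))\<^sup>2 + (w x)\<^sup>2 * (norm (R x *v v))\<^sup>2) / 2"
      by (simp add: power_mult_distrib)
  qed
  also have "\<dots> = ((norm ?u)\<^sup>2 + (\<Sum>x\<in>?S. (w x)\<^sup>2 * (norm (R x *v v))\<^sup>2)) / 2"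
    by (simp add: sum_divide_distrib[symmetric] sum.distrib one)
  finally have "(norm ?u)\<^sup>2 \<le> (\<Sum>x\<in>?S. (w x)\<^sup>2 * (norm (R x *v v))\<^sup>2)" by simp
  then show ?thesis by (simp add: ER braket_self)
qed

text \<open>A mixed input is a convex combination of pure ones, so expectations can be estimated
  vector by vector and then averaged.\<close>

lemma density_diag:
  fixes \<rho> :: "'d::finite cmat"
  assumes "density_operator \<rho>"
  obtains b p where "onb b" "\<And>k. k < CARD('d) \<Longrightarrow> 0 \<le> p k" "(\<Sum>k<CARD('d). p k) = 1"
    "\<And>U X. trace (U ** \<rho> ** dagger U ** X) = (\<Sum>k<CARD('d). complex_of_real (p k) * braket (U *v b k) (X *v (U *v b k)))"
proof -
  have psd: "psd \<rho>" and tr: "trace \<rho> = 1" using assms by (simp_all add: density_operator_def)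
  obtain b p where d: "diagonalizes b p \<rho>" using spectral_theorem psd unfolding psd_def by metis
  interpret onb b using diagonalizes_onb d .
  have \<rho>: "\<rho> = diag_op (\<lambda>k. complex_of_real (p k))" using d by (simp add: diagonalizes_iff)
  have p: "0 \<le> p k" if "k < CARD('d)" for k
  proof -
    have "0 \<le> Re (braket (b k) (\<rho> *v b k))" using psd by (simp add: psd_def)
    then show ?thesis using that by (simp add: \<rho> diag_op_basis braket_basis)
  qed
  have "complex_of_real (\<Sum>k<CARD('d). p k) = complex_of_real 1" using tr by (simp add: \<rho> trace_diag_op)
  then have p1: "(\<Sum>k<CARD('d). p k) = 1" using of_real_eq_iff by blast
  have tr: "trace (U ** \<rho> ** dagger U ** X) = (\<Sum>k<CARD('d). complex_of_real (p k) * braket (U *v b k) (X *v (U *v b k)))" for U X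
  proof -
    have "trace (U ** \<rho> ** dagger U ** X) = trace (\<rho> ** (dagger U ** X ** U))"
      using trace_mul_sym[of U "\<rho> ** dagger U ** X"] by (simp add: matrix_mul_assoc)
    also have "\<dots> = (\<Sum>k<CARD('d). complex_of_real (p k) * braket (b k) ((dagger U ** X ** U) *v b k))"
      unfolding \<rho> by (rule trace_diag_op_mult)
    finally show ?thesis by (simp add: matrix_vector_mul_assoc[symmetric] braket_mv)
  qed
  show ?thesis by (rule that[OF onb_axioms p p1 tr])
qed

lemma smult_expectation:
  assumes "cmod z = 1" shows "braket (z *s u) (X *v (z *s u)) = braket u (X *v u)"
proof -
  have "cnj z * z = 1" using complex_norm_square[of z] assms by (simp add: mult.commute)
  then show ?thesis by (simp add: mv_cscale mult.assoc[symmetric] mult.commute)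
qed

text \<open>
  A finite-difference version of the quantum Cramer-Rao bound: it needs a Lipschitz bound on the
  propagators (up to a phase), but no differentiability in the parameter.
\<close>

lemma estimator_increment:
  fixes \<rho> U U' :: "'d::finite cmat" and E :: "real \<Rightarrow> 'd cmat" and f :: "real \<Rightarrow> real"
  assumes \<rho>: "density_operator \<rho>" and E: "povm E"
    and U: "unitary U" "unitary U'"
    and z: "cmod z = 1" and \<delta>: "spectral_norm (cscale z U' - U) \<le> \<delta>"
  defines "\<mu> \<equiv> \<lambda>U. est_mean E f (U ** \<rho> ** dagger U)"
    and "v \<equiv> est_var E f (U ** \<rho> ** dagger U)"
  defines "F \<equiv> \<Sum>x\<in>{x. E x \<noteq> 0}. cscale (complex_of_real (f x - \<mu> U)) (E x)"
  shows "\<bar>\<mu> U' - \<mu> U\<bar> \<le> 2 * \<delta> * sqrt v + spectral_norm F * \<delta>\<^sup>2"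
proof -
  let ?S = "{x. E x \<noteq> 0}"
  obtain b p where "onb b" and p: "\<And>k. k < CARD('d) \<Longrightarrow> 0 \<le> p k" and p1: "(\<Sum>k<CARD('d). p k) = 1"
    and tr: "\<And>U X. trace (U ** \<rho> ** dagger U ** X) = (\<Sum>k<CARD('d). complex_of_real (p k) * braket (U *v b k) (X *v (U *v b k)))"
    using density_diag[OF \<rho>] by blast
  interpret onb b by fact
  have psd: "psd (E x)" for x using E by (simp add: povm_def)
  have \<delta>0: "0 \<le> \<delta>" using \<delta> spectral_norm_nonneg order_trans by blast
  have hF: "hermitian F"
    using psd unfolding hermitian_def F_def dagger_sum
    by (intro sum.cong) (simp_all add: psd_def hermitian_def dagger_cscale)
  define m where "m = \<mu> U"
  have mean: "(\<Sum>k<CARD('d). p k * Re (braket (V *v b k) (F *v (V *v b k)))) = \<mu> V - m" if V: "unitary V" for V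
  proof -
    have "(\<Sum>k<CARD('d). p k * Re (braket (V *v b k) (F *v (V *v b k)))) = Re (trace (V ** \<rho> ** dagger V ** F))"
      unfolding tr by simp
    also have "\<dots> = (\<Sum>x\<in>?S. (f x - m) * Re (trace (V ** \<rho> ** dagger V ** E x)))"
      by (simp add: F_def m_def mult_sum_right cscale_mult_right trace_sum trace_cscale flip: of_real_diff)
    also have "\<dots> = \<mu> V - m * (\<Sum>x\<in>?S. Re (trace (V ** \<rho> ** dagger V ** E x)))"
      by (simp add: \<mu>_def est_mean_def left_diff_distrib sum_subtractf sum_distrib_left)
    also have "(\<Sum>x\<in>?S. Re (trace (V ** \<rho> ** dagger V ** E x))) = Re (trace (V ** \<rho> ** dagger V ** (\<Sum>x\<in>?S. E x)))"
      by (simp add: mult_sum_right trace_sum)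
    also have "\<dots> = (\<Sum>k<CARD('d). p k * (norm (V *v b k))\<^sup>2)"
      using E unfolding tr by (simp add: povm_def braket_self)
    also have "\<dots> = 1" using p1 by (simp add: unitary_norm[OF V] norm_basis)
    finally show ?thesis by simp
  qed
  define y where "y k = norm (F *v (U *v b k))" for k
  have yv: "(\<Sum>k<CARD('d). p k * (y k)\<^sup>2) \<le> v"
  proof -
    have "(\<Sum>k<CARD('d). p k * (y k)\<^sup>2) \<le>
        (\<Sum>k<CARD('d). p k * (\<Sum>x\<in>?S. (f x - m)\<^sup>2 * Re (braket (U *v b k) (E x *v (U *v b k)))))"
      unfolding y_def F_def m_def by (intro sum_mono mult_left_mono povm_square_le[OF E] p) auto
    also have "\<dots> = (\<Sum>x\<in>?S. \<Sum>k<CARD('d). p k * ((f x - m)\<^sup>2 * Re (braket (U *v b k) (E x *v (U *v b k)))))"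
      unfolding sum_distrib_left by (rule sum.swap)
    also have "\<dots> = v"
      unfolding v_def est_var_def tr m_def \<mu>_def by (simp add: sum_distrib_left mult_ac)
    finally show ?thesis .
  qed
  have ysum: "(\<Sum>k<CARD('d). p k * y k) \<le> sqrt v"
  proof (rule real_le_rsqrt)
    have "(\<Sum>k<CARD('d). p k * y k)\<^sup>2 = (\<Sum>k<CARD('d). sqrt (p k) * (sqrt (p k) * y k))\<^sup>2"
      using p by (intro arg_cong[where f = "\<lambda>x. x\<^sup>2"] sum.cong) (auto simp: mult.assoc[symmetric])
    also have "\<dots> \<le> (\<Sum>k<CARD('d). (sqrt (p k))\<^sup>2) * (\<Sum>k<CARD('d). (sqrt (p k) * y k)\<^sup>2)"
      by (rule Cauchy_Schwarz_ineq_sum)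
    also have "\<dots> = (\<Sum>k<CARD('d). p k) * (\<Sum>k<CARD('d). p k * (y k)\<^sup>2)"
      using p by (intro arg_cong2[where f = "(*)"] sum.cong) (auto simp: power_mult_distrib)
    also have "\<dots> \<le> v" using yv by (simp add: p1)
    finally show "(\<Sum>k<CARD('d). p k * y k)\<^sup>2 \<le> v" .
  qed
  have pt: "\<bar>Re (braket (U' *v b k) (F *v (U' *v b k))) - Re (braket (U *v b k) (F *v (U *v b k)))\<bar>
      \<le> 2 * \<delta> * y k + spectral_norm F * \<delta>\<^sup>2" if k: "k < CARD('d)" for k
  proof -
    let ?u = "U *v b k" and ?d = "(cscale z U' - U) *v b k"
    have d: "norm ?d \<le> \<delta>" using norm_mv_le[of "cscale z U' - U" "b k"] \<delta> by (simp add: norm_basis k)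
    have zu: "z *s (U' *v b k) = ?u + ?d" by (simp add: matrix_vector_mult_diff_rdistrib cscale_mv)
    have "braket (U' *v b k) (F *v (U' *v b k)) = braket (?u + ?d) (F *v (?u + ?d))"
      unfolding zu[symmetric] smult_expectation[OF z] ..
    \<comment> \<open>In the cross terms the displacement meets \<open>F *v ?u\<close>, whose
      averaged squared norm is at most the variance; the last term is quadratic in
      \<open>\<delta>\<close> and disappears in the derivative.\<close>
    also have "\<dots> = braket ?u (F *v ?u) + braket ?u (F *v ?d) + braket ?d (F *v ?u) + braket ?d (F *v ?d)"
      by (simp only: matrix_vector_right_distrib braket_add_left braket_add_right add.assoc) simp
    finally have "braket (U' *v b k) (F *v (U' *v b k)) - braket ?u (F *v ?u) =
        braket (F *v ?u) ?d + braket ?d (F *v ?u) + braket ?d (F *v ?d)"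
      using hF by (simp add: braket_mv[of ?u F ?d] hermitian_def)
    then have "\<bar>Re (braket (U' *v b k) (F *v (U' *v b k))) - Re (braket ?u (F *v ?u))\<bar> \<le>
        cmod (braket (F *v ?u) ?d + braket ?d (F *v ?u) + braket ?d (F *v ?d))"
      using abs_Re_le_cmod by (metis minus_complex.sel(1))
    also have "\<dots> \<le> cmod (braket (F *v ?u) ?d) + cmod (braket ?d (F *v ?u)) + cmod (braket ?d (F *v ?d))"
      by (intro order_trans[OF norm_triangle_ineq] add_mono norm_triangle_ineq order_refl)
    also have "\<dots> \<le> y k * norm ?d + norm ?d * y k + spectral_norm F * norm ?d * norm ?d"
      unfolding y_def by (intro add_mono norm_braket_le norm_braket_mv_le)
    also have "\<dots> \<le> y k * \<delta> + \<delta> * y k + spectral_norm F * \<delta> * \<delta>"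
      using d \<delta>0 by (intro add_mono mult_mono) (auto simp: y_def spectral_norm_nonneg)
    finally show ?thesis by (simp add: power2_eq_square)
  qed
  have "\<mu> U' - \<mu> U = (\<Sum>k<CARD('d). p k * (Re (braket (U' *v b k) (F *v (U' *v b k))) - Re (braket (U *v b k) (F *v (U *v b k)))))"
    using mean[OF U(1)] mean[OF U(2)] by (simp add: right_diff_distrib sum_subtractf)
  also have "\<bar>\<dots>\<bar> \<le> (\<Sum>k<CARD('d). p k * (2 * \<delta> * y k + spectral_norm F * \<delta>\<^sup>2))"
    by (rule order_trans[OF sum_abs], rule sum_mono)
      (use p pt in \<open>auto simp: abs_mult intro!: mult_left_mono\<close>)
  also have "\<dots> = 2 * \<delta> * (\<Sum>k<CARD('d). p k * y k) + spectral_norm F * \<delta>\<^sup>2 * (\<Sum>k<CARD('d). p k)"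
    unfolding sum_distrib_left sum.distrib[symmetric] by (rule sum.cong) (auto simp: algebra_simps)
  also have "\<dots> \<le> 2 * \<delta> * sqrt v + spectral_norm F * \<delta>\<^sup>2"
    using ysum \<delta>0 by (simp add: p1 mult_left_mono)
  finally show ?thesis .
qed

text \<open>Dividing by positive \<open>\<epsilon>\<close> and letting it tend to zero from the
  right removes the quadratic term.\<close>

lemma derivative_le_of_increments:
  fixes \<mu> :: "real^'m::finite \<Rightarrow> real"
  assumes d: "(\<mu> has_derivative (\<lambda>v. \<alpha> \<bullet> v)) (at \<theta>)"
    and inc: "\<And>\<epsilon>. 0 < \<epsilon> \<Longrightarrow> \<mu> (\<theta> + \<epsilon> *\<^sub>R v) - \<mu> \<theta> \<le> A * \<epsilon> + B * \<epsilon>\<^sup>2"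
  shows "\<alpha> \<bullet> v \<le> A"
proof -
  have "((\<lambda>\<epsilon>. \<mu> (\<theta> + \<epsilon> *\<^sub>R v)) has_derivative (\<lambda>\<epsilon>. \<alpha> \<bullet> (\<epsilon> *\<^sub>R v))) (at 0)"
    by (rule has_derivative_compose[of "\<lambda>\<epsilon>. \<theta> + \<epsilon> *\<^sub>R v" "\<lambda>\<epsilon>. \<epsilon> *\<^sub>R v" 0 UNIV \<mu> "\<lambda>v. \<alpha> \<bullet> v"])
      (use d in \<open>auto intro!: derivative_eq_intros\<close>)
  then have "((\<lambda>\<epsilon>. \<mu> (\<theta> + \<epsilon> *\<^sub>R v)) has_real_derivative \<alpha> \<bullet> v) (at 0)"
    by (simp add: has_field_derivative_def mult_commute_abs)
  then have "((\<lambda>\<epsilon>. (\<mu> (\<theta> + \<epsilon> *\<^sub>R v) - \<mu> \<theta>) / \<epsilon>) \<longlongrightarrow> \<alpha> \<bullet> v) (at 0)"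
    by (simp add: DERIV_def)
  then have 1: "((\<lambda>\<epsilon>. (\<mu> (\<theta> + \<epsilon> *\<^sub>R v) - \<mu> \<theta>) / \<epsilon>) \<longlongrightarrow> \<alpha> \<bullet> v) (at_right 0)"
    by (rule filterlim_mono) (auto simp: at_le)
  have "((\<lambda>\<epsilon>. A + B * \<epsilon>) \<longlongrightarrow> A + B * 0) (at_right 0)" by (intro tendsto_intros)
  then have 2: "((\<lambda>\<epsilon>. A + B * \<epsilon>) \<longlongrightarrow> A) (at_right 0)" by simp
  have ev: "\<forall>\<^sub>F \<epsilon> in at_right 0. (\<mu> (\<theta> + \<epsilon> *\<^sub>R v) - \<mu> \<theta>) / \<epsilon> \<le> A + B * \<epsilon>"
    using eventually_at_right_less[of 0]
  proof eventually_elim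
    case (elim \<epsilon>)
    have "\<mu> (\<theta> + \<epsilon> *\<^sub>R v) - \<mu> \<theta> \<le> (A + B * \<epsilon>) * \<epsilon>" using inc[OF elim] by (simp add: power2_eq_square algebra_simps)
    then show ?case using elim by (simp add: pos_divide_le_eq)
  qed
  show ?thesis by (rule tendsto_le[OF _ 2 1 ev]) simp
qed

context estimation
begin

theorem variance_lower_bound:
  fixes U :: "real^'m \<Rightarrow> ('n \<times> 'k::finite) cmat" and f :: "real \<Rightarrow> real"
  assumes t: "t > 0"
    and U: "controlled (\<lambda>\<theta>'. with_ancilla (drift g \<theta>')) t U"
    and \<rho>: "density_operator \<rho>" and E: "povm E"
  defines "\<mu> \<equiv> \<lambda>\<theta>'. est_mean E f (U \<theta>' ** \<rho> ** dagger (U \<theta>'))"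
  assumes lu: "locally_unbiased \<alpha> \<theta> \<mu>"
  shows "(gamma g \<alpha>)\<^sup>2 / t\<^sup>2 \<le> est_var E f (U \<theta> ** \<rho> ** dagger (U \<theta>))"
proof -
  let ?\<gamma> = "gamma g \<alpha>" and ?v = "est_var E f (U \<theta> ** \<rho> ** dagger (U \<theta>))"
  obtain v c where pos: "\<alpha> \<bullet> v > 0"
    and dir: "spectral_norm (drift g v - cscale (complex_of_real c) (mat 1)) \<le> (\<alpha> \<bullet> v) / (2 * ?\<gamma>)"
    by (rule dual_direction)
  define \<kappa> where "\<kappa> = (\<alpha> \<bullet> v) / (2 * ?\<gamma>)"
  define F where "F = (\<Sum>x\<in>{x. E x \<noteq> 0}. cscale (complex_of_real (f x - \<mu> \<theta>)) (E x))"
  have herm_H: "hermitian (with_ancilla (drift g \<theta>') :: ('n \<times> 'k) cmat)" for \<theta>'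
    by (intro hermitian_with_ancilla hermitian_drift)
  have "\<mu> (\<theta> + \<epsilon> *\<^sub>R v) - \<mu> \<theta> \<le> (2 * (\<kappa> * t) * sqrt ?v) * \<epsilon> + (spectral_norm F * (\<kappa> * t)\<^sup>2) * \<epsilon>\<^sup>2"
    if \<epsilon>: "0 < \<epsilon>" for \<epsilon>
  proof -
    let ?\<theta> = "\<theta> + \<epsilon> *\<^sub>R v"
    have "with_ancilla (drift g ?\<theta>) - with_ancilla (drift g \<theta>) - cscale (complex_of_real (\<epsilon> * c)) (mat 1) =
        cscale (complex_of_real \<epsilon>) (with_ancilla (drift g v - cscale (complex_of_real c) (mat 1)) :: ('n \<times> 'k) cmat)"
      by (simp add: drift_add drift_scaleR scaleR_cscale with_ancilla_diff[symmetric] with_ancilla_cscale[symmetric]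
          with_ancilla_mat1[symmetric] cscale_diff_right cscale_cscale)
    then have "spectral_norm (with_ancilla (drift g ?\<theta>) - with_ancilla (drift g \<theta>) - cscale (complex_of_real (\<epsilon> * c)) (mat 1) :: ('n \<times> 'k) cmat)
        \<le> \<epsilon> * spectral_norm (with_ancilla (drift g v - cscale (complex_of_real c) (mat 1)) :: ('n \<times> 'k) cmat)"
      using spectral_norm_cscale[of "complex_of_real \<epsilon>" "with_ancilla (drift g v - cscale (complex_of_real c) (mat 1)) :: ('n \<times> 'k) cmat"] \<epsilon>
      by simp
    also have "\<dots> \<le> \<epsilon> * \<kappa>"
      using \<epsilon> unfolding \<kappa>_def
      by (intro mult_left_mono order_trans[OF spectral_norm_with_ancilla dir]) simp
    finally have "(\<forall>\<theta>. unitary (U \<theta>)) \<and>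
        spectral_norm (cscale (cis (\<epsilon> * c * t)) (U ?\<theta>) - U \<theta>) \<le> \<epsilon> * \<kappa> * t"
      by (rule controlled_perturbation[OF U herm_H])
    then have "\<bar>\<mu> ?\<theta> - \<mu> \<theta>\<bar> \<le> 2 * (\<epsilon> * \<kappa> * t) * sqrt ?v + spectral_norm F * (\<epsilon> * \<kappa> * t)\<^sup>2"
      unfolding \<mu>_def F_def by (intro estimator_increment[OF \<rho> E]) auto
    then show ?thesis by (simp add: power_mult_distrib mult_ac abs_le_iff)
  qed
  then have "\<alpha> \<bullet> v \<le> 2 * (\<kappa> * t) * sqrt ?v"
    using lu unfolding locally_unbiased_def by (intro derivative_le_of_increments) auto
  \<comment> \<open>The factor \<open>\<alpha> \<bullet> v\<close> occurs on both sides, so the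
    length of \<open>v\<close> does not matter; the 2 from the two cross terms cancels the 2 of half
    the spread.\<close>
  then have "(\<alpha> \<bullet> v) * 1 \<le> (\<alpha> \<bullet> v) * (t * sqrt ?v / ?\<gamma>)"
    using gamma_pos by (simp add: \<kappa>_def field_simps)
  then have "1 \<le> t * sqrt ?v / ?\<gamma>" using pos by (simp only: mult_le_cancel_left_pos)
  then have le: "?\<gamma> / t \<le> sqrt ?v" using gamma_pos t by (simp add: field_simps)
  \<comment> \<open>\<open>sqrt\<close> is odd on the reals, so positivity is what lets
    \<open>(sqrt ?v)\<^sup>2\<close> be replaced by the variance.\<close>
  then have "0 < sqrt ?v" using gamma_pos t by (meson divide_pos_pos less_le_trans)
  moreover have "(?\<gamma> / t)\<^sup>2 \<le> (sqrt ?v)\<^sup>2" using le gamma_pos t by (intro power_mono) auto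
  ultimately show ?thesis by (simp add: power_divide)
qed

end

section \<open>Assembly for a minimizer: phase, switches, estimator and bias\<close>

section \<open>The swap protocol for a minimizer\<close>

locale optimal_protocol = estimation g \<alpha> + swap_protocol b a t xs ys
  for g :: "'m::finite \<Rightarrow> 'n::finite cmat" and \<alpha> :: "real^'m" and b :: "nat \<Rightarrow> 'n cvec"
    and a :: "nat \<Rightarrow> real" and t :: real and xs ys :: "nat list" +
  fixes A :: "'n cmat"
  assumes minA: "minimizer g \<alpha> A" and diagA: "diagonalizes b a A"

lemma (in estimation) optimal_protocolI:
  fixes A :: "'n cmat"
  assumes minA: "minimizer g \<alpha> A" and diagA: "diagonalizes b a A"
    and xs: "distinct xs" "set xs = {k. k < CARD('n) \<and> a k > 0}"
    and ys: "distinct ys" "set ys = {k. k < CARD('n) \<and> a k < 0}"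
    and t: "t > 0"
  shows "optimal_protocol g \<alpha> b a t xs ys A"
proof -
  interpret onb b using diagonalizes_onb diagA .
  have A: "A = diag_op (\<lambda>k. complex_of_real (a k))" using diagA by (simp add: diagonalizes_iff)
  have "complex_of_real (\<Sum>k<CARD('n). a k) = 0"
    using minA by (simp add: A minimizer_def feasible_def trace_diag_op)
  then have "(\<Sum>k<CARD('n). a k) = 0" using of_real_eq_0_iff by blast
  moreover have "\<exists>k<CARD('n). a k \<noteq> 0"
  proof (rule ccontr)
    assume "\<not> (\<exists>k<CARD('n). a k \<noteq> 0)"
    then have "trace_norm A = 0" using trace_norm_diagonalizes[OF diagA] by simp
    then show False using gamma_eq[OF minA] gamma_pos by simp
  qed
  ultimately show ?thesis by unfold_locales (use xs ys t minA diagA in auto)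
qed

context optimal_protocol
begin

lemma minimizer_trace_norm: "trace_norm A = 2 * gamma g \<alpha>"
  using gamma_eq[OF minA] by simp

lemma minimizer_dimension: "CARD('n) \<ge> 2"
  using ends_lt(1,2) last_ne by linarith

lemma protocol_phase:
  "2 * t / trace_norm A * (\<Sum>j\<in>UNIV. \<theta> $ j * Re (trace (A ** g j))) = (\<alpha> \<bullet> \<theta>) * t / gamma g \<alpha>"
proof -
  have "(\<Sum>j\<in>UNIV. \<theta> $ j * Re (trace (A ** g j))) = \<alpha> \<bullet> \<theta>"
    using minA by (simp add: minimizer_def feasible_def inner_vec_def mult.commute)
  then show ?thesis by (simp add: minimizer_trace_norm)
qed

lemma protocol_state:
  "\<exists>\<omega>. swap_state b a t xs ys (drift g \<theta>) =
    cis \<omega> *s ((1 / sqrt 2) *\<^sub>R (b (last xs) + cis ((\<alpha> \<bullet> \<theta>) * t / gamma g \<alpha>) *s b (last ys)))"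
proof -
  have A: "A = diag_op (\<lambda>k. complex_of_real (a k))" using diagA by (simp add: diagonalizes_iff)
  have "Re (trace (A ** drift g \<theta>)) = \<alpha> \<bullet> \<theta>"
    using feasible_trace_drift[of A \<theta>] minA by (simp add: minimizer_def)
  then have "2 * t / trace_norm A * Re (trace (A ** drift g \<theta>)) = (\<alpha> \<bullet> \<theta>) * t / gamma g \<alpha>"
    by (simp add: minimizer_trace_norm)
  then show ?thesis
    using swap_state_eq[OF hermitian_drift[of \<theta>]] unfolding A[symmetric] trace_norm_diagonalizes[OF diagA] by simp
qed

text \<open>Each of the two branches has one swap fewer than labels, and the labels are counted by
  the rank, so there are \<open>rank A - 2\<close> swaps.\<close>

lemma switches_less_rank:
  "length (swap_schedule b a t xs ys) < rank A"
  "rank A \<le> CARD('m) + 1 \<Longrightarrow> card (set xs) + card (set ys) \<le> CARD('m) + 1 \<and>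
    length (swap_schedule b a t xs ys) < CARD('m)"
proof -
  have "{k. k < CARD('n) \<and> a k \<noteq> 0} = set xs \<union> set ys" by (auto simp: xs ys)
  then have r: "rank A = card (set xs) + card (set ys)"
    using rank_diagonalizes[OF diagA] disjoint by (simp add: card_Un_disjoint)
  have "card (set xs) > 0" "card (set ys) > 0" using xs_ne ys_ne by (simp_all add: card_gt_0_iff)
  then show "length (swap_schedule b a t xs ys) < rank A"
    "rank A \<le> CARD('m) + 1 \<Longrightarrow> card (set xs) + card (set ys) \<le> CARD('m) + 1 \<and>
      length (swap_schedule b a t xs ys) < CARD('m)"
    unfolding schedule_length r by linarith+
qed

definition interference :: "'n cmat" where
  "interference = cscale \<i> (ketbra (b (last xs)) (b (last ys))) + dagger (cscale \<i> (ketbra (b (last xs)) (b (last ys))))"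

lemma hermitian_interference: "hermitian interference"
  by (simp add: hermitian_def interference_def dagger_add add.commute)

lemma protocol_measurement:
  fixes \<theta> :: "real^'m"
  defines "\<psi> \<equiv> swap_state b a t xs ys (drift g \<theta>)"
  shows "norm \<psi> = 1" "Re (braket \<psi> (interference *v \<psi>)) = - sin ((\<alpha> \<bullet> \<theta>) * t / gamma g \<alpha>)"
    "norm (interference *v \<psi>) = 1"
  using protocol_state[of \<theta>] interference_measurement[OF ends_lt(1,2) last_ne]
  unfolding \<psi>_def interference_def by metis+

lemma norm_initial_state: "norm (initial_state b xs ys) = 1"
  using interference_measurement(1)[OF ends_lt(3,4) hd_ne, of 0 0]
  by (simp only: initial_state_def cis_zero vector_smult_lid)

text \<open>The estimator is affine in the outcome and adapted to the operating point
  \<open>\<theta>\<close>: \<open>w\<close> inverts the slope of the interference fringe and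
  \<open>u\<close> corrects the value there. Where \<open>cos \<Phi>\<close> vanishes the fringe is
  flat and no such slope exists.\<close>

context
  fixes \<theta> :: "real^'m" and \<Phi> u w :: real
  assumes cos: "cos \<Phi> \<noteq> 0"
    and \<Phi>_def: "\<Phi> = (\<alpha> \<bullet> \<theta>) * t / gamma g \<alpha>"
    and w_def: "w = - gamma g \<alpha> / (t * cos \<Phi>)"
    and u_def: "u = \<alpha> \<bullet> \<theta> + w * sin \<Phi>"
begin

lemma estimator_mean:
  assumes "norm \<psi> = 1"
  shows "est_mean (observable interference) (\<lambda>x. u + w * x) (ketbra \<psi> \<psi>) = u + w * Re (braket \<psi> (interference *v \<psi>))"
  by (rule est_mean_affine[OF hermitian_interference assms])

lemma estimator_locally_unbiased:
  "locally_unbiased \<alpha> \<theta> (\<lambda>\<theta>'. est_mean (observable interference) (\<lambda>x. u + w * x)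
    (ketbra (swap_state b a t xs ys (drift g \<theta>')) (swap_state b a t xs ys (drift g \<theta>'))))"
proof -
  have eq: "est_mean (observable interference) (\<lambda>x. u + w * x)
      (ketbra (swap_state b a t xs ys (drift g \<theta>')) (swap_state b a t xs ys (drift g \<theta>'))) =
      u + w * (- sin ((\<alpha> \<bullet> \<theta>') * t / gamma g \<alpha>))" for \<theta>'
    using protocol_measurement[of \<theta>'] by (simp add: estimator_mean)
  have "((\<lambda>\<theta>'. u + w * (- sin ((\<alpha> \<bullet> \<theta>') * t / gamma g \<alpha>))) has_derivative
      (\<lambda>v. w * (- (((\<alpha> \<bullet> v) * t / gamma g \<alpha>) * cos \<Phi>)))) (at \<theta>)"
    unfolding \<Phi>_def by (auto intro!: derivative_eq_intros simp: divide_inverse)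
  moreover have "w * (- (((\<alpha> \<bullet> v) * t / gamma g \<alpha>) * cos \<Phi>)) = \<alpha> \<bullet> v" for v
    using t gamma_pos cos by (simp add: w_def)
  ultimately show ?thesis
    unfolding locally_unbiased_def eq by (simp add: u_def \<Phi>_def)
qed

text \<open>The outcome has variance \<open>(cos \<Phi>)\<^sup>2\<close>, which cancels against the
  cosine in the slope, so the variance is the same at every operating point.\<close>

lemma estimator_variance:
  "est_var (observable interference) (\<lambda>x. u + w * x)
    (ketbra (swap_state b a t xs ys (drift g \<theta>)) (swap_state b a t xs ys (drift g \<theta>))) = (gamma g \<alpha>)\<^sup>2 / t\<^sup>2"
proof -
  have "est_var (observable interference) (\<lambda>x. u + w * x)
    (ketbra (swap_state b a t xs ys (drift g \<theta>)) (swap_state b a t xs ys (drift g \<theta>))) = w\<^sup>2 * (1 - (sin \<Phi>)\<^sup>2)"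
    using protocol_measurement[of \<theta>] by (simp add: est_var_affine[OF hermitian_interference] \<Phi>_def)
  also have "\<dots> = (w * cos \<Phi>)\<^sup>2" by (simp add: power_mult_distrib cos_squared_eq)
  also have "w * cos \<Phi> = - (gamma g \<alpha> / t)" using cos by (simp add: w_def)
  finally show ?thesis by (simp add: power_divide)
qed

text \<open>The conditional mean is Lipschitz in the propagator and its deviation is bounded on
  unitaries, so convergence in probability implies convergence of its expectation. The good event
  alone yields the probability statement about the individual random states.\<close>

lemma reshaped_estimator:
  assumes \<eta>: "\<eta> > 0"
  shows "\<forall>\<^sub>F L in sequentially.
    let P = random_swap_state b a t xs ys (drift g \<theta>) L;
        \<mu> = (\<lambda>\<psi>. est_mean (observable interference) (\<lambda>x. u + w * x) (ketbra \<psi> \<psi>))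
    in (measure_pmf.expectation P \<mu> - \<alpha> \<bullet> \<theta>)\<^sup>2 \<le> \<eta> * ((gamma g \<alpha>)\<^sup>2 / t\<^sup>2) \<and>
       measure_pmf.prob P {\<psi>. (\<mu> \<psi> - \<alpha> \<bullet> \<theta>)\<^sup>2 \<le> \<eta> * ((gamma g \<alpha>)\<^sup>2 / t\<^sup>2)} \<ge> 1 - \<eta>"
proof -
  let ?H = "drift g \<theta>" and ?S = "swap_schedule b a t xs ys" and ?i = "initial_state b xs ys"
  define \<mu> where "\<mu> \<psi> = est_mean (observable interference) (\<lambda>x. u + w * x) (ketbra \<psi> \<psi>)" for \<psi>
  define q where "q = \<alpha> \<bullet> \<theta>"
  define G where "G = pulsed (evol (diag_part b ?H)) 0 ?S t"
  define R where "R L = random_pulsed (reshaped_evol b ?H L) 0 ?S t" for L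
  \<comment> \<open>The \<open>+ 1\<close> makes \<open>K\<close> positive at once, so that it can
    be divided by.\<close>
  define K where "K = 2 * \<bar>w\<bar> * spectral_norm interference + 1"
  have K: "K > 0" unfolding K_def using spectral_norm_nonneg[of interference] by (smt (verit) mult_nonneg_nonneg abs_ge_zero)
  have conv: "conv_in_prob R G" and uR: "\<And>L W. W \<in> set_pmf (R L) \<Longrightarrow> unitary W" and uG: "unitary G"
    using random_pulsed_conv[of "reshaped_evol b ?H" "evol (diag_part b ?H)" ?S 0 t]
      reshaped_evol_conv[OF hermitian_drift minimizer_dimension] unitary_reshaped_evol[OF hermitian_drift]
      unitary_evol[OF hermitian_diag_part[OF hermitian_drift]] schedule_unitary
    unfolding R_def G_def by blast+
  have G: "G *v ?i = swap_state b a t xs ys ?H" by (simp add: G_def swap_state_def)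
  have nW: "norm (W *v ?i) = 1" if "unitary W" for W
    using that by (simp add: unitary_norm norm_initial_state)
  have \<mu>G: "\<mu> (G *v ?i) = q"
    using protocol_measurement(2)[of \<theta>] by (simp add: \<mu>_def estimator_mean nW uG) (simp add: G u_def q_def \<Phi>_def)
  have dev: "\<bar>\<mu> (W *v ?i) - q\<bar> \<le> K * spectral_norm (G - W)" if W: "unitary W" for W
  proof -
    let ?m = "\<lambda>V. Re (braket (V *v ?i) (interference *v (V *v ?i)))"
    have "\<mu> (W *v ?i) - q = w * (?m W - ?m G)"
      unfolding \<mu>G[symmetric] by (simp add: \<mu>_def estimator_mean nW uG W right_diff_distrib)
    then have "\<bar>\<mu> (W *v ?i) - q\<bar> = \<bar>w\<bar> * \<bar>?m W - ?m G\<bar>" by (simp only: abs_mult)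
    also have "\<dots> \<le> \<bar>w\<bar> * (2 * spectral_norm interference * norm (W *v ?i - G *v ?i))"
      by (intro mult_left_mono expectation_value_lipschitz nW uG W) simp
    also have "norm (W *v ?i - G *v ?i) = norm ((G - W) *v ?i)"
      by (simp add: matrix_vector_mult_diff_rdistrib norm_minus_commute)
    also have "\<bar>w\<bar> * (2 * spectral_norm interference * norm ((G - W) *v ?i)) \<le> \<bar>w\<bar> * (2 * spectral_norm interference * spectral_norm (G - W))"
      using norm_mv_le[of "G - W" ?i] spectral_norm_nonneg[of interference]
      by (intro mult_left_mono) (auto simp: norm_initial_state)
    also have "\<dots> \<le> K * spectral_norm (G - W)"
      unfolding K_def using spectral_norm_nonneg[of "G - W"] by (simp add: algebra_simps)
    finally show ?thesis .
  qed
  have dev2: "\<bar>\<mu> (W *v ?i) - q\<bar> \<le> 2 * K" if W: "unitary W" for W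
  proof -
    have "spectral_norm (G - W) \<le> 2"
      using spectral_norm_diff[of G W] unitary_spectral_norm[OF uG] unitary_spectral_norm[OF W] by linarith
    from mult_left_mono[OF this less_imp_le[OF K]] dev[OF W] show ?thesis by linarith
  qed
  define r where "r = sqrt \<eta> * (gamma g \<alpha> / t)"
  have r: "r > 0" "r\<^sup>2 = \<eta> * ((gamma g \<alpha>)\<^sup>2 / t\<^sup>2)"
    using \<eta> t gamma_pos by (simp_all add: r_def power_mult_distrib power_divide)
  \<comment> \<open>The good event contributes \<open>K * \<epsilon>\<close> to the bias and the bad
    one \<open>2 * K\<close> times its probability, at most \<open>\<epsilon>\<close>: hence
    \<open>3 * K\<close>. The minimum with \<open>\<eta>\<close> serves the failure
    probability.\<close>
  define \<epsilon> where "\<epsilon> = min \<eta> (r / (3 * K))"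
  have \<epsilon>: "\<epsilon> > 0" "\<epsilon> \<le> \<eta>" using \<eta> r K by (auto simp: \<epsilon>_def)
  have "\<epsilon> \<le> r / (3 * K)" by (simp add: \<epsilon>_def)
  then have K\<epsilon>: "3 * K * \<epsilon> \<le> r" using K by (simp add: pos_le_divide_eq mult.commute)
  have "\<forall>\<^sub>F L in sequentially. measure_pmf.prob (R L) {V. spectral_norm (G - V) \<le> \<epsilon>} \<ge> 1 - \<epsilon>"
    using conv \<epsilon>(1) unfolding conv_in_prob_def by blast
  then have "\<forall>\<^sub>F L in sequentially. (measure_pmf.expectation (R L) (\<lambda>W. \<mu> (W *v ?i)) - q)\<^sup>2 \<le> r\<^sup>2 \<and>
      measure_pmf.prob (R L) {W. (\<mu> (W *v ?i) - q)\<^sup>2 \<le> r\<^sup>2} \<ge> 1 - \<eta>"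
  proof eventually_elim
    case (elim L)
    let ?good = "{V. spectral_norm (G - V) \<le> \<epsilon>}"
    let ?d = "\<lambda>W. \<mu> (W *v ?i) - q"
    have bad: "measure_pmf.prob (R L) (- ?good) \<le> \<epsilon>"
      using elim measure_pmf.prob_compl[of ?good "R L"] by (simp add: Compl_eq_Diff_UNIV)
    have bd: "AE W in measure_pmf (R L). \<bar>?d W\<bar> \<le> 2 * K"
      using dev2 uR by (simp add: AE_measure_pmf_iff)
    have int_d: "integrable (measure_pmf (R L)) ?d"
      by (rule measure_pmf.integrable_const_bound[where B = "2 * K"]) (use bd in simp_all)
    then have int: "integrable (measure_pmf (R L)) (\<lambda>W. ?d W + q)" by (intro Bochner_Integration.integrable_add) auto
    then have int_\<mu>: "integrable (measure_pmf (R L)) (\<lambda>W. \<mu> (W *v ?i))" by simp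
    have ind: "integrable (measure_pmf (R L)) (indicat_real (- ?good))"
      by (rule integrable_real_indicator) (auto simp: measure_pmf.emeasure_eq_measure)
    have "measure_pmf.expectation (R L) (\<lambda>W. \<mu> (W *v ?i)) - q = measure_pmf.expectation (R L) ?d"
      using int_\<mu> by simp
    then have "\<bar>measure_pmf.expectation (R L) (\<lambda>W. \<mu> (W *v ?i)) - q\<bar> \<le> measure_pmf.expectation (R L) (\<lambda>W. \<bar>?d W\<bar>)"
      using integral_abs_bound[of "measure_pmf (R L)" ?d] by simp
    also have "\<dots> \<le> measure_pmf.expectation (R L) (\<lambda>W. K * \<epsilon> + 2 * K * indicat_real (- ?good) W)"
    proof (rule integral_mono_AE)
      show "integrable (measure_pmf (R L)) (\<lambda>W. \<bar>?d W\<bar>)" using int_d by (rule integrable_abs)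
      show "integrable (measure_pmf (R L)) (\<lambda>W. K * \<epsilon> + 2 * K * indicat_real (- ?good) W)"
        by (intro Bochner_Integration.integrable_add integrable_mult_right measure_pmf.integrable_const ind)
      have "\<bar>?d W\<bar> \<le> K * \<epsilon> + 2 * K * indicat_real (- ?good) W" if "unitary W" for W
      proof (cases "W \<in> ?good")
        case True
        then have "K * spectral_norm (G - W) \<le> K * \<epsilon>" using K by (intro mult_left_mono) auto
        then show ?thesis using dev[OF that] True by simp
      next
        case False
        have "0 \<le> K * \<epsilon>" using K \<epsilon> by simp
        then show ?thesis using dev2[OF that] False by simp
      qed
      then show "AE W in measure_pmf (R L). \<bar>?d W\<bar> \<le> K * \<epsilon> + 2 * K * indicat_real (- ?good) W"
        using uR by (simp add: AE_measure_pmf_iff)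
    qed
    also have "\<dots> = K * \<epsilon> + 2 * K * measure_pmf.prob (R L) (- ?good)"
      using ind by (subst Bochner_Integration.integral_add) simp_all
    also have "\<dots> \<le> K * \<epsilon> + 2 * K * \<epsilon>" using bad K by simp
    also have "\<dots> \<le> r" using K\<epsilon> by simp
    finally have "\<bar>measure_pmf.expectation (R L) (\<lambda>W. \<mu> (W *v ?i)) - q\<bar> \<le> \<bar>r\<bar>" using r(1) by simp
    then have 1: "(measure_pmf.expectation (R L) (\<lambda>W. \<mu> (W *v ?i)) - q)\<^sup>2 \<le> r\<^sup>2"
      by (simp only: abs_le_square_iff)
    have "measure_pmf.prob (R L) ?good \<le> measure_pmf.prob (R L) {W. (?d W)\<^sup>2 \<le> r\<^sup>2}"
    proof (rule measure_pmf.finite_measure_mono_AE)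
      have "(?d W)\<^sup>2 \<le> r\<^sup>2" if "unitary W" "W \<in> ?good" for W
      proof -
        have "K * spectral_norm (G - W) \<le> K * \<epsilon>" using that K by (intro mult_left_mono) auto
        moreover have "0 \<le> K * \<epsilon>" using K \<epsilon> by simp
        ultimately have "\<bar>?d W\<bar> \<le> \<bar>r\<bar>" using dev[OF that(1)] K\<epsilon> by simp
        then show ?thesis by (simp only: abs_le_square_iff)
      qed
      then show "AE W in measure_pmf (R L). W \<in> ?good \<longrightarrow> W \<in> {W. (?d W)\<^sup>2 \<le> r\<^sup>2}"
        using uR by (simp add: AE_measure_pmf_iff)
    qed simp
    then show ?case using 1 elim \<epsilon>(2) by simp
  qed
  then show ?thesis
    unfolding Let_def random_swap_state_def R_def[symmetric] r(2)[symmetric] q_def[symmetric] \<mu>_def[symmetric]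
    by (simp add: vimage_def)
qed

end

end

theorem mainTheorem2:
  fixes g :: "'m::finite \<Rightarrow> 'n::finite cmat" and \<alpha> \<theta> :: "real^'m" and t :: real
  assumes herm: "\<And>j. hermitian (g j)"
    and traceless: "\<And>j. trace (g j) = 0"
    and lin_indep: "inj g" "independent (range g)"
    and \<alpha>: "\<alpha> \<noteq> 0"
    and t: "t > 0"
  shows "(\<exists>A b a. minimizer g \<alpha> A \<and> diagonalizes b a A \<and> rank A \<le> CARD('m) + 1) \<and>
    (\<forall>A b a xs ys.
      minimizer g \<alpha> A \<and> diagonalizes b a A \<and>
      distinct xs \<and> set xs = {k. k < CARD('n) \<and> a k > 0} \<and>
      distinct ys \<and> set ys = {k. k < CARD('n) \<and> a k < 0} \<longrightarrow>
      (let N = CARD('n); H0 = drift g \<theta>; Heff = diag_part b H0;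
           q = \<alpha> \<bullet> \<theta>; \<gamma> = gamma g \<alpha>;
           \<Phi> = 2 * t / trace_norm A * (\<Sum>j\<in>UNIV. \<theta> $ j * Re (trace (A ** g j)));
           K = cscale \<i> (ketbra (b (last xs)) (b (last ys)));
           M = K + dagger K;
           pure = (\<lambda>\<psi>. ketbra \<psi> \<psi>);
           switches = length (swap_schedule b a t xs ys)
       in
        \<comment> \<open>(i)\<close>
        (1 / real N) *\<^sub>R (\<Sum>s<N. dagger (phase_unitary b s) ** H0 ** phase_unitary b s) = Heff \<and>
        \<comment> \<open>(ii): the constant hidden in \<open>\<Omega>\<close> is \<open>10 ^ 4 * c\<close>, the same in every dimension \<open>N\<close>, for
          failure probability \<open>1 / N powr c\<close>\<close>
        (\<forall>c \<epsilon> L. c \<ge> 1 \<and> \<epsilon> > 0 \<and> L \<ge> 1 \<and>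
            real L \<ge> 10 ^ 4 * c * (ln (real N) * (spectral_norm H0)\<^sup>2 * t\<^sup>2 / \<epsilon>\<^sup>2) \<longrightarrow>
          measure_pmf.prob (reshaped_evol b H0 L t) {V. spectral_norm (evol Heff t - V) \<le> \<epsilon>}
            \<ge> 1 - real N powr (- c)) \<and>
        \<comment> \<open>(iii)\<close>
        \<Phi> = q * t / \<gamma> \<and>
        (\<exists>\<omega>. swap_state b a t xs ys H0 =
           cis \<omega> *s ((1 / sqrt 2) *\<^sub>R (b (last xs) + cis \<Phi> *s b (last ys)))) \<and>
        \<comment> \<open>(iv): estimator and its variance, bias under reshaping, lower bound\<close>
        povm (observable M) \<and>
        (cos \<Phi> \<noteq> 0 \<longrightarrow>
          (\<exists>f. locally_unbiased \<alpha> \<theta>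
                (\<lambda>\<theta>'. est_mean (observable M) f (pure (swap_state b a t xs ys (drift g \<theta>')))) \<and>
              est_var (observable M) f (pure (swap_state b a t xs ys H0)) = \<gamma>\<^sup>2 / t\<^sup>2 \<and>
              (\<forall>\<eta>>0. \<forall>\<^sub>F L in sequentially.
                let P = random_swap_state b a t xs ys H0 L;
                    \<mu> = (\<lambda>\<psi>. est_mean (observable M) f (pure \<psi>))
                in (measure_pmf.expectation P \<mu> - q)\<^sup>2 \<le> \<eta> * (\<gamma>\<^sup>2 / t\<^sup>2) \<and>
                   measure_pmf.prob P {\<psi>. (\<mu> \<psi> - q)\<^sup>2 \<le> \<eta> * (\<gamma>\<^sup>2 / t\<^sup>2)} \<ge> 1 - \<eta>))) \<and>
        (\<forall>(U :: real^'m \<Rightarrow> ('n \<times> 'k::finite) cmat) \<rho> E f.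
          let \<rho>t = (\<lambda>\<theta>'. U \<theta>' ** \<rho> ** dagger (U \<theta>'));
              \<mu> = (\<lambda>\<theta>'. est_mean E f (\<rho>t \<theta>'))
          in controlled (\<lambda>\<theta>'. with_ancilla (drift g \<theta>')) t U \<and> density_operator \<rho> \<and> povm E \<and>
             (unbiased \<alpha> \<mu> \<or> locally_unbiased \<alpha> \<theta> \<mu>) \<longrightarrow>
             est_var E f (\<rho>t \<theta>) \<ge> \<gamma>\<^sup>2 / t\<^sup>2) \<and>
        \<comment> \<open>(v)\<close>
        switches < rank A \<and>
        (rank A \<le> CARD('m) + 1 \<longrightarrow>
          card (set xs) + card (set ys) \<le> CARD('m) + 1 \<and> switches < CARD('m))))"
proof -
  interpret estimation g \<alpha>
    by unfold_locales (use herm traceless lin_indep \<alpha> in auto)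
  show ?thesis
  proof (intro conjI allI impI, goal_cases)
    case 1
    show ?case by (rule low_rank_minimizer)
  next
    case (2 A b a xs ys)
    then interpret optimal_protocol g \<alpha> b a t xs ys A
      using t by (intro optimal_protocolI) auto
    let ?\<Phi> = "(\<alpha> \<bullet> \<theta>) * t / gamma g \<alpha>"
    have M: "cscale \<i> (ketbra (b (last xs)) (b (last ys))) + dagger (cscale \<i> (ketbra (b (last xs)) (b (last ys)))) = interference"
      by (simp add: interference_def)
    have i: "(1 / real CARD('n)) *\<^sub>R (\<Sum>s<CARD('n). dagger (phase_unitary b s) ** drift g \<theta> ** phase_unitary b s) = diag_part b (drift g \<theta>)"
      by (rule twirl)
    have ii: "\<forall>c \<epsilon> L. c \<ge> 1 \<and> \<epsilon> > 0 \<and> L \<ge> 1 \<and>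
        real L \<ge> 10 ^ 4 * c * (ln (real CARD('n)) * (spectral_norm (drift g \<theta>))\<^sup>2 * t\<^sup>2 / \<epsilon>\<^sup>2) \<longrightarrow>
        measure_pmf.prob (reshaped_evol b (drift g \<theta>) L t)
          {V. spectral_norm (evol (diag_part b (drift g \<theta>)) t - V) \<le> \<epsilon>} \<ge> 1 - real CARD('n) powr (- c)"
      using reshaping_error[OF hermitian_drift] by blast
    have povm: "povm (observable interference)" by (rule povm_observable[OF hermitian_interference])
    have iv: "\<exists>f. locally_unbiased \<alpha> \<theta>
          (\<lambda>\<theta>'. est_mean (observable interference) f (ketbra (swap_state b a t xs ys (drift g \<theta>')) (swap_state b a t xs ys (drift g \<theta>')))) \<and>
        est_var (observable interference) f (ketbra (swap_state b a t xs ys (drift g \<theta>)) (swap_state b a t xs ys (drift g \<theta>))) = (gamma g \<alpha>)\<^sup>2 / t\<^sup>2 \<and>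
        (\<forall>\<eta>>0. \<forall>\<^sub>F L in sequentially.
          let P = random_swap_state b a t xs ys (drift g \<theta>) L;
              \<mu> = (\<lambda>\<psi>. est_mean (observable interference) f (ketbra \<psi> \<psi>))
          in (measure_pmf.expectation P \<mu> - \<alpha> \<bullet> \<theta>)\<^sup>2 \<le> \<eta> * ((gamma g \<alpha>)\<^sup>2 / t\<^sup>2) \<and>
             measure_pmf.prob P {\<psi>. (\<mu> \<psi> - \<alpha> \<bullet> \<theta>)\<^sup>2 \<le> \<eta> * ((gamma g \<alpha>)\<^sup>2 / t\<^sup>2)} \<ge> 1 - \<eta>)"
      if cos: "cos ?\<Phi> \<noteq> 0"
      using estimator_locally_unbiased[OF cos refl refl refl] estimator_variance[OF cos refl refl refl]
        reshaped_estimator[OF cos refl refl refl] by blast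
    have lower: "(gamma g \<alpha>)\<^sup>2 / t\<^sup>2 \<le> est_var E f (U \<theta> ** \<rho> ** dagger (U \<theta>))"
      if U: "controlled (\<lambda>\<theta>'. with_ancilla (drift g \<theta>')) t U" and \<rho>: "density_operator \<rho>" and E: "povm E"
        and u: "unbiased \<alpha> (\<lambda>\<theta>'. est_mean E f (U \<theta>' ** \<rho> ** dagger (U \<theta>'))) \<or>
          locally_unbiased \<alpha> \<theta> (\<lambda>\<theta>'. est_mean E f (U \<theta>' ** \<rho> ** dagger (U \<theta>')))"
      for U :: "real^'m \<Rightarrow> ('n \<times> 'k::finite) cmat" and \<rho> E f
    proof (rule variance_lower_bound[OF t U \<rho> E])
      \<comment> \<open>Unbiasedness for all parameters makes the mean equal to a linear function,
        which is its own derivative, so one bound covers both notions.\<close>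
      have "locally_unbiased \<alpha> \<theta> \<mu>" if "unbiased \<alpha> \<mu>" for \<mu>
      proof -
        have "\<mu> = (\<lambda>\<theta>. \<alpha> \<bullet> \<theta>)" using that by (auto simp: unbiased_def)
        then show ?thesis
          by (simp add: locally_unbiased_def bounded_linear_imp_has_derivative bounded_linear_inner_right)
      qed
      then show "locally_unbiased \<alpha> \<theta> (\<lambda>\<theta>'. est_mean E f (U \<theta>' ** \<rho> ** dagger (U \<theta>')))" using u by blast
    qed
    show ?case
      unfolding Let_def protocol_phase M
    proof (intro conjI)
      show "\<exists>\<omega>. swap_state b a t xs ys (drift g \<theta>) =
           cis \<omega> *s ((1 / sqrt 2) *\<^sub>R (b (last xs) + cis ?\<Phi> *s b (last ys)))"
        by (rule protocol_state)
    qed (use i ii povm iv[unfolded Let_def] lower switches_less_rank in blast)+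
  qed
qed

end
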